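(* Let $n\ge 1$ and let $X^{n,n+1}_{n+3}$ be the blow-up of $\mathbb{P}^n\times\mathbb{P}^{n+1}$ in $n+3$ points $p_1,\dots,p_{n+3}$ in general position. Let $C$ be the distinguished rational curve through $p_1,\dots,p_{n+3}$, let $1\le k\le n+1$, and let $\operatorname{BS}_k(C)\subset X^{n,n+1}_{n+3}$ be (the strict transform of) the $k$-th bilinear secant variety of $C$. Then an effective divisor $D=d_1H_1+d_2H_2-\sum_{i=1}^{n+3}m_iE_i$ contains $\operatorname{BS}_k(C)$ in its base locus at least $$\max\Big\{0,\;k\sum_{i=1}^{n+3}m_i-(nk+k-1)d_1-(nk+2k-1)d_2\Big\}$$ times.
   Context: We work over an algebraically closed field of characteristic zero. $H_1,H_2$ are the pullbacks of the hyperplane classes of the two factors and $E_i$ is the exceptional divisor over $p_i$. The distinguished rational curve $C$ is the unique irreducible curve of bidegree $(n,n+1)$ in $\mathbb{P}^n\times\mathbb{P}^{n+1}$ through $p_1,\dots,p_{n+3}$ (it exists and is smooth and rational; bidegree $(a,b)$ means intersection numbers $a$ and $b$ with the pullbacks of hyperplanes from the first and second factor). For points $z_1,\dots,z_k$ whose projections to each factor are linearly independent ("general" points), the bilinear span is $\operatorname{BL}(z_1,\dots,z_k)=L^1\times L^2$, where $L^j$ is the linear span of the projections to the $j$-th factor. The $k$-th bilinear secant variety is $\operatorname{BS}_k(C)=\overline{\bigcup\operatorname{BL}(z_1,\dots,z_k)}$, the union over $k$-tuples of general points $z_i\in C$. The statement that $D$ contains $V$ in its base locus at least $m$ times means that every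 effective divisor in $|D|$ has multiplicity at least $m$ along $V$ (at a general point of $V$; if $V$ is the whole variety this multiplicity is $0$). *)

theory Defs
  imports
    "HOL-Library.Poly_Mapping"
    "HOL-Computational_Algebra.Polynomial"
    "HOL-Computational_Algebra.Fraction_Field"
    Complex_Main
begin

hide_const (open) Rat.Fract

section \<open>Multiprojective spaces and their Zariski topology\<close>

type_synonym ('v, 'a) mpoly = "('v \<Rightarrow>\<^sub>0 nat) \<Rightarrow>\<^sub>0 'a"

definition Const :: "'a::zero \<Rightarrow> ('v, 'a) mpoly" where
  "Const c = Poly_Mapping.single 0 c"

definition Var :: "'v \<Rightarrow> ('v, 'a::zero_neq_one) mpoly" where
  "Var v = Poly_Mapping.single (Poly_Mapping.single v 1) 1"

text \<open>Apply \<open>h\<close> to the coefficients and substitute \<open>f v\<close> for each variable \<open>v\<close>.\<close>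

definition mpoly_subst :: "('a::zero \<Rightarrow> 'r::comm_ring_1) \<Rightarrow> ('v \<Rightarrow> 'r) \<Rightarrow> ('v, 'a) mpoly \<Rightarrow> 'r" where
  "mpoly_subst h f P =
     (\<Sum>m\<in>Poly_Mapping.keys P. h (Poly_Mapping.lookup P m) *
        (\<Prod>v\<in>Poly_Mapping.keys m. f v ^ Poly_Mapping.lookup m v))"

definition mpoly_eval :: "('v \<Rightarrow> 'a::comm_ring_1) \<Rightarrow> ('v, 'a) mpoly \<Rightarrow> 'a" where
  "mpoly_eval q P = mpoly_subst (\<lambda>c. c) q P"

text \<open>
  A finite set \<open>Vs\<close> of variables partitioned into blocks by \<open>blk\<close> describes a product of
  projective spaces, one factor for each block, the variables of the block being its homogeneous
  coordinates.  Points are given by their homogeneous coordinate vectors, nonzero in every block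
  (and, as a normalisation, zero outside \<open>Vs\<close>); two vectors are the same point iff they agree up to
  one nonzero scalar per block.  Zariski closed and open sets contain all coordinate vectors of
  each of their points.
\<close>

definition mproj :: "'v set \<Rightarrow> ('v \<Rightarrow> 'b) \<Rightarrow> ('v \<Rightarrow> 'a::field) set" where
  "mproj Vs blk =
     {q. (\<forall>v. v \<notin> Vs \<longrightarrow> q v = 0) \<and> (\<forall>b\<in>blk ` Vs. \<exists>v\<in>Vs. blk v = b \<and> q v \<noteq> 0)}"

definition same_point :: "('v \<Rightarrow> 'b) \<Rightarrow> ('v \<Rightarrow> 'a::field) \<Rightarrow> ('v \<Rightarrow> 'a) \<Rightarrow> bool" where
  "same_point blk u w \<longleftrightarrow> (\<exists>c. (\<forall>b. c b \<noteq> 0) \<and> (\<forall>v. u v = c (blk v) * w v))"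

definition mform :: "'v set \<Rightarrow> ('v \<Rightarrow> 'b) \<Rightarrow> ('b \<Rightarrow> nat) \<Rightarrow> ('v, 'a::zero) mpoly \<Rightarrow> bool" where
  "mform Vs blk d P \<longleftrightarrow>
     (\<forall>m\<in>Poly_Mapping.keys P. Poly_Mapping.keys m \<subseteq> Vs \<and>
        (\<forall>b. (\<Sum>v\<in>{v \<in> Poly_Mapping.keys m. blk v = b}. Poly_Mapping.lookup m v) = d b))"

definition zclosed :: "'v set \<Rightarrow> ('v \<Rightarrow> 'b) \<Rightarrow> ('v \<Rightarrow> 'a::field) set \<Rightarrow> bool" where
  "zclosed Vs blk Z \<longleftrightarrow>
     (\<exists>S. (\<forall>G\<in>S. \<exists>d. mform Vs blk d G) \<and>
          Z = {q \<in> mproj Vs blk. \<forall>G\<in>S. mpoly_eval q G = 0})"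

definition zopen :: "'v set \<Rightarrow> ('v \<Rightarrow> 'b) \<Rightarrow> ('v \<Rightarrow> 'a::field) set \<Rightarrow> bool" where
  "zopen Vs blk U \<longleftrightarrow> U \<subseteq> mproj Vs blk \<and> zclosed Vs blk (mproj Vs blk - U)"

definition zclosure :: "'v set \<Rightarrow> ('v \<Rightarrow> 'b) \<Rightarrow> ('v \<Rightarrow> 'a::field) set \<Rightarrow> ('v \<Rightarrow> 'a) set" where
  "zclosure Vs blk A = zclosed Vs blk hull A"


section \<open>The product of projective spaces of dimensions n and n+1\<close>

datatype pvar = X nat | Y nat

text \<open>
  The linear order is arbitrary; it only serves to make the polynomial ring in these variables an
  instance of \<open>idom\<close>, so that its fraction field is available.
\<close>

instantiation pvar :: linorder
begin

fun pvar_code :: "pvar \<Rightarrow> nat" where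
  "pvar_code (X j) = 2 * j"
| "pvar_code (Y j) = 2 * j + 1"

definition less_eq_pvar :: "pvar \<Rightarrow> pvar \<Rightarrow> bool" where
  "v \<le> w \<longleftrightarrow> pvar_code v \<le> pvar_code w"

definition less_pvar :: "pvar \<Rightarrow> pvar \<Rightarrow> bool" where
  "v < w \<longleftrightarrow> pvar_code v < pvar_code w"

instance
proof
  fix x y z :: pvar
  show "x < y \<longleftrightarrow> x \<le> y \<and> \<not> y \<le> x" "x \<le> x" "x \<le> y \<Longrightarrow> y \<le> z \<Longrightarrow> x \<le> z" "x \<le> y \<or> y \<le> x"
    by (auto simp: less_eq_pvar_def less_pvar_def)
  show "x \<le> y \<Longrightarrow> y \<le> x \<Longrightarrow> x = y"
    by (cases x; cases y) (auto simp: less_eq_pvar_def, presburger+)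
qed

end

datatype factor = First | Second

fun factor_of :: "pvar \<Rightarrow> factor" where
  "factor_of (X _) = First"
| "factor_of (Y _) = Second"

definition pvars :: "nat \<Rightarrow> pvar set" where
  "pvars n = X ` {..n} \<union> Y ` {..n + 1}"

abbreviation PP :: "nat \<Rightarrow> (pvar \<Rightarrow> 'a::field) set" where
  "PP n \<equiv> mproj (pvars n) factor_of"

text \<open>
  The \<open>(n+3)\<close>-tuples of points of \<open>PP n\<close> form again a multiprojective space; \<open>pt p i\<close> is the
  \<open>i\<close>-th point of the tuple \<open>p\<close>, with \<open>i < n + 3\<close>.
\<close>

definition tuple_vars :: "nat \<Rightarrow> (nat \<times> pvar) set" where
  "tuple_vars n = {..<n + 3} \<times> pvars n"

definition tuple_block :: "nat \<times> pvar \<Rightarrow> nat \<times> factor" where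
  "tuple_block = (\<lambda>(i, v). (i, factor_of v))"

definition pt :: "(nat \<times> pvar \<Rightarrow> 'a) \<Rightarrow> nat \<Rightarrow> pvar \<Rightarrow> 'a" where
  "pt p i v = p (i, v)"


section \<open>The blow-up in n+3 points\<close>

text \<open>
  The bilinear forms vanishing at \<open>p\<^sub>i = (a, b)\<close> are spanned by the \<open>2 \<times> 2\<close> minors
  \<open>x\<^sub>j y\<^sub>k a\<^sub>l b\<^sub>m - x\<^sub>l y\<^sub>m a\<^sub>j b\<^sub>k\<close> of the matrix with columns
  \<open>x \<otimes> y\<close> and \<open>a \<otimes> b\<close>, and they generate the ideal sheaf of \<open>p\<^sub>i\<close> twisted by \<open>(1,1)\<close>.  Hence the
  blow-up is the closure of the graph of the rational map with these minors as homogeneous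
  coordinates, where \<open>Exc i j k l m\<close> is the coordinate given by the minor above.
\<close>

datatype bvar = Base pvar | Exc nat nat nat nat nat

datatype block = Factor factor | Exceptional nat

fun block_of :: "bvar \<Rightarrow> block" where
  "block_of (Base v) = Factor (factor_of v)"
| "block_of (Exc i _ _ _ _) = Exceptional i"

definition bvars :: "nat \<Rightarrow> bvar set" where
  "bvars n = Base ` pvars n \<union>
     {Exc i j k l m | i j k l m. i < n + 3 \<and> j \<le> n \<and> k \<le> n + 1 \<and> l \<le> n \<and> m \<le> n + 1}"

fun graph_coord :: "(nat \<times> pvar \<Rightarrow> 'a::field) \<Rightarrow> bvar \<Rightarrow> (pvar, 'a) mpoly" where
  "graph_coord p (Base v) = Var v"
| "graph_coord p (Exc i j k l m) =
     Const (pt p i (X l) * pt p i (Y m)) * Var (X j) * Var (Y k)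
     - Const (pt p i (X j) * pt p i (Y k)) * Var (X l) * Var (Y m)"

definition graph_point :: "(nat \<times> pvar \<Rightarrow> 'a::field) \<Rightarrow> (pvar \<Rightarrow> 'a) \<Rightarrow> bvar \<Rightarrow> 'a" where
  "graph_point p x v = mpoly_eval x (graph_coord p v)"

text \<open>
  Intersecting with the multiprojective space removes the base points \<open>p\<^sub>i\<close>, where a whole block of
  coordinates vanishes.
\<close>

definition blow_up :: "nat \<Rightarrow> (nat \<times> pvar \<Rightarrow> 'a::field) \<Rightarrow> (bvar \<Rightarrow> 'a) set" where
  "blow_up n p =
     zclosure (bvars n) block_of (graph_point p ` PP n \<inter> mproj (bvars n) block_of)"

definition blow_down :: "(bvar \<Rightarrow> 'a) \<Rightarrow> pvar \<Rightarrow> 'a" where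
  "blow_down q v = q (Base v)"

definition strict_transform ::
    "nat \<Rightarrow> (nat \<times> pvar \<Rightarrow> 'a::field) \<Rightarrow> (pvar \<Rightarrow> 'a) set \<Rightarrow> (bvar \<Rightarrow> 'a) set" where
  "strict_transform n p V =
     zclosure (bvars n) block_of
       {q \<in> blow_up n p. blow_down q \<in> V \<and>
          (\<forall>i<n + 3. \<not> same_point factor_of (blow_down q) (pt p i))}"


section \<open>Local rings and divisors on the blow-up\<close>

text \<open>
  The function field of the blow-up is that of \<open>PP n\<close>, consisting of the quotients of forms of the
  same bidegree.
\<close>

definition function_field :: "nat \<Rightarrow> (pvar, 'a::field) mpoly fract set" where
  "function_field n =
     {Fract A B | A B d. mform (pvars n) factor_of d A \<and> mform (pvars n) factor_of d B \<and> B \<noteq> 0}"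

definition restrict_form :: "(nat \<times> pvar \<Rightarrow> 'a::field) \<Rightarrow> (bvar, 'a) mpoly \<Rightarrow> (pvar, 'a) mpoly" where
  "restrict_form p A = mpoly_subst Const (graph_coord p) A"

text \<open>
  The local ring of the blow-up at \<open>q\<close> and its maximal ideal, as subsets of the function field: a
  quotient of multihomogeneous forms of equal multidegree on the ambient multiprojective space
  restricts to a rational function on the (dense) graph.
\<close>

definition local_ring ::
    "nat \<Rightarrow> (nat \<times> pvar \<Rightarrow> 'a::field) \<Rightarrow> (bvar \<Rightarrow> 'a) \<Rightarrow> (pvar, 'a) mpoly fract set" where
  "local_ring n p q =
     {Fract (restrict_form p A) (restrict_form p B) | A B d.
        mform (bvars n) block_of d A \<and> mform (bvars n) block_of d B \<and> mpoly_eval q B \<noteq> 0}"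

definition max_ideal ::
    "nat \<Rightarrow> (nat \<times> pvar \<Rightarrow> 'a::field) \<Rightarrow> (bvar \<Rightarrow> 'a) \<Rightarrow> (pvar, 'a) mpoly fract set" where
  "max_ideal n p q =
     {Fract (restrict_form p A) (restrict_form p B) | A B d.
        mform (bvars n) block_of d A \<and> mform (bvars n) block_of d B \<and> mpoly_eval q B \<noteq> 0 \<and>
        mpoly_eval q A = 0}"

definition ideal_prod :: "'r::comm_ring_1 set \<Rightarrow> 'r set \<Rightarrow> 'r set" where
  "ideal_prod I J = {(\<Sum>t<(N::nat). f t * g t) | N f g. \<forall>t<N. f t \<in> I \<and> g t \<in> J}"

primrec max_ideal_power ::
    "nat \<Rightarrow> (nat \<times> pvar \<Rightarrow> 'a::field) \<Rightarrow> (bvar \<Rightarrow> 'a) \<Rightarrow> nat \<Rightarrow> (pvar, 'a) mpoly fract set" where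
  "max_ideal_power n p q 0 = local_ring n p q"
| "max_ideal_power n p q (Suc r) = ideal_prod (max_ideal n p q) (max_ideal_power n p q r)"

text \<open>
  A Cartier divisor is represented by a family of local equations, indexed by the points of the
  blow-up, in the function field.
\<close>

type_synonym 'a divisor = "(bvar \<Rightarrow> 'a) \<Rightarrow> (pvar, 'a) mpoly fract"

text \<open>The pullbacks of the hyperplanes \<open>x\<^sub>0 = 0\<close> and \<open>y\<^sub>0 = 0\<close>.\<close>

definition H1 :: "('a::field) divisor" where
  "H1 q = Fract (Var (X 0)) (Var (X (LEAST j. q (Base (X j)) \<noteq> 0)))"

definition H2 :: "('a::field) divisor" where
  "H2 q = Fract (Var (Y 0)) (Var (Y (LEAST k. q (Base (Y k)) \<noteq> 0)))"

text \<open>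
  The exceptional divisor over \<open>p\<^sub>i\<close> is the effective Cartier divisor whose ideal sheaf is the inverse
  image of the ideal sheaf of \<open>p\<^sub>i\<close>: its stalk at \<open>q\<close> is generated by the rational functions \<open>A/B\<close>
  regular at the image of \<open>q\<close> with \<open>A\<close> vanishing at \<open>p\<^sub>i\<close>.  It is the unit ideal if \<open>q\<close> does not lie
  over \<open>p\<^sub>i\<close>.  A local equation is a generator of the stalk; it is unique up to units.
\<close>

definition exceptional_ideal ::
    "nat \<Rightarrow> (nat \<times> pvar \<Rightarrow> 'a::field) \<Rightarrow> nat \<Rightarrow> (bvar \<Rightarrow> 'a) \<Rightarrow> (pvar, 'a) mpoly fract set" where
  "exceptional_ideal n p i q =
     ideal_prod
       {Fract A B | A B d. mform (pvars n) factor_of d A \<and> mform (pvars n) factor_of d B \<and>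
          mpoly_eval (blow_down q) B \<noteq> 0 \<and> mpoly_eval (pt p i) A = 0}
       (local_ring n p q)"

definition exc_divisor :: "nat \<Rightarrow> (nat \<times> pvar \<Rightarrow> 'a::field) \<Rightarrow> nat \<Rightarrow> 'a divisor" where
  "exc_divisor n p i q = (SOME e. exceptional_ideal n p i q = (\<lambda>g. e * g) ` local_ring n p q)"

text \<open>The divisor \<open>d\<^sub>1 H\<^sub>1 + d\<^sub>2 H\<^sub>2 - \<Sum> m\<^sub>i E\<^sub>i\<close>.\<close>

definition class_divisor ::
    "nat \<Rightarrow> (nat \<times> pvar \<Rightarrow> 'a::field) \<Rightarrow> int \<Rightarrow> int \<Rightarrow> (nat \<Rightarrow> int) \<Rightarrow> 'a divisor" where
  "class_divisor n p d1 d2 m q =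
     (H1 q powi d1) * (H2 q powi d2) * (\<Prod>i<n + 3. exc_divisor n p i q powi (- m i))"

text \<open>The effective divisors linearly equivalent to \<open>\<Delta>\<close>.\<close>

definition linear_system ::
    "nat \<Rightarrow> (nat \<times> pvar \<Rightarrow> 'a::field) \<Rightarrow> 'a divisor \<Rightarrow> 'a divisor set" where
  "linear_system n p \<Delta> =
     {(\<lambda>q. f * \<Delta> q) | f. f \<in> function_field n \<and> f \<noteq> 0 \<and>
        (\<forall>q\<in>blow_up n p. f * \<Delta> q \<in> local_ring n p q)}"

definition mult_at_least ::
    "nat \<Rightarrow> (nat \<times> pvar \<Rightarrow> 'a::field) \<Rightarrow> 'a divisor \<Rightarrow> (bvar \<Rightarrow> 'a) \<Rightarrow> nat \<Rightarrow> bool" where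
  "mult_at_least n p D q r \<longleftrightarrow> D q \<in> max_ideal_power n p q r"

text \<open>Multiplicity along a subvariety \<open>V\<close>, taken at its general points: on a dense open subset of it.\<close>

definition mult_along_at_least ::
    "nat \<Rightarrow> (nat \<times> pvar \<Rightarrow> 'a::field) \<Rightarrow> 'a divisor \<Rightarrow> (bvar \<Rightarrow> 'a) set \<Rightarrow> nat \<Rightarrow> bool" where
  "mult_along_at_least n p D V r \<longleftrightarrow>
     (\<exists>W. zopen (bvars n) block_of W \<and> V \<subseteq> zclosure (bvars n) block_of (V \<inter> W) \<and>
        (\<forall>q\<in>V \<inter> W. mult_at_least n p D q r))"

definition in_base_locus_at_least ::
    "nat \<Rightarrow> (nat \<times> pvar \<Rightarrow> 'a::field) \<Rightarrow> 'a divisor \<Rightarrow> (bvar \<Rightarrow> 'a) set \<Rightarrow> nat \<Rightarrow> bool" where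
  "in_base_locus_at_least n p \<Delta> V r \<longleftrightarrow>
     (\<forall>D\<in>linear_system n p \<Delta>. mult_along_at_least n p D V r)"


section \<open>The distinguished rational curve and its bilinear secant varieties\<close>

text \<open>Value at \<open>(s, t)\<close> of the binary form \<open>\<Sum> c\<^sub>j s\<^sup>j t\<^sup>a\<^sup>-\<^sup>j\<close> of degree \<open>a\<close>, where \<open>c\<^sub>j\<close> are the coefficients of \<open>f\<close>.\<close>

definition binary_form :: "nat \<Rightarrow> 'a::field poly \<Rightarrow> 'a \<Rightarrow> 'a \<Rightarrow> 'a" where
  "binary_form a f s t = (\<Sum>j\<le>a. coeff f j * s ^ j * t ^ (a - j))"

definition curve_point ::
    "nat \<Rightarrow> nat \<Rightarrow> nat \<Rightarrow> (pvar \<Rightarrow> 'a::field poly) \<Rightarrow> 'a \<Rightarrow> 'a \<Rightarrow> pvar \<Rightarrow> 'a" where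
  "curve_point n a b f s t v =
     (if v \<in> pvars n then binary_form (case factor_of v of First \<Rightarrow> a | Second \<Rightarrow> b) (f v) s t else 0)"

text \<open>
  \<open>C\<close> is an irreducible rational curve of bidegree \<open>(a, b)\<close>: the image of a morphism from the
  projective line which is birational onto \<open>C\<close> (injective up to finitely many points, the
  characteristic being zero), i.e. the normalisation of \<open>C\<close>.  The intersection number of \<open>C\<close> with
  the pullback of a hyperplane of a factor is the degree of its pullback to the normalisation,
  which is the degree of the forms defining the morphism to that factor.
\<close>

definition rational_curve :: "nat \<Rightarrow> nat \<Rightarrow> nat \<Rightarrow> (pvar \<Rightarrow> 'a::field) set \<Rightarrow> bool" where
  "rational_curve n a b C \<longleftrightarrow>
     (\<exists>f :: pvar \<Rightarrow> 'a poly.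
        (\<forall>v\<in>pvars n. degree (f v) \<le> (case factor_of v of First \<Rightarrow> a | Second \<Rightarrow> b)) \<and>
        (\<forall>s t. (s, t) \<noteq> (0, 0) \<longrightarrow> curve_point n a b f s t \<in> PP n) \<and>
        (\<exists>T. finite T \<and>
           (\<forall>s s'. s \<notin> T \<longrightarrow> s' \<notin> T \<longrightarrow>
              same_point factor_of (curve_point n a b f s 1) (curve_point n a b f s' 1) \<longrightarrow> s = s')) \<and>
        C = {x \<in> PP n. \<exists>s t. (s, t) \<noteq> (0, 0) \<and> same_point factor_of x (curve_point n a b f s t)})"

definition distinguished_curve ::
    "nat \<Rightarrow> (nat \<times> pvar \<Rightarrow> 'a::field) \<Rightarrow> (pvar \<Rightarrow> 'a) set \<Rightarrow> bool" where
  "distinguished_curve n p C \<longleftrightarrow> rational_curve n n (n + 1) C \<and> (\<forall>i<n + 3. pt p i \<in> C)"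

definition general_points :: "nat \<Rightarrow> nat \<Rightarrow> (nat \<Rightarrow> pvar \<Rightarrow> 'a::field) \<Rightarrow> bool" where
  "general_points n k z \<longleftrightarrow>
     (\<forall>b c. (\<forall>v\<in>pvars n. factor_of v = b \<longrightarrow> (\<Sum>i<k. c i * z i v) = 0) \<longrightarrow> (\<forall>i<k. c i = 0))"

definition bilinear_span :: "nat \<Rightarrow> nat \<Rightarrow> (nat \<Rightarrow> pvar \<Rightarrow> 'a::field) \<Rightarrow> (pvar \<Rightarrow> 'a) set" where
  "bilinear_span n k z =
     {x \<in> PP n. \<forall>b. \<exists>c. \<forall>v\<in>pvars n. factor_of v = b \<longrightarrow> x v = (\<Sum>i<k. c i * z i v)}"

definition BS :: "nat \<Rightarrow> nat \<Rightarrow> (pvar \<Rightarrow> 'a::field) set \<Rightarrow> (pvar \<Rightarrow> 'a) set" where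
  "BS n k C =
     zclosure (pvars n) factor_of
       (\<Union>z\<in>{z. (\<forall>i<k. z i \<in> C) \<and> general_points n k z}. bilinear_span n k z)"

end

theory Submission
  imports Defs "Jordan_Normal_Form.Char_Poly"
begin

text \<open>
  An effective divisor in the class \<open>d\<^sub>1 H\<^sub>1 + d\<^sub>2 H\<^sub>2 - \<Sum> m\<^sub>i E\<^sub>i\<close> is given by a single form \<open>G\<close> of
  bidegree \<open>(d\<^sub>1, d\<^sub>2)\<close> (\<open>section_is_form\<close>) that vanishes at \<open>p\<^sub>i\<close> to order at least \<open>m\<^sub>i\<close>
  (\<open>section_vanishes_at_point\<close>).  Away from the exceptional divisors the multiplicity of the divisor
  is the multiplicity of \<open>G\<close>, so the assertion is one about forms.  It has two halves.
  
  The curve.  Put \<open>r = \<Sum> m\<^sub>i - n d\<^sub>1 - (n + 1) d\<^sub>2\<close>, which is minus the intersection number of the divisor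
  with the strict transform of \<open>C\<close>.  The normal bundle of that strict transform is a sum of copies of
  \<open>\<O>(-1)\<close>, and this forces \<open>G\<close> to vanish along \<open>C\<close> to order \<open>r\<close>.  In elementary terms: choose a
  parameter on \<open>C\<close> that is 0 at the point \<open>z\<close> and \<open>\<tau>\<^sub>l\<close> at \<open>p\<^sub>l\<close>.  By Lagrange interpolation \<open>C\<close> is
  determined by the nodes \<open>\<tau>\<^sub>l\<close>, \<open>l \<le> n + 1\<close>, and by coefficients proportional to the points \<open>p\<^sub>l\<close>.
  Changing the nodes and the factors of proportionality to first order in \<open>\<epsilon>\<close> gives curves of the same
  bidegree through \<open>p\<^sub>0, \<dots>, p\<^sub>n\<^sub>+\<^sub>1\<close> whose point with parameter 0 moves away from \<open>z\<close> in any prescribed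
  direction.  Restrict \<open>G\<close> to this family.  The lowest nonzero coefficient \<open>P\<^sub>e(t)\<close> of the resulting polynomial
  in \<open>\<epsilon>\<close> has degree at most \<open>n d\<^sub>1 + (n + 1) d\<^sub>2\<close>, it is divisible by \<open>(t - \<tau>\<^sub>l)\<close> to the power \<open>m\<^sub>l\<close> for \<open>l \<le> n + 1\<close>,
  and by \<open>(t - \<tau>\<^sub>l)\<close> to the power \<open>m\<^sub>l - e\<close> for the last point, which the family misses.  Counting zeros gives
  \<open>e \<ge> r\<close> (\<open>multiplicity_along_curve\<close>).
  
  The span.  Let \<open>G\<close> vanish to order \<open>r\<close> at \<open>z\<^sub>1, \<dots>, z\<^sub>k\<close>, and expand \<open>G(\<Sum> A\<^sub>i z\<^sub>i + W)\<close> into monomials, with one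
  variable \<open>A\<^sub>i\<close> for each point and each factor.  In every monomial the degree in all variables except the
  two \<open>A\<^sub>i\<close> is at least \<open>r\<close>, for every \<open>i\<close>, while the total degree is \<open>d\<^sub>1 + d\<^sub>2\<close>.  Adding the \<open>k\<close>
  inequalities, the degree in \<open>W\<close> is at least \<open>k r - (k - 1) (d\<^sub>1 + d\<^sub>2)\<close>
  (\<open>multiplicity_along_span\<close>), and this is the number in the theorem.
  
  Vanishing to a given order is the vanishing of forms, the Hasse derivatives of \<open>G\<close>, so the bound
  passes from the spans to their closure and to the strict transform.
  
  Representing a divisor by a form rests on the fact that a quotient of forms that is regular off finitely
  many points is a form (\<open>form_quotient_polynomial\<close>): restricted to a general line it is a polynomial in one
  variable, so division with remainder by a form that is monic in the direction of the line leaves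
  remainder 0.  The order of vanishing at \<open>p\<^sub>i\<close> is read off from general lines through \<open>p\<^sub>i\<close>: their strict
  transforms meet \<open>E\<^sub>i\<close> in points at which one of the minors that define the blow-up is a local equation of \<open>E\<^sub>i\<close>
  (\<open>exc_divisor_over_point\<close>).
\<close>

section \<open>Substitution into polynomials\<close>

abbreviation (input) keys where "keys \<equiv> Poly_Mapping.keys"

abbreviation (input) lookup where "lookup \<equiv> Poly_Mapping.lookup"

lemma poly_mapping_as_sum:
  fixes P :: "'b \<Rightarrow>\<^sub>0 'a::comm_monoid_add"
  shows "P = (\<Sum>m\<in>keys P. Poly_Mapping.single m (lookup P m))"
  by (intro poly_mapping_eqI)
     (auto simp: lookup_sum lookup_single when_def sum.delta' not_in_keys_iff_lookup_eq_zero)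

definition mono_val :: "('v \<Rightarrow> 'r::comm_ring_1) \<Rightarrow> ('v \<Rightarrow>\<^sub>0 nat) \<Rightarrow> 'r" where
  "mono_val f m = (\<Prod>v\<in>keys m. f v ^ lookup m v)"

lemma mono_val_superset:
  assumes "finite S" "keys m \<subseteq> S"
  shows "mono_val f m = (\<Prod>v\<in>S. f v ^ lookup m v)"
  unfolding mono_val_def
  by (rule prod.mono_neutral_left) (use assms in \<open>auto simp: in_keys_iff\<close>)

lemma mono_val_0 [simp]: "mono_val f 0 = 1"
  by (simp add: mono_val_def)

lemma mono_val_single [simp]: "mono_val f (Poly_Mapping.single v k) = f v ^ k"
  by (subst mono_val_superset[of "{v}"]) auto

lemma mono_val_add: "mono_val f (m + m') = mono_val f m * mono_val f m'"
proof -
  let ?S = "keys m \<union> keys m'"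
  have "mono_val f (m + m') = (\<Prod>v\<in>?S. f v ^ lookup (m + m') v)"
    by (rule mono_val_superset) (auto dest: subsetD[OF keys_add])
  also have "\<dots> = mono_val f m * mono_val f m'"
    by (simp add: lookup_add power_add prod.distrib mono_val_superset[of ?S])
  finally show ?thesis .
qed

lemma mono_val_scale: "mono_val (\<lambda>v. a v * b v) m = mono_val a m * mono_val b m"
  by (simp add: mono_val_def power_mult_distrib prod.distrib)

lemma mono_val_hom:
  assumes "comm_ring_hom g"
  shows "g (mono_val f m) = mono_val (\<lambda>v. g (f v)) m"
proof -
  interpret comm_ring_hom g by fact
  show ?thesis by (simp add: mono_val_def hom_distribs)
qed

lemma mpoly_subst_alt:
  "mpoly_subst h f P = (\<Sum>m\<in>keys P. h (lookup P m) * mono_val f m)"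
  by (simp add: mpoly_subst_def mono_val_def)

lemma mpoly_subst_superset:
  assumes "h 0 = 0" "finite S" "keys P \<subseteq> S"
  shows "mpoly_subst h f P = (\<Sum>m\<in>S. h (lookup P m) * mono_val f m)"
  unfolding mpoly_subst_alt
  by (rule sum.mono_neutral_left) (use assms in \<open>auto simp: in_keys_iff\<close>)

lemma mpoly_subst_single:
  assumes "h 0 = 0"
  shows "mpoly_subst h f (Poly_Mapping.single m c) = h c * mono_val f m"
  by (subst mpoly_subst_superset[of h "{m}"]) (use assms in \<open>auto split: if_splits\<close>)

lemma mult_as_sum:
  fixes P Q :: "('v, 'a::comm_ring_1) mpoly"
  shows "P * Q = (\<Sum>m\<in>keys P. \<Sum>m'\<in>keys Q.
     Poly_Mapping.single (m + m') (lookup P m * lookup Q m'))"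
  by (subst poly_mapping_as_sum[of P], subst poly_mapping_as_sum[of Q])
     (simp add: sum_distrib_left sum_distrib_right mult_single, rule sum.swap)

lemma mpoly_subst_hom:
  fixes h :: "'a::comm_ring_1 \<Rightarrow> 'r::comm_ring_1"
  assumes "comm_ring_hom h"
  shows "comm_ring_hom (mpoly_subst h f)"
proof -
  interpret h: comm_ring_hom h by fact
  let ?k = keys and ?l = lookup
  have add: "mpoly_subst h f (P + Q) = mpoly_subst h f P + mpoly_subst h f Q" for P Q
  proof -
    let ?S = "?k P \<union> ?k Q"
    have "mpoly_subst h f (P + Q) = (\<Sum>m\<in>?S. h (?l (P + Q) m) * mono_val f m)"
      by (rule mpoly_subst_superset) (auto dest: subsetD[OF keys_add])
    also have "\<dots> = mpoly_subst h f P + mpoly_subst h f Q"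
      by (simp add: lookup_add h.hom_add algebra_simps sum.distrib mpoly_subst_superset[of h ?S])
    finally show ?thesis .
  qed
  have zero: "mpoly_subst h f 0 = 0" by (simp add: mpoly_subst_def)
  have sum: "mpoly_subst h f (\<Sum>i\<in>A. g i) = (\<Sum>i\<in>A. mpoly_subst h f (g i))" for A and g :: "'x \<Rightarrow> _"
    by (induction A rule: infinite_finite_induct) (auto simp: add zero)
  have mult: "mpoly_subst h f (P * Q) = mpoly_subst h f P * mpoly_subst h f Q" for P Q
  proof -
    have "mpoly_subst h f (P * Q) = (\<Sum>m\<in>?k P. \<Sum>m'\<in>?k Q. h (?l P m * ?l Q m') * mono_val f (m + m'))"
      by (simp add: mult_as_sum[of P Q] sum mpoly_subst_single)
    also have "\<dots> = mpoly_subst h f P * mpoly_subst h f Q"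
      by (simp add: mpoly_subst_alt sum_distrib_left sum_distrib_right mono_val_add h.hom_mult mult_ac)
         (subst sum.swap, simp add: mult_ac)
    finally show ?thesis .
  qed
  have one: "mpoly_subst h f 1 = 1"
    using mpoly_subst_single[of h f 0 1] by simp
  show ?thesis
    by unfold_locales (auto simp: zero one add mult)
qed

lemma mpoly_subst_Const [simp]: "h 0 = 0 \<Longrightarrow> mpoly_subst h f (Const c) = h c"
  by (simp add: Const_def mpoly_subst_single)

lemma mpoly_subst_Var [simp]: "h 0 = 0 \<Longrightarrow> h 1 = 1 \<Longrightarrow> mpoly_subst h f (Var v) = f v"
  by (simp add: Var_def mpoly_subst_single)

lemma Const_hom: "comm_ring_hom (Const :: 'a::comm_ring_1 \<Rightarrow> ('v, 'a) mpoly)"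
  by unfold_locales (auto simp: Const_def single_add mult_single)

text \<open>
  Almost every computation below evaluates one polynomial in several rings; this lemma compares the results.
\<close>

lemma hom_mpoly_subst:
  assumes "comm_ring_hom g"
  shows "g (mpoly_subst h f P) = mpoly_subst (\<lambda>c. g (h c)) (\<lambda>v. g (f v)) P"
proof -
  interpret comm_ring_hom g by fact
  show ?thesis by (simp add: mpoly_subst_alt hom_distribs mono_val_hom[OF assms])
qed

lemma mono_val_Var: "mono_val Var m = (Poly_Mapping.single m 1 :: ('v, 'a::comm_ring_1) mpoly)"
proof -
  have *: "(Var v :: ('v, 'a) mpoly) ^ k = Poly_Mapping.single (Poly_Mapping.single v k) 1" for v k
    by (induction k) (auto simp: Var_def mult_single simp flip: single_add)
  have "(\<Prod>v\<in>S. Poly_Mapping.single (Poly_Mapping.single v (lookup m v)) (1::'a)) =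
     Poly_Mapping.single (\<Sum>v\<in>S. Poly_Mapping.single v (lookup m v)) 1" for S
    by (induction S rule: infinite_finite_induct) (auto simp: mult_single)
  then show ?thesis
    by (simp add: mono_val_def * flip: poly_mapping_as_sum)
qed

lemma mpoly_subst_id: "mpoly_subst Const Var P = (P :: ('v, 'a::comm_ring_1) mpoly)"
  by (subst (2) poly_mapping_as_sum[of P])
     (simp add: mpoly_subst_alt mono_val_Var Const_def mult_single)

lemma mpoly_subst_cong:
  assumes "\<And>m v. m \<in> keys P \<Longrightarrow> v \<in> keys m \<Longrightarrow> f v = g v"
  shows "mpoly_subst h f P = mpoly_subst h g P"
  unfolding mpoly_subst_def using assms by (intro sum.cong prod.cong arg_cong2[of _ _ _ _ "(*)"]) auto

lemma mpoly_subst_subst: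
  assumes "comm_ring_hom h'"
  shows "mpoly_subst h' g (mpoly_subst h f P) =
    mpoly_subst (\<lambda>c. mpoly_subst h' g (h c)) (\<lambda>v. mpoly_subst h' g (f v)) P"
  by (rule hom_mpoly_subst[OF mpoly_subst_hom[OF assms]])

lemma id_hom: "comm_ring_hom (\<lambda>x. x)"
  by unfold_locales auto

lemma mpoly_eval_hom: "comm_ring_hom (mpoly_eval x)"
  unfolding mpoly_eval_def [abs_def] by (rule mpoly_subst_hom[OF id_hom])

lemma const_poly_hom: "comm_ring_hom (\<lambda>c. [:c:] :: 'a::comm_ring_1 poly)"
  by unfold_locales auto

lemma poly_at_hom: "comm_ring_hom (\<lambda>p :: 'a::comm_ring_1 poly. poly p t)"
  by unfold_locales auto

lemma hom_comp: "comm_ring_hom f \<Longrightarrow> comm_ring_hom g \<Longrightarrow> comm_ring_hom (\<lambda>x. f (g x))"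
proof -
  assume "comm_ring_hom f" "comm_ring_hom g"
  then interpret f: comm_ring_hom f + g: comm_ring_hom g .
  show ?thesis by unfold_locales (auto simp: f.hom_add g.hom_add f.hom_mult g.hom_mult)
qed

section \<open>Weights and multiplicative filtrations\<close>

text \<open>
  For the indicator function \<open>\<omega>\<close> of a block this is the degree in that block.
\<close>

definition wt :: "('v \<Rightarrow> nat) \<Rightarrow> ('v \<Rightarrow>\<^sub>0 nat) \<Rightarrow> nat" where
  "wt \<omega> m = (\<Sum>v\<in>keys m. \<omega> v * lookup m v)"

lemma wt_superset:
  assumes "finite S" "keys m \<subseteq> S"
  shows "wt \<omega> m = (\<Sum>v\<in>S. \<omega> v * lookup m v)"
  unfolding wt_def
  by (rule sum.mono_neutral_left) (use assms in \<open>auto simp: in_keys_iff\<close>)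

lemma wt_0 [simp]: "wt \<omega> 0 = 0"
  by (simp add: wt_def)

lemma wt_single [simp]: "wt \<omega> (Poly_Mapping.single v k) = \<omega> v * k"
  by (subst wt_superset[of "{v}"]) auto

lemma wt_add: "wt \<omega> (m + m') = wt \<omega> m + wt \<omega> m'"
proof -
  let ?S = "keys m \<union> keys m'"
  have "wt \<omega> (m + m') = (\<Sum>v\<in>?S. \<omega> v * lookup (m + m') v)"
    by (rule wt_superset) (auto dest: subsetD[OF keys_add])
  also have "\<dots> = wt \<omega> m + wt \<omega> m'"
    by (simp add: lookup_add algebra_simps sum.distrib wt_superset[of ?S])
  finally show ?thesis .
qed

lemma wt_sum_weights: "finite I \<Longrightarrow> (\<Sum>i\<in>I. wt (\<omega> i) m) = wt (\<lambda>v. \<Sum>i\<in>I. \<omega> i v) m"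
  unfolding wt_def by (subst sum.swap) (simp add: sum_distrib_right)

lemma wt_plus_weights: "wt \<omega> m + wt \<omega>' m = wt (\<lambda>v. \<omega> v + \<omega>' v) m"
  by (simp add: wt_def algebra_simps sum.distrib)

lemma wt_mult_weights: "wt (\<lambda>v. k * \<omega> v) m = k * wt \<omega> m"
  by (simp add: wt_def sum_distrib_left mult_ac)

lemma wt_cong: "(\<And>v. v \<in> keys m \<Longrightarrow> \<omega> v = \<omega>' v) \<Longrightarrow> wt \<omega> m = wt \<omega>' m"
  by (simp add: wt_def)

lemma wt_mono: "(\<And>v. \<omega> v \<le> \<omega>' v) \<Longrightarrow> wt \<omega> m \<le> wt \<omega>' m"
  by (auto simp: wt_def intro!: sum_mono mult_right_mono)

lemma wt_eq_0_iff: "wt \<omega> m = 0 \<longleftrightarrow> (\<forall>v\<in>keys m. \<omega> v = 0)"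
  by (auto simp: wt_def in_keys_iff)

abbreviation deg :: "('v \<Rightarrow>\<^sub>0 nat) \<Rightarrow> nat" where
  "deg \<equiv> wt (\<lambda>_. 1)"

definition block_wt :: "('v \<Rightarrow> 'b) \<Rightarrow> 'b \<Rightarrow> 'v \<Rightarrow> nat" where
  "block_wt blk b v = of_bool (blk v = b)"

lemma wt_block: "wt (block_wt blk b) m =
   (\<Sum>v\<in>{v \<in> keys m. blk v = b}. lookup m v)"
  by (auto simp: wt_def block_wt_def of_bool_def sum.inter_filter intro!: sum.cong)

text \<open>
  The second indicator turns the condition on the variables into a degree as well, so that a
  multihomogeneous form is a polynomial homogeneous for a family of weights.
\<close>

lemma mform_iff:
  "mform Vs blk d P \<longleftrightarrow> (\<forall>m\<in>keys P. wt (\<lambda>v. of_bool (v \<notin> Vs)) m = 0 \<and>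
      (\<forall>b. wt (block_wt blk b) m = d b))"
  by (auto simp: mform_def wt_block wt_eq_0_iff)

text \<open>
  Degree bounds, orders of vanishing, divisibility by powers and powers of the maximal ideal all have
  this shape.  No monotonicity is imposed: gradings and increasing filtrations are included.
\<close>

definition filtration :: "(nat \<Rightarrow> 'r::comm_ring_1 set) \<Rightarrow> bool" where
  "filtration F \<longleftrightarrow> (\<forall>j. 0 \<in> F j) \<and> (\<forall>j. \<forall>a\<in>F j. \<forall>b\<in>F j. a + b \<in> F j) \<and> 1 \<in> F 0 \<and>
     (\<forall>i j. \<forall>a\<in>F i. \<forall>b\<in>F j. a * b \<in> F (i + j))"

lemma filtrationI:
  assumes "\<And>j. 0 \<in> F j" "\<And>j a b. a \<in> F j \<Longrightarrow> b \<in> F j \<Longrightarrow> a + b \<in> F j" "1 \<in> F 0"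
    "\<And>i j a b. a \<in> F i \<Longrightarrow> b \<in> F j \<Longrightarrow> a * b \<in> F (i + j)"
  shows "filtration F"
  using assms by (simp add: filtration_def)

lemma filtrationD:
  assumes "filtration F"
  shows "0 \<in> F j" "a \<in> F j \<Longrightarrow> b \<in> F j \<Longrightarrow> a + b \<in> F j" "1 \<in> F 0"
    "a \<in> F i \<Longrightarrow> b \<in> F j \<Longrightarrow> a * b \<in> F (i + j)"
  using assms by (auto simp: filtration_def)

lemma filtration_sum: "filtration F \<Longrightarrow> (\<And>i. i \<in> A \<Longrightarrow> g i \<in> F j) \<Longrightarrow> sum g A \<in> F j"
  by (induction A rule: infinite_finite_induct) (auto intro: filtrationD)

lemma filtration_power: "filtration F \<Longrightarrow> a \<in> F j \<Longrightarrow> a ^ k \<in> F (j * k)"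
  by (induction k) (auto intro: filtrationD)

lemma filtration_mono_val:
  assumes F: "filtration F" and f: "\<And>v. v \<in> keys m \<Longrightarrow> f v \<in> F (\<omega> v)"
  shows "mono_val f m \<in> F (wt \<omega> m)"
proof -
  have "(\<Prod>v\<in>S. f v ^ lookup m v) \<in> F (\<Sum>v\<in>S. \<omega> v * lookup m v)"
    if "S \<subseteq> keys m" for S
    using finite_subset[OF that finite_keys] that
    by (induction S rule: finite_induct) (auto intro: filtrationD[OF F] filtration_power[OF F] f)
  then show ?thesis by (simp add: mono_val_def wt_def)
qed

text \<open>
  A monomial of weight \<open>e\<close> is sent to \<open>F e\<close> by multiplicativity, and the last hypothesis moves it to \<open>F d\<close>.
  This one statement yields all degree and order estimates.
\<close>

lemma filtration_mpoly_subst: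
  assumes F: "filtration F" and h: "\<And>c. h c \<in> F 0"
    and f: "\<And>m v. m \<in> keys P \<Longrightarrow> v \<in> keys m \<Longrightarrow> f v \<in> F (\<omega> v)"
    and d: "\<And>m. m \<in> keys P \<Longrightarrow> F (wt \<omega> m) \<subseteq> F d"
  shows "mpoly_subst h f P \<in> F d"
  unfolding mpoly_subst_alt
proof (rule filtration_sum[OF F])
  fix m assume m: "m \<in> keys P"
  have "mono_val f m \<in> F (wt \<omega> m)" by (rule filtration_mono_val[OF F f[OF m]])
  then have "mono_val f m \<in> F d" using d[OF m] by auto
  then show "h (lookup P m) * mono_val f m \<in> F d"
    using filtrationD(4)[OF F h] by fastforce
qed

lemma filtration_graded:
  "filtration (\<lambda>j. {P :: ('v, 'a::comm_ring_1) mpoly. \<forall>m\<in>keys P. wt \<omega> m = j})"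
  unfolding filtration_def
  by (auto simp: wt_add dest!: subsetD[OF keys_add] subsetD[OF keys_mult])

lemma filtration_order_ge:
  "filtration (\<lambda>j. {P :: ('v, 'a::comm_ring_1) mpoly. \<forall>m\<in>keys P. wt \<omega> m \<ge> j})"
  unfolding filtration_def
  by (fastforce simp: wt_add dest!: subsetD[OF keys_add] subsetD[OF keys_mult] intro: add_mono)

lemma mform_mult: "mform Vs blk d P \<Longrightarrow> mform Vs blk e Q \<Longrightarrow>
    mform Vs blk (\<lambda>b. d b + e b) (P * Q :: ('v, 'a::comm_ring_1) mpoly)"
  by (auto simp: mform_iff wt_add dest!: subsetD[OF keys_mult])

lemma mform_add: "mform Vs blk d P \<Longrightarrow> mform Vs blk d Q \<Longrightarrow>
    mform Vs blk d (P + Q :: ('v, 'a::comm_ring_1) mpoly)"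
  by (auto simp: mform_iff dest!: subsetD[OF keys_add])

lemma mform_diff:
  "mform Vs blk d P \<Longrightarrow> mform Vs blk d Q \<Longrightarrow> mform Vs blk d (P - Q :: ('v, 'a::comm_ring_1) mpoly)"
  by (auto simp: mform_iff dest!: subsetD[OF keys_diff])

lemma mform_0 [simp]: "mform Vs blk d 0"
  by (simp add: mform_iff)

lemma mform_sum: "(\<And>i. i \<in> I \<Longrightarrow> mform Vs blk d (P i :: ('v, 'a::comm_ring_1) mpoly)) \<Longrightarrow> mform Vs blk d (\<Sum>i\<in>I. P i)"
  by (induction I rule: infinite_finite_induct) (auto intro: mform_add)

lemma mform_Const: "mform Vs blk (\<lambda>_. 0) (Const c)"
  by (auto simp: mform_iff Const_def split: if_splits)

lemma mform_1: "mform Vs blk (\<lambda>_. 0) 1"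
  by (auto simp: mform_iff)

lemma mform_Var: "v \<in> Vs \<Longrightarrow> mform Vs blk (\<lambda>b. of_bool (blk v = b)) (Var v :: ('v, 'a::comm_ring_1) mpoly)"
  by (auto simp: mform_iff Var_def block_wt_def split: if_splits)

lemma mform_prod:
  "(\<And>i. i \<in> I \<Longrightarrow> mform Vs blk (d i) (P i :: ('v, 'a::comm_ring_1) mpoly)) \<Longrightarrow>
    mform Vs blk (\<lambda>b. \<Sum>i\<in>I. d i b) (\<Prod>i\<in>I. P i)"
proof (induction I rule: infinite_finite_induct)
  case (insert x F)
  then show ?case using mform_mult[of Vs blk "d x" "P x"] by simp
qed (auto simp: mform_1)

lemma mform_power:
  "mform Vs blk d (P :: ('v, 'a::comm_ring_1) mpoly) \<Longrightarrow> mform Vs blk (\<lambda>b. k * d b) (P ^ k)"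
  using mform_prod[of "{..<k}" Vs blk "\<lambda>_. d" "\<lambda>_. P"] by simp

lemma mform_cong: "mform Vs blk d P \<Longrightarrow> (\<And>b. d b = e b) \<Longrightarrow> mform Vs blk e P"
  by (simp add: mform_iff)

lemma mform_keysD:
  assumes "mform Vs blk d P" "m \<in> keys P"
  shows "keys m \<subseteq> Vs"
  using assms by (simp add: mform_def)

lemma mpoly_subst_mform_cong:
  assumes "mform Vs blk d P" "\<And>v. v \<in> Vs \<Longrightarrow> f v = g v"
  shows "mpoly_subst h f P = mpoly_subst h g P"
  by (rule mpoly_subst_cong) (use assms mform_keysD in blast)

section \<open>Hasse derivatives and multiplicity\<close>

text \<open>
  The polynomial \<open>G(X + W)\<close> as a polynomial in \<open>W\<close> with coefficients in the ring of polynomials in \<open>X\<close>.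
\<close>

definition taylor_shift :: "('v, 'a::comm_ring_1) mpoly \<Rightarrow> ('v, ('v, 'a) mpoly) mpoly" where
  "taylor_shift G = mpoly_subst (\<lambda>c. Const (Const c)) (\<lambda>v. Const (Var v) + Var v) G"

text \<open>
  In characteristic zero this is the partial derivative of multi-index \<open>\<alpha>\<close> divided by \<open>\<alpha>!\<close>.
\<close>

definition hasse :: "('v \<Rightarrow>\<^sub>0 nat) \<Rightarrow> ('v, 'a::comm_ring_1) mpoly \<Rightarrow> ('v, 'a) mpoly" where
  "hasse \<alpha> G = lookup (taylor_shift G) \<alpha>"

lemma taylor:
  fixes G :: "('v, 'a::comm_ring_1) mpoly"
  assumes "comm_ring_hom h"
  shows "mpoly_subst h (\<lambda>v. A v + B v) G =
    (\<Sum>\<alpha>\<in>keys (taylor_shift G). mpoly_subst h A (hasse \<alpha> G) * mono_val B \<alpha>)"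
proof -
  interpret h: comm_ring_hom h by fact
  interpret hA: comm_ring_hom "mpoly_subst h A" by (rule mpoly_subst_hom) fact
  interpret hAB: comm_ring_hom "mpoly_subst (mpoly_subst h A) B"
    by (rule mpoly_subst_hom[OF hA.comm_ring_hom_axioms])
  have "mpoly_subst (mpoly_subst h A) B (taylor_shift G) = mpoly_subst h (\<lambda>v. A v + B v) G"
    unfolding taylor_shift_def
    by (simp add: mpoly_subst_subst[OF hA.comm_ring_hom_axioms] hAB.hom_add)
  then show ?thesis by (simp add: mpoly_subst_alt[of _ _ "taylor_shift G"] hasse_def)
qed

lemma filtration_nested:
  "filtration (\<lambda>j. {Q :: ('v, ('v, 'a::comm_ring_1) mpoly) mpoly.
     \<forall>\<alpha>. \<forall>m\<in>keys (lookup Q \<alpha>). wt \<omega> m + wt \<omega> \<alpha> = j})"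
    (is "filtration ?F")
proof -
  have add: "a + b \<in> ?F j" if "a \<in> ?F j" "b \<in> ?F j" for a b j
    using that by (auto simp: lookup_add dest!: subsetD[OF keys_add])
  have sum: "sum g A \<in> ?F j" if "\<And>i. i \<in> A \<Longrightarrow> g i \<in> ?F j" for g :: "'x \<Rightarrow> _" and A j
    using that
  proof (induction A rule: infinite_finite_induct)
    case (insert x A)
    have "g x \<in> ?F j" "sum g A \<in> ?F j"
      using insert.prems insert.IH by blast+
    then have "g x + sum g A \<in> ?F j" by (rule add)
    then show ?case using insert.hyps by simp
  qed auto
  have mult: "P * Q \<in> ?F (i + j)" if P: "P \<in> ?F i" and Q: "Q \<in> ?F j" for P Q i j
    unfolding mult_as_sum[of P Q]
  proof (intro sum)
    fix \<alpha> \<beta>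
    show "Poly_Mapping.single (\<alpha> + \<beta>) (lookup P \<alpha> * lookup Q \<beta>) \<in> ?F (i + j)"
    proof (intro CollectI allI ballI)
      fix \<gamma> m
      assume m: "m \<in> keys (lookup (Poly_Mapping.single (\<alpha> + \<beta>)
        (lookup P \<alpha> * lookup Q \<beta>)) \<gamma>)"
      then have \<gamma>: "\<gamma> = \<alpha> + \<beta>"
        by (auto simp: lookup_single when_def split: if_splits)
      with m have "m \<in> keys (lookup P \<alpha> * lookup Q \<beta>)"
        by (simp add: lookup_single when_def)
      then obtain a b where "m = a + b" "a \<in> keys (lookup P \<alpha>)"
        "b \<in> keys (lookup Q \<beta>)"
        by (auto dest!: subsetD[OF keys_mult])
      moreover have "wt \<omega> a + wt \<omega> \<alpha> = i" if "a \<in> keys (lookup P \<alpha>)" for a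
        using P that by simp
      moreover have "wt \<omega> b + wt \<omega> \<beta> = j" if "b \<in> keys (lookup Q \<beta>)" for b
        using Q that by simp
      ultimately have "m = a + b" "wt \<omega> a + wt \<omega> \<alpha> = i" "wt \<omega> b + wt \<omega> \<beta> = j"
        by simp_all
      then show "wt \<omega> m + wt \<omega> \<gamma> = i + j"
        by (simp add: \<gamma> wt_add)
    qed
  qed
  have one: "1 \<in> ?F 0"
    by (auto simp: lookup_one when_def)
  have zero: "0 \<in> ?F j" for j by simp
  show ?thesis by (rule filtrationI[OF zero add one mult])
qed

text \<open>
  \<open>G(X + W)\<close> is homogeneous of the same weight as \<open>G\<close> when \<open>X\<close> and \<open>W\<close> are given equal weights.
\<close>

lemma hasse_wt:
  fixes G :: "('v, 'a::comm_ring_1) mpoly"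
  assumes "\<And>m. m \<in> keys G \<Longrightarrow> wt \<omega> m = d"
    and "m \<in> keys (hasse \<alpha> G)"
  shows "wt \<omega> m + wt \<omega> \<alpha> = d"
proof -
  let ?F = "\<lambda>j. {Q :: ('v, ('v, 'a) mpoly) mpoly.
     \<forall>\<alpha>. \<forall>m\<in>keys (lookup Q \<alpha>). wt \<omega> m + wt \<omega> \<alpha> = j}"
  have "taylor_shift G \<in> ?F d"
    unfolding taylor_shift_def
  proof (rule filtration_mpoly_subst[OF filtration_nested, where \<omega> = \<omega>])
    show "Const (Const c) \<in> ?F 0" for c
      by (auto simp: Const_def lookup_single when_def split: if_splits)
    have "Const (Var v) \<in> ?F (\<omega> v)" "Var v \<in> ?F (\<omega> v)" for v
      by (auto simp: Const_def Var_def lookup_single when_def split: if_splits)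
    then show "Const (Var v) + Var v \<in> ?F (\<omega> v)" for v
      by (rule filtrationD(2)[OF filtration_nested])
  qed (simp add: assms)
  then show ?thesis using assms(2) by (auto simp: hasse_def)
qed

lemma hasse_mform:
  assumes "mform Vs blk d G"
  shows "mform Vs blk (\<lambda>b. d b - wt (block_wt blk b) \<alpha>) (hasse \<alpha> G)"
  unfolding mform_iff
proof (intro ballI conjI allI)
  fix m assume m: "m \<in> keys (hasse \<alpha> G)"
  have "wt (\<lambda>v. of_bool (v \<notin> Vs)) m + wt (\<lambda>v. of_bool (v \<notin> Vs)) \<alpha> = 0"
    by (rule hasse_wt[OF _ m]) (use assms in \<open>auto simp: mform_iff\<close>)
  then show "wt (\<lambda>v. of_bool (v \<notin> Vs)) m = 0" by simp
  fix b
  have "wt (block_wt blk b) m + wt (block_wt blk b) \<alpha> = d b"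
    by (rule hasse_wt[OF _ m]) (use assms in \<open>auto simp: mform_iff\<close>)
  then show "wt (block_wt blk b) m = d b - wt (block_wt blk b) \<alpha>" by simp
qed

lemma mono_val_block:
  assumes "finite B" "blk ` keys m \<subseteq> B"
  shows "mono_val (\<lambda>v. c (blk v)) m = (\<Prod>b\<in>B. c b ^ wt (block_wt blk b) m)"
proof -
  have "mono_val (\<lambda>v. c (blk v)) m =
      (\<Prod>b\<in>B. \<Prod>v\<in>{v \<in> keys m. blk v = b}. c (blk v) ^ lookup m v)"
    unfolding mono_val_def by (rule prod.group[symmetric]) (use assms in auto)
  also have "\<dots> = (\<Prod>b\<in>B. c b ^ wt (block_wt blk b) m)"
    by (intro prod.cong) (auto simp: wt_block power_sum)
  finally show ?thesis .
qed

lemma mpoly_subst_scale: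
  assumes P: "mform Vs blk d P" and B: "finite B" "blk ` Vs \<subseteq> B"
  shows "mpoly_subst h (\<lambda>v. c (blk v) * f v) P = (\<Prod>b\<in>B. c b ^ d b) * mpoly_subst h f P"
proof -
  have "mono_val (\<lambda>v. c (blk v) * f v) m = (\<Prod>b\<in>B. c b ^ d b) * mono_val f m"
    if m: "m \<in> keys P" for m
  proof -
    have "mono_val (\<lambda>v. c (blk v)) m = (\<Prod>b\<in>B. c b ^ wt (block_wt blk b) m)"
      by (rule mono_val_block) (use B mform_keysD[OF P m] in auto)
    also have "\<dots> = (\<Prod>b\<in>B. c b ^ d b)"
      using P m by (simp add: mform_iff)
    finally show ?thesis by (simp add: mono_val_scale)
  qed
  then show ?thesis
    by (simp add: mpoly_subst_alt sum_distrib_left mult_ac)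
qed

text \<open>
  The multiplicity of \<open>G\<close> at the point of affine space with coordinates \<open>z\<close>.  For a multihomogeneous form
  it is the multiplicity at the corresponding point of the product of projective spaces, since \<open>G\<close> is
  homogeneous along the block scalings.
\<close>

definition vanishes :: "('v, 'a::comm_ring_1) mpoly \<Rightarrow> ('v \<Rightarrow> 'a) \<Rightarrow> nat \<Rightarrow> bool" where
  "vanishes G z r \<longleftrightarrow> (\<forall>\<alpha>. deg \<alpha> < r \<longrightarrow> mpoly_eval z (hasse \<alpha> G) = 0)"

lemma vanishes_0 [simp]: "vanishes G z 0"
  by (simp add: vanishes_def)

lemma vanishes_mono: "vanishes G z r \<Longrightarrow> r' \<le> r \<Longrightarrow> vanishes G z r'"
  by (auto simp: vanishes_def)

lemma mpoly_subst_const_point: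
  assumes "comm_ring_hom h"
  shows "mpoly_subst h (\<lambda>v. h (z v)) P = h (mpoly_eval z P)"
  unfolding mpoly_eval_def by (simp add: hom_mpoly_subst[OF assms])

text \<open>
  Expand in powers of \<open>W\<close>.  The coefficients at the powers below \<open>r\<close> are Hasse derivatives of \<open>G\<close> at a
  rescaled \<open>z\<close>, and they vanish there because they are multihomogeneous themselves.  The scaling factors
  \<open>s\<close> belong to the ring \<open>'r\<close>, which matters for families of points.
\<close>

lemma vanishes_filtration:
  fixes G :: "('v, 'a::comm_ring_1) mpoly" and h :: "'a \<Rightarrow> 'r::comm_ring_1"
  assumes G: "mform Vs blk d G" and fin: "finite Vs" and z: "vanishes G z r"
    and h: "comm_ring_hom h" and F: "filtration F" and dec: "\<And>i. i \<ge> r \<Longrightarrow> F i \<subseteq> F r"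
    and hF: "\<And>c. h c \<in> F 0" and s: "\<And>b. s b \<in> F 0" and W: "\<And>v. v \<in> Vs \<Longrightarrow> W v \<in> F 1"
  shows "mpoly_subst h (\<lambda>v. s (blk v) * h (z v) + W v) G \<in> F r"
proof -
  interpret h: comm_ring_hom h by fact
  have "mpoly_subst h (\<lambda>v. s (blk v) * h (z v)) (hasse \<alpha> G) * mono_val W \<alpha> \<in> F r" for \<alpha>
  proof (cases "hasse \<alpha> G = 0")
    case True
    then show ?thesis by (simp add: mpoly_subst_def filtrationD[OF F])
  next
    case nz: False
    show ?thesis
    proof (cases "deg \<alpha> < r")
      case True
      have "mpoly_subst h (\<lambda>v. s (blk v) * h (z v)) (hasse \<alpha> G) =
        (\<Prod>b\<in>blk ` Vs. s b ^ (d b - wt (block_wt blk b) \<alpha>)) * mpoly_subst h (\<lambda>v. h (z v)) (hasse \<alpha> G)"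
        by (rule mpoly_subst_scale[OF hasse_mform[OF G]]) (use fin in auto)
      also have "\<dots> = 0"
        using z True by (simp add: mpoly_subst_const_point[OF h] vanishes_def)
      finally show ?thesis by (simp add: filtrationD[OF F])
    next
      case False
      from nz obtain m where m: "m \<in> keys (hasse \<alpha> G)"
        by (metis keys_eq_empty ex_in_conv)
      have "wt (\<lambda>v. of_bool (v \<notin> Vs)) m + wt (\<lambda>v. of_bool (v \<notin> Vs)) \<alpha> = 0"
        by (rule hasse_wt[OF _ m]) (use G in \<open>auto simp: mform_iff\<close>)
      then have "keys \<alpha> \<subseteq> Vs" by (auto simp: wt_eq_0_iff)
      then have "mono_val W \<alpha> \<in> F (deg \<alpha>)"
        by (intro filtration_mono_val[OF F]) (use W in auto)
      then have 1: "mono_val W \<alpha> \<in> F r" using dec False by (meson linorder_not_less subsetD)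
      have "mpoly_subst h (\<lambda>v. s (blk v) * h (z v)) (hasse \<alpha> G) \<in> F 0"
        by (rule filtration_mpoly_subst[OF F, where \<omega> = "\<lambda>_. 0"])
           (use filtrationD(4)[OF F s hF] hF in \<open>auto simp: wt_def\<close>)
      from filtrationD(4)[OF F this 1] show ?thesis by simp
    qed
  qed
  then show ?thesis
    unfolding taylor[OF h] by (intro filtration_sum[OF F])
qed

lemma vanishes_same_point:
  fixes G :: "('v, 'a::field) mpoly"
  assumes "mform Vs blk d G" "finite Vs" "same_point blk z z'" "vanishes G z' r"
  shows "vanishes G z r"
  unfolding vanishes_def
proof (intro allI impI)
  fix \<alpha> :: "'v \<Rightarrow>\<^sub>0 nat" assume \<alpha>: "deg \<alpha> < r"
  obtain c where c: "\<And>v. z v = c (blk v) * z' v"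
    using assms(3) by (auto simp: same_point_def)
  have "mpoly_eval z (hasse \<alpha> G) = (\<Prod>b\<in>blk ` Vs. c b ^ (d b - wt (block_wt blk b) \<alpha>)) *
        mpoly_eval z' (hasse \<alpha> G)"
    unfolding mpoly_eval_def c[abs_def]
    by (rule mpoly_subst_scale[OF hasse_mform[OF assms(1)]]) (use assms in auto)
  then show "mpoly_eval z (hasse \<alpha> G) = 0"
    using \<alpha> assms(4) by (simp add: vanishes_def)
qed

section \<open>Vanishing identities over an infinite field\<close>

text \<open>
  Induction on the set of variables: for fixed values of the other variables the sum is a polynomial in the
  new one with infinitely many zeros.  Indexing by an abstract set \<open>M\<close> with exponents \<open>e\<close> lets the induction
  hypothesis apply to the terms with a given exponent of the new variable.
\<close>

lemma coefficients_zero_if_function_zero: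
  fixes c :: "'m \<Rightarrow> 'a::field_char_0"
  assumes "finite V" "finite M"
    "\<forall>m\<in>M. \<forall>m'\<in>M. (\<forall>v\<in>V. e m v = e m' v) \<longrightarrow> m = m'"
    "\<forall>x::'v \<Rightarrow> 'a. (\<Sum>m\<in>M. c m * (\<Prod>v\<in>V. x v ^ e m v)) = 0"
  shows "\<forall>m\<in>M. c m = 0"
  using assms
proof (induction V arbitrary: M rule: finite_induct)
  case empty
  show ?case
  proof
    fix m assume m: "m \<in> M"
    then have "M = {m}" using empty by auto
    then show "c m = 0" using empty by simp
  qed
next
  case (insert v V)
  show ?case
  proof
    fix m0 assume m0: "m0 \<in> M"
    let ?M = "{m \<in> M. e m v = e m0 v}"
    have "\<forall>m\<in>?M. c m = 0"
    proof (rule insert.IH)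
      show "\<forall>x::'v \<Rightarrow> 'a. (\<Sum>m\<in>?M. c m * (\<Prod>v\<in>V. x v ^ e m v)) = 0"
      proof
        fix x :: "'v \<Rightarrow> 'a"
        let ?p = "\<Sum>m\<in>M. monom (c m * (\<Prod>v\<in>V. x v ^ e m v)) (e m v)"
        have "poly ?p t = 0" for t
        proof -
          have "poly ?p t = (\<Sum>m\<in>M. c m * (\<Prod>w\<in>insert v V. (x(v := t)) w ^ e m w))"
          proof (subst poly_sum, intro sum.cong refl)
            fix m
            have "(\<Prod>w\<in>V. (x(v := t)) w ^ e m w) = (\<Prod>w\<in>V. x w ^ e m w)"
              using insert.hyps by (intro prod.cong) auto
            then show "poly (monom (c m * (\<Prod>v\<in>V. x v ^ e m v)) (e m v)) t =
               c m * (\<Prod>w\<in>insert v V. (x(v := t)) w ^ e m w)"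
              using insert.hyps by (simp add: poly_monom)
          qed
          then show ?thesis using insert.prems(3) by simp
        qed
        then have "?p = 0" using poly_all_0_iff_0 by blast
        then have "coeff ?p (e m0 v) = 0" by simp
        then show "(\<Sum>m\<in>?M. c m * (\<Prod>v\<in>V. x v ^ e m v)) = 0"
          using insert.prems(1) by (simp add: coeff_sum sum.inter_filter)
      qed
    qed (use insert in auto)
    then show "c m0 = 0" using m0 by auto
  qed
qed

lemma mpoly_eq_0_if_eval_0:
  fixes P :: "('v, 'a::field_char_0) mpoly"
  assumes "\<And>x. mpoly_eval x P = 0"
  shows "P = 0"
proof -
  let ?V = "\<Union>m\<in>keys P. keys m"
  have "\<forall>m\<in>keys P. lookup P m = 0"
  proof (rule coefficients_zero_if_function_zero[where V = ?V and e = lookup])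
    show "\<forall>m\<in>keys P. \<forall>m'\<in>keys P.
       (\<forall>v\<in>?V. lookup m v = lookup m' v) \<longrightarrow> m = m'"
    proof (intro ballI impI poly_mapping_eqI)
      fix m m' v assume *: "m \<in> keys P" "m' \<in> keys P"
        "\<forall>v\<in>?V. lookup m v = lookup m' v"
      show "lookup m v = lookup m' v"
        using * by (cases "v \<in> ?V") (auto simp: in_keys_iff)
    qed
    show "\<forall>x. (\<Sum>m\<in>keys P. lookup P m *
         (\<Prod>v\<in>?V. x v ^ lookup m v)) = 0"
    proof
      fix x
      have "(\<Sum>m\<in>keys P. lookup P m *
         (\<Prod>v\<in>?V. x v ^ lookup m v)) = mpoly_eval x P"
        unfolding mpoly_eval_def mpoly_subst_alt
        by (intro sum.cong refl arg_cong2[of _ _ _ _ "(*)"] mono_val_superset[symmetric]) auto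
      then show "(\<Sum>m\<in>keys P. lookup P m *
         (\<Prod>v\<in>?V. x v ^ lookup m v)) = 0" using assms by simp
    qed
  qed auto
  then show ?thesis by (metis keys_eq_empty in_keys_iff ex_in_conv)
qed

lemma mpoly_eq_0_if_generic_eval_0:
  fixes P K :: "('v::linorder, 'a::field_char_0) mpoly"
  assumes "K \<noteq> 0" "\<And>x. mpoly_eval x K \<noteq> 0 \<Longrightarrow> mpoly_eval x P = 0"
  shows "P = 0"
proof -
  have "P * K = 0"
  proof (rule mpoly_eq_0_if_eval_0)
    fix x
    interpret comm_ring_hom "mpoly_eval x :: ('v, 'a) mpoly \<Rightarrow> 'a" by (rule mpoly_eval_hom)
    show "mpoly_eval x (P * K) = 0" using assms(2)[of x] by (auto simp: hom_mult)
  qed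
  then show ?thesis using assms(1) by simp
qed

lemma mono_val_monom:
  "mono_val (\<lambda>v. monom (w v) 1) m = monom (mono_val w m) (deg m)"
proof -
  have "(\<Prod>v\<in>S. monom (w v) 1 ^ lookup m v) =
    monom (\<Prod>v\<in>S. w v ^ lookup m v) (\<Sum>v\<in>S. 1 * lookup m v)" for S
    by (induction S rule: infinite_finite_induct) (auto simp: mult_monom monom_power)
  then show ?thesis by (simp add: mono_val_def wt_def)
qed

lemma mpoly_eval_single: "mpoly_eval x (Poly_Mapping.single m c) = c * mono_val x m"
  by (simp add: mpoly_eval_def mpoly_subst_single)

text \<open>
  The part of degree \<open>j < r\<close> of \<open>G(z + W)\<close>, evaluated at \<open>W = w\<close>, is the coefficient of \<open>\<epsilon>\<^sup>j\<close> of \<open>G\<close> on the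
  line \<open>z + \<epsilon> w\<close>.  It vanishes for all \<open>w\<close> off the zero set of \<open>K\<close>, hence identically.
\<close>

lemma vanishes_if_lines:
  fixes G K :: "('v::linorder, 'a::field_char_0) mpoly"
  assumes K: "K \<noteq> 0"
    and G: "\<And>w. mpoly_eval w K \<noteq> 0 \<Longrightarrow>
      [:0, 1:] ^ r dvd mpoly_subst (\<lambda>c. [:c:]) (\<lambda>v. [:z v, w v:]) G"
  shows "vanishes G z r"
  unfolding vanishes_def
proof (intro allI impI)
  fix \<beta> :: "'v \<Rightarrow>\<^sub>0 nat" assume \<beta>: "deg \<beta> < r"
  let ?S = "{\<alpha> \<in> keys (taylor_shift G). deg \<alpha> = deg \<beta>}"
  let ?e = "\<lambda>\<alpha>. mpoly_eval z (hasse \<alpha> G)"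
  define H where "H = (\<Sum>\<alpha>\<in>?S. Poly_Mapping.single \<alpha> (?e \<alpha>))"
  have "H = 0"
  proof (rule mpoly_eq_0_if_generic_eval_0[OF K])
    fix w assume w: "mpoly_eval w K \<noteq> 0"
    interpret ev: comm_ring_hom "mpoly_eval w :: ('v, 'a) mpoly \<Rightarrow> 'a" by (rule mpoly_eval_hom)
    have eq: "[:z v, w v:] = [:z v:] + monom (w v) 1" for v
      by (simp add: monom_altdef)
    have "mpoly_subst (\<lambda>c. [:c:]) (\<lambda>v. [:z v, w v:]) G =
      (\<Sum>\<alpha>\<in>keys (taylor_shift G). [:?e \<alpha>:] * monom (mono_val w \<alpha>) (deg \<alpha>))"
      unfolding eq taylor[OF const_poly_hom] mono_val_monom
      by (simp add: mpoly_subst_const_point[OF const_poly_hom])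
    also have "coeff \<dots> (deg \<beta>) = (\<Sum>\<alpha>\<in>?S. ?e \<alpha> * mono_val w \<alpha>)"
      by (simp add: coeff_sum sum.inter_filter if_distrib cong: if_cong)
    also have "\<dots> = mpoly_eval w H"
      unfolding H_def ev.hom_sum mpoly_eval_single ..
    finally have "mpoly_eval w H = coeff (mpoly_subst (\<lambda>c. [:c:]) (\<lambda>v. [:z v, w v:]) G) (deg \<beta>)"
      by simp
    also have "\<dots> = 0"
    proof -
      from G[OF w] obtain Q where Q: "mpoly_subst (\<lambda>c. [:c:]) (\<lambda>v. [:z v, w v:]) G = [:0, 1:] ^ r * Q" by (elim dvdE)
      have "[:0, 1:] ^ r = monom (1::'a) r"
        by (simp add: monom_altdef)
      then show ?thesis unfolding Q using \<beta> by (simp add: coeff_monom_mult)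
    qed
    finally show "mpoly_eval w H = 0" .
  qed
  then have "lookup H \<beta> = 0" by simp
  also have "lookup H \<beta> = (if \<beta> \<in> keys (taylor_shift G) then ?e \<beta> else 0)"
    by (simp add: H_def lookup_sum lookup_single when_def)
  finally show "?e \<beta> = 0"
    by (auto simp: hasse_def in_keys_iff mpoly_eval_def mpoly_subst_def split: if_splits)
qed

lemma vanishes_1:
  fixes G :: "('v::linorder, 'a::field_char_0) mpoly"
  assumes "mpoly_eval x G = 0"
  shows "vanishes G x 1"
proof (rule vanishes_if_lines[where K = 1])
  fix w :: "'v \<Rightarrow> 'a"
  have "comm_ring_hom (\<lambda>p :: 'a poly. poly p 0)" by unfold_locales auto
  from hom_mpoly_subst[OF this, of "\<lambda>c. [:c:]" "\<lambda>v. [:x v, w v:]" G]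
  have "poly (mpoly_subst (\<lambda>c. [:c:]) (\<lambda>v. [:x v, w v:]) G) 0 = 0"
    using assms by (simp add: mpoly_eval_def)
  then show "[:0, 1:] ^ 1 dvd mpoly_subst (\<lambda>c. [:c:]) (\<lambda>v. [:x v, w v:]) G"
    by (simp add: poly_eq_0_iff_dvd)
qed simp

section \<open>Univariate polynomials\<close>

text \<open>
  Stated with divisibility by powers rather than with \<open>order\<close>, so that a multiplicity 0 may be attached to
  a point that is not a root.
\<close>

lemma sum_multiplicities_le_degree:
  fixes p :: "'a::field poly"
  assumes "p \<noteq> 0" "finite I" "inj_on \<tau> I" "\<And>i. i \<in> I \<Longrightarrow> [:-\<tau> i, 1:] ^ M i dvd p"
  shows "(\<Sum>i\<in>I. M i) \<le> degree p"
  using assms(2,1,3,4)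
proof (induction I arbitrary: p rule: finite_induct)
  case (insert i I)
  obtain q where q: "p = [:-\<tau> i, 1:] ^ M i * q"
    using insert.prems(3)[of i] by (auto elim: dvdE)
  have nz: "q \<noteq> 0" "[:-\<tau> i, 1:] ^ M i * q \<noteq> 0" using insert.prems(1) q by auto
  have "(\<Sum>j\<in>I. M j) \<le> degree q"
  proof (rule insert.IH[OF nz(1)])
    fix j assume j: "j \<in> I"
    then have ne: "\<tau> i \<noteq> \<tau> j" using insert.hyps insert.prems(2) by (auto simp: inj_on_def)
    have "M j \<le> order (\<tau> j) p"
      using insert.prems(3)[of j] j insert.prems(1) by (simp add: order_divides)
    also have "\<dots> = order (\<tau> j) ([:-\<tau> i, 1:] ^ M i) + order (\<tau> j) q"
      unfolding q by (rule order_mult[OF nz(2)])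
    also have "order (\<tau> j) ([:-\<tau> i, 1:] ^ M i) = 0"
      using ne by (intro order_0I) (auto simp: poly_power)
    finally show "[:-\<tau> j, 1:] ^ M j dvd q" by (simp add: order_divides)
  qed (use insert.prems(2) in auto)
  moreover have "degree p = M i + degree q"
    unfolding q using nz by (simp add: degree_mult_eq degree_power_eq)
  ultimately show ?case using insert.hyps by simp
qed simp

lemma degree_prod_linear:
  "degree (\<Prod>m\<in>S. [:-\<tau> m, 1:] :: 'a::field poly) = card S"
  by (subst degree_prod_eq_sum_degree) auto

lemma coeff_prod_linear:
  "coeff (\<Prod>m\<in>S. [:-\<tau> m, 1:] :: 'a::field poly) (card S) = 1"
  using lead_coeff_prod[of "\<lambda>m. [:-\<tau> m, 1:]" S] by (simp add: degree_prod_linear)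

lemma lagrange:
  fixes p :: "'a::field poly"
  assumes inj: "inj_on \<tau> {..<N}" and p: "degree p < N"
  shows "p = (\<Sum>l<N. Polynomial.smult (poly p (\<tau> l) / (\<Prod>m\<in>{..<N} - {l}. \<tau> l - \<tau> m))
      (\<Prod>m\<in>{..<N} - {l}. [:-\<tau> m, 1:]))" (is "p = ?q")
proof (rule poly_eqI_degree[where A = "\<tau> ` {..<N}"])
  have card: "card (\<tau> ` {..<N}) = N" using card_image[OF inj] by simp
  show "degree p < card (\<tau> ` {..<N})" using p card by simp
  have "degree ?q \<le> N - 1"
    by (rule degree_sum_le) (auto simp: degree_prod_linear intro: order.trans[OF degree_smult_le])
  then show "degree ?q < card (\<tau> ` {..<N})" using card p by simp
  fix x assume "x \<in> \<tau> ` {..<N}"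
  then obtain j where j: "j < N" "x = \<tau> j" by auto
  have *: "poly (\<Prod>m\<in>{..<N} - {l}. [:-\<tau> m, 1:]) (\<tau> j) = (if l = j then (\<Prod>m\<in>{..<N} - {j}. \<tau> j - \<tau> m) else 0)"
    if "l < N" for l
    using that j by (auto simp: poly_prod intro!: prod_zero)
  have nz: "(\<Prod>m\<in>{..<N} - {j}. \<tau> j - \<tau> m) \<noteq> 0"
    using inj j by (auto simp: inj_on_def)
  have "poly ?q x = (\<Sum>l<N. if l = j then poly p (\<tau> j) else 0)"
    unfolding poly_sum poly_smult j(2)
    by (rule sum.cong) (use nz in \<open>auto simp: *\<close>)
  also have "\<dots> = poly p x" using j by simp
  finally show "poly p x = poly ?q x" by simp
qed

text \<open>
  The left hand side is the coefficient of \<open>t\<^sup>N\<^sup>-\<^sup>1\<close> in the interpolation formula.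
\<close>

lemma lagrange_lead:
  fixes p :: "'a::field poly"
  assumes inj: "inj_on \<tau> {..<N}" and p: "degree p < N - 1"
  shows "(\<Sum>l<N. poly p (\<tau> l) / (\<Prod>m\<in>{..<N} - {l}. \<tau> l - \<tau> m)) = 0"
proof -
  have "degree p < N" using p by simp
  have "0 = coeff p (N - 1)" using p by (simp add: coeff_eq_0)
  also have "\<dots> = (\<Sum>l<N. poly p (\<tau> l) / (\<Prod>m\<in>{..<N} - {l}. \<tau> l - \<tau> m) *
      coeff (\<Prod>m\<in>{..<N} - {l}. [:-\<tau> m, 1:]) (N - 1))"
    by (subst lagrange[OF inj \<open>degree p < N\<close>]) (simp add: coeff_sum)
  also have "\<dots> = (\<Sum>l<N. poly p (\<tau> l) / (\<Prod>m\<in>{..<N} - {l}. \<tau> l - \<tau> m))"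
  proof (rule sum.cong)
    fix l assume "l \<in> {..<N}"
    then have "card ({..<N} - {l}) = N - 1" by simp
    then show "poly p (\<tau> l) / (\<Prod>m\<in>{..<N} - {l}. \<tau> l - \<tau> m) *
      coeff (\<Prod>m\<in>{..<N} - {l}. [:-\<tau> m, 1:]) (N - 1) =
      poly p (\<tau> l) / (\<Prod>m\<in>{..<N} - {l}. \<tau> l - \<tau> m)"
      using coeff_prod_linear[of \<tau> "{..<N} - {l}"] by simp
  qed simp
  finally show ?thesis by simp
qed

section \<open>Polynomials in a parameter and a deformation variable\<close>

text \<open>
  In \<open>'a poly poly\<close> the outer variable is \<open>\<epsilon>\<close> and the inner one is \<open>t\<close>.
\<close>

definition inner_degree :: "nat \<Rightarrow> 'a::comm_ring_1 poly poly set" where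
  "inner_degree j = {p. \<forall>i. degree (coeff p i) \<le> j}"

lemma filtration_inner_degree: "filtration (inner_degree :: nat \<Rightarrow> 'a::comm_ring_1 poly poly set)"
  unfolding filtration_def
proof (intro conjI allI ballI)
  fix i j and a b :: "'a poly poly" assume "a \<in> inner_degree i" "b \<in> inner_degree j"
  then show "a * b \<in> inner_degree (i + j)"
    by (auto simp: inner_degree_def coeff_mult intro!: degree_sum_le
          intro: order.trans[OF degree_mult_le] add_mono)
qed (auto simp: inner_degree_def intro: degree_add_le)

text \<open>
  The powers of the ideal generated by \<open>\<epsilon>\<close> and \<open>t - \<tau>\<close>.
\<close>

definition jet_filtration :: "'a::comm_ring_1 \<Rightarrow> nat \<Rightarrow> 'a poly poly set" where
  "jet_filtration \<tau> j = {p. \<forall>e. [:-\<tau>, 1:] ^ (j - e) dvd coeff p e}"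

lemma filtration_jet_filtration: "filtration (jet_filtration \<tau>)"
  unfolding filtration_def
proof (intro conjI allI ballI)
  fix i j a b assume a: "a \<in> jet_filtration \<tau> i" and b: "b \<in> jet_filtration \<tau> j"
  show "a * b \<in> jet_filtration \<tau> (i + j)"
    unfolding jet_filtration_def
  proof (intro CollectI allI)
    fix e
    show "[:-\<tau>, 1:] ^ (i + j - e) dvd coeff (a * b) e"
      unfolding coeff_mult
    proof (rule dvd_sum)
      fix k assume k: "k \<in> {..e}"
      have "[:-\<tau>, 1:] ^ (i + j - e) dvd [:-\<tau>, 1:] ^ (i - k) * [:-\<tau>, 1:] ^ (j - (e - k))"
        unfolding power_add[symmetric] by (rule le_imp_power_dvd) (use k in auto)
      also have "\<dots> dvd coeff a k * coeff b (e - k)"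
        using a b by (intro mult_dvd_mono) (auto simp: jet_filtration_def)
      finally show "[:-\<tau>, 1:] ^ (i + j - e) dvd coeff a k * coeff b (e - k)" .
    qed
  qed
qed (auto simp: jet_filtration_def)

lemma filtration_dvd: "filtration (\<lambda>j. {p :: 'r::comm_ring_1. x ^ j dvd p})"
  by (auto simp: filtration_def power_add intro: mult_dvd_mono)

text \<open>
  If the product is divisible by \<open>\<epsilon>\<^sup>e\<close> then so is \<open>B\<close>, as \<open>\<epsilon>\<close> is prime and does not divide \<open>A\<close>.
\<close>

lemma coeff_mult_lowest:
  fixes A B :: "'a::idom poly"
  assumes A: "coeff A 0 \<noteq> 0" and low: "\<And>i. i < e \<Longrightarrow> coeff (A * B) i = 0"
  shows "coeff (A * B) e = coeff A 0 * coeff B e"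
proof -
  have step: "coeff (A * B) i = coeff A 0 * coeff B i"
    if "\<And>j. j < i \<Longrightarrow> coeff B j = 0" for i
  proof -
    have "coeff (A * B) i = (\<Sum>j\<le>i. if j = 0 then coeff A 0 * coeff B i else 0)"
      unfolding coeff_mult using that by (intro sum.cong) auto
    then show ?thesis by simp
  qed
  have "coeff B i = 0" if "i < e" for i
    using that
  proof (induction i rule: less_induct)
    case (less i)
    have "coeff A 0 * coeff B i = 0"
      using step[of i] low[of i] less by auto
    then show ?case using A by simp
  qed
  then show ?thesis using step by blast
qed

section \<open>Deforming a curve through all but one of the points\<close>

text \<open>
  The curve \<open>c\<close> is written through its values at the nodes \<open>\<tau>\<close>, and the nodes and the values are then moved by
  \<open>\<kappa>\<close>.  The block \<open>b0\<close> is meant to be one where \<open>c\<close> has degree at most \<open>N - 2\<close>.  Interpolation at \<open>N\<close> nodes gives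
  degree \<open>N - 1\<close> in general, and the top coefficient stays 0 only if values and nodes move together there;
  this is why \<open>\<kappa> b0\<close> enters both \<open>node\<close> and \<open>scaling\<close>.
\<close>

locale curve_deformation =
  fixes N :: nat and \<tau> :: "nat \<Rightarrow> 'a::field_char_0" and c :: "'v \<Rightarrow> 'a poly"
    and blk :: "'v \<Rightarrow> 'b" and b0 :: 'b and \<kappa> :: "'b \<Rightarrow> nat \<Rightarrow> 'a"
  assumes inj: "inj_on \<tau> {..<N}"
begin

text \<open>
  The polynomial \<open>(1 + \<epsilon> \<kappa>\<^sub>l) t - \<tau>\<^sub>l\<close>.  Its value at \<open>t = 0\<close> does not depend on \<open>\<epsilon>\<close>, so that the point of the
  deformed curve with parameter 0 is linear in \<open>\<epsilon>\<close>.
\<close>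

definition node :: "nat \<Rightarrow> 'a poly poly" where
  "node l = [:[:-\<tau> l, 1:], [:0, \<kappa> b0 l:]:]"

definition scaling :: "'b \<Rightarrow> nat \<Rightarrow> 'a poly poly" where
  "scaling b l = [:1, [:\<kappa> b l:]:]"

definition lagrange_coeff :: "'v \<Rightarrow> nat \<Rightarrow> 'a" where
  "lagrange_coeff v l = poly (c v) (\<tau> l) / (\<Prod>m\<in>{..<N} - {l}. \<tau> l - \<tau> m)"

definition curve :: "'v \<Rightarrow> 'a poly poly" where
  "curve v = (\<Sum>l<N. [:[:lagrange_coeff v l:]:] * scaling (blk v) l * (\<Prod>m\<in>{..<N} - {l}. node m))"

lemma curve_coeff_0:
  assumes "degree (c v) < N"
  shows "coeff (curve v) 0 = c v"
proof -
  have "coeff (curve v) 0 = poly (curve v) 0" by (simp add: poly_0_coeff_0)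
  also have "\<dots> = (\<Sum>l<N. Polynomial.smult (lagrange_coeff v l) (\<Prod>m\<in>{..<N} - {l}. [:-\<tau> m, 1:]))"
    by (simp add: curve_def poly_sum poly_prod scaling_def node_def)
  also have "\<dots> = c v"
    unfolding lagrange_coeff_def using lagrange[OF inj assms] by simp
  finally show ?thesis .
qed

text \<open>
  The summands of the coefficient of \<open>\<epsilon>\<close> are multiples of the values \<open>c(\<tau>\<^sub>l)\<close> with factors that can be
  chosen at will through \<open>\<kappa>\<close>.  Hence the direction in which the point moves is arbitrary as soon as these
  values span.
\<close>

lemma curve_at_0:
  assumes "degree (c v) < N"
  shows "map_poly (\<lambda>p. poly p 0) (curve v) =
    [:poly (c v) 0, (\<Sum>l<N. lagrange_coeff v l * \<kappa> (blk v) l * (\<Prod>m\<in>{..<N} - {l}. - \<tau> m)):]"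
proof -
  interpret p0: comm_ring_hom "\<lambda>p :: 'a poly. poly p 0"
    by unfold_locales auto
  interpret p0: map_poly_comm_ring_hom "\<lambda>p :: 'a poly. poly p 0" ..
  have node: "map_poly (\<lambda>p. poly p 0) (node m) = [:- \<tau> m:]" for m
    by (rule poly_eqI) (auto simp: node_def coeff_map_poly coeff_pCons split: nat.splits)
  have scaling: "map_poly (\<lambda>p. poly p 0) (scaling b l) = [:1, \<kappa> b l:]" for b l
    by (rule poly_eqI) (auto simp: scaling_def coeff_map_poly coeff_pCons split: nat.splits)
  have const: "map_poly (\<lambda>p. poly p 0) [:[:x:]:] = [:x:]" for x :: 'a
    by (rule poly_eqI) (auto simp: coeff_map_poly coeff_pCons split: nat.splits)
  have cprod: "(\<Prod>m\<in>S. [:- \<tau> m:]) = [:\<Prod>m\<in>S. - \<tau> m:]" for S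
    by (induction S rule: infinite_finite_induct) auto
  have cv: "poly (c v) 0 = (\<Sum>l<N. lagrange_coeff v l * (\<Prod>m\<in>{..<N} - {l}. - \<tau> m))"
    unfolding lagrange_coeff_def by (subst lagrange[OF inj assms]) (simp add: poly_sum poly_prod)
  have s2: "(\<Sum>l\<in>S. [:f l, g l:]) = [:\<Sum>l\<in>S. f l, \<Sum>l\<in>S. g l:]" for S :: "nat set" and f g :: "nat \<Rightarrow> 'a"
    by (induction S rule: infinite_finite_induct) auto
  have "map_poly (\<lambda>p. poly p 0) (curve v) =
    (\<Sum>l<N. [:lagrange_coeff v l * (\<Prod>m\<in>{..<N} - {l}. - \<tau> m), lagrange_coeff v l * \<kappa> (blk v) l * (\<Prod>m\<in>{..<N} - {l}. - \<tau> m):])"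
    unfolding curve_def p0.hom_sum p0.hom_mult p0.hom_prod node scaling const cprod
    by (intro sum.cong) (auto simp: algebra_simps)
  then show ?thesis unfolding s2 cv .
qed

lemma node_inner_degree: "node m \<in> inner_degree 1"
  by (auto simp: inner_degree_def node_def coeff_pCons split: nat.splits)

lemma prod_node_inner_degree: "finite S \<Longrightarrow> (\<Prod>m\<in>S. node m) \<in> inner_degree (card S)"
proof (induction S rule: finite_induct)
  case (insert m S)
  then show ?case
    using filtrationD(4)[OF filtration_inner_degree node_inner_degree, of _ _ m] by fastforce
qed (simp add: filtrationD(3)[OF filtration_inner_degree])

lemma const_inner_degree: "[:[:x:]:] \<in> inner_degree 0"
  by (auto simp: inner_degree_def coeff_pCons split: nat.splits)

lemma curve_inner_degree: "curve v \<in> inner_degree (N - 1)"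
  unfolding curve_def
proof (rule filtration_sum[OF filtration_inner_degree])
  fix l assume l: "l \<in> {..<N}"
  have "scaling (blk v) l \<in> inner_degree 0"
    by (auto simp: inner_degree_def scaling_def coeff_pCons split: nat.splits)
  from filtrationD(4)[OF filtration_inner_degree const_inner_degree this]
  have "[:[:lagrange_coeff v l:]:] * scaling (blk v) l \<in> inner_degree 0" by simp
  from filtrationD(4)[OF filtration_inner_degree this prod_node_inner_degree[of "{..<N} - {l}"]]
  show "[:[:lagrange_coeff v l:]:] * scaling (blk v) l * (\<Prod>m\<in>{..<N} - {l}. node m) \<in> inner_degree (N - 1)"
    using l by simp
qed

text \<open>
  Multiplying by \<open>t\<close> replaces \<open>(1 + \<epsilon> \<kappa>\<^sub>l) t\<close> by \<open>node l + \<tau>\<^sub>l\<close> in each term.  The terms with \<open>node l\<close> add up to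
  \<open>\<Sum> lagrange_coeff v l\<close> times the product of all nodes, and that sum is 0 because the degree of \<open>c v\<close> is
  smaller than \<open>N - 1\<close>.
\<close>

lemma curve_inner_degree_b0:
  assumes "blk v = b0" "degree (c v) < N - 1"
  shows "curve v \<in> inner_degree (N - 2)"
proof -
  \<comment> \<open>The inner variable \<open>t\<close>.\<close>
  define T :: "'a poly poly" where "T = [:[:0, 1:]:]"
  have T: "T * scaling b0 l = node l + [:[:\<tau> l:]:]" for l
    by (simp add: T_def scaling_def node_def)
  have prod: "node l * (\<Prod>m\<in>{..<N} - {l}. node m) = (\<Prod>m<N. node m)" if "l < N" for l
    by (rule prod.remove[symmetric]) (use that in auto)
  have s0: "(\<Sum>l\<in>S. [:[:f l:]:]) = [:[:\<Sum>l\<in>S. f l:]:]" for S :: "nat set" and f :: "nat \<Rightarrow> 'a"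
    by (induction S rule: infinite_finite_induct) auto
  have "T * curve v = (\<Sum>l<N. [:[:lagrange_coeff v l:]:] * (T * scaling b0 l) * (\<Prod>m\<in>{..<N} - {l}. node m))"
    by (simp add: curve_def assms(1) sum_distrib_left mult_ac)
  also have "\<dots> = (\<Sum>l<N. [:[:lagrange_coeff v l:]:] * (node l * (\<Prod>m\<in>{..<N} - {l}. node m)) +
      [:[:lagrange_coeff v l:]:] * [:[:\<tau> l:]:] * (\<Prod>m\<in>{..<N} - {l}. node m))"
    unfolding T by (simp only: algebra_simps)
  also have "\<dots> = (\<Sum>l<N. [:[:lagrange_coeff v l:]:]) * (\<Prod>m<N. node m) +
      (\<Sum>l<N. [:[:lagrange_coeff v l:]:] * [:[:\<tau> l:]:] * (\<Prod>m\<in>{..<N} - {l}. node m))"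
    unfolding sum.distrib sum_distrib_right by (intro arg_cong2[of _ _ _ _ "(+)"] sum.cong) (auto simp: prod)
  also have "(\<Sum>l<N. [:[:lagrange_coeff v l:]:]) = 0"
    unfolding s0 lagrange_coeff_def using lagrange_lead[OF inj assms(2)] by simp
  finally have eq: "T * curve v = (\<Sum>l<N. [:[:lagrange_coeff v l:]:] * [:[:\<tau> l:]:] * (\<Prod>m\<in>{..<N} - {l}. node m))"
    by simp
  have "T * curve v \<in> inner_degree (N - 1)"
    unfolding eq
  proof (rule filtration_sum[OF filtration_inner_degree])
    fix l assume l: "l \<in> {..<N}"
    from filtrationD(4)[OF filtration_inner_degree const_inner_degree const_inner_degree]
    have "[:[:lagrange_coeff v l:]:] * [:[:\<tau> l:]:] \<in> inner_degree 0" by simp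
    from filtrationD(4)[OF filtration_inner_degree this prod_node_inner_degree[of "{..<N} - {l}"]]
    show "[:[:lagrange_coeff v l:]:] * [:[:\<tau> l:]:] * (\<Prod>m\<in>{..<N} - {l}. node m) \<in> inner_degree (N - 1)"
      using l by simp
  qed
  then have "degree ([:0, 1:] * coeff (curve v) i) \<le> N - 1" for i
    by (simp add: inner_degree_def T_def)
  then have "degree (coeff (curve v) i) \<le> N - 2" for i
  proof -
    have "degree ([:0, 1:] * coeff (curve v) i) \<le> N - 1" by fact
    then show ?thesis
      by (cases "coeff (curve v) i = 0") (auto simp: degree_mult_eq)
  qed
  then show ?thesis by (simp add: inner_degree_def)
qed

text \<open>
  Modulo \<open>node l\<close> only the term of index \<open>l\<close> survives: the deformed curve passes through the same point.
\<close>

lemma curve_through_node: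
  assumes l: "l < N"
  obtains s W where "\<And>v. curve v = s (blk v) * [:[:poly (c v) (\<tau> l):]:] + W v" "\<And>v. node l dvd W v"
proof
  let ?D = "\<Prod>m\<in>{..<N} - {l}. \<tau> l - \<tau> m"
  let ?t = "\<lambda>v j. [:[:lagrange_coeff v j:]:] * scaling (blk v) j * (\<Prod>m\<in>{..<N} - {j}. node m)"
  show "curve v = ([:[:1 / ?D:]:] * scaling (blk v) l * (\<Prod>m\<in>{..<N} - {l}. node m)) * [:[:poly (c v) (\<tau> l):]:] +
     (\<Sum>j\<in>{..<N} - {l}. ?t v j)" for v
  proof -
    have "[:[:1 / ?D:]:] * [:[:poly (c v) (\<tau> l):]:] = [:[:lagrange_coeff v l:]:]"
      by (simp add: lagrange_coeff_def)
    then have "([:[:1 / ?D:]:] * scaling (blk v) l * (\<Prod>m\<in>{..<N} - {l}. node m)) * [:[:poly (c v) (\<tau> l):]:] = ?t v l"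
      by (simp only: mult_ac flip: \<open>[:[:1 / ?D:]:] * [:[:poly (c v) (\<tau> l):]:] = [:[:lagrange_coeff v l:]:]\<close>)
    moreover have "curve v = ?t v l + (\<Sum>j\<in>{..<N} - {l}. ?t v j)"
      unfolding curve_def by (rule sum.remove) (use l in auto)
    ultimately show ?thesis by simp
  qed
  show "node l dvd (\<Sum>j\<in>{..<N} - {l}. ?t v j)" for v
    using l by (intro dvd_sum dvd_mult dvd_prodI) auto
qed

end

section \<open>Multiplicity along a curve\<close>

lemma X_power_eq_monom: "[:0, 1:] ^ r = monom (1::'a::comm_ring_1) r"
  by (simp add: monom_altdef)

lemma const2_hom: "comm_ring_hom (\<lambda>c. [:[:c:]:] :: 'a::comm_ring_1 poly poly)"
  by (rule hom_comp[OF const_poly_hom const_poly_hom])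

definition factor_degree :: "nat \<Rightarrow> pvar \<Rightarrow> nat" where
  "factor_degree n v = (case factor_of v of First \<Rightarrow> n | Second \<Rightarrow> n + 1)"

lemma wt_factor_degree:
  assumes "mform (pvars n) factor_of d G" "m \<in> keys G"
  shows "wt (factor_degree n) m = n * d First + (n + 1) * d Second"
proof -
  have "wt (factor_degree n) m = wt (\<lambda>v. n * block_wt factor_of First v + (n + 1) * block_wt factor_of Second v) m"
  proof (rule wt_cong)
    fix v show "factor_degree n v = n * block_wt factor_of First v + (n + 1) * block_wt factor_of Second v"
      by (cases "factor_of v") (auto simp: factor_degree_def block_wt_def)
  qed
  also have "\<dots> = n * wt (block_wt factor_of First) m + (n + 1) * wt (block_wt factor_of Second) m"
    by (simp only: wt_mult_weights wt_plus_weights[symmetric])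
  finally show ?thesis using assms by (simp add: mform_iff)
qed

lemma finite_pvars [simp]: "finite (pvars n)"
  by (simp add: pvars_def)

text \<open>
  The deformation is chosen so that the point with parameter 0 moves in the direction \<open>w\<close>, and the zeros of the
  lowest coefficient in \<open>\<epsilon>\<close> are counted against its degree.
\<close>

theorem multiplicity_along_curve:
  fixes c :: "pvar \<Rightarrow> 'a::field_char_0 poly" and \<tau> :: "nat \<Rightarrow> 'a"
  assumes G: "mform (pvars n) factor_of d G"
    and c: "\<And>v. v \<in> pvars n \<Longrightarrow> degree (c v) \<le> factor_degree n v"
    and inj_\<tau>: "inj_on \<tau> {..<n + 3}" and nz: "\<And>l. l < n + 2 \<Longrightarrow> \<tau> l \<noteq> 0"
    and van: "\<And>i. i < n + 3 \<Longrightarrow> vanishes G (\<lambda>v. poly (c v) (\<tau> i)) (M i)"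
    and span: "\<And>w b. \<exists>g. \<forall>v\<in>pvars n. factor_of v = b \<longrightarrow> w v = (\<Sum>l<n + 2. g l * poly (c v) (\<tau> l))"
  shows "vanishes G (\<lambda>v. poly (c v) 0)
    (nat (int (\<Sum>i<n + 3. M i) - int n * int (d First) - (int n + 1) * int (d Second)))"
    (is "vanishes G _ ?r")
proof (rule vanishes_if_lines[where K = 1])
  fix w :: "pvar \<Rightarrow> 'a"
  let ?D = "\<lambda>l. \<Prod>m\<in>{..<n + 2} - {l}. \<tau> l - \<tau> m"
  let ?E = "\<lambda>l. \<Prod>m\<in>{..<n + 2} - {l}. - \<tau> m"
  from span[of _ w] obtain g where g:
    "\<And>b v. v \<in> pvars n \<Longrightarrow> factor_of v = b \<Longrightarrow> w v = (\<Sum>l<n + 2. g b l * poly (c v) (\<tau> l))"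
    by metis
  \<comment> \<open>The factors cancel those by which the values of the curve at the nodes enter its derivative at 0.\<close>
  define \<kappa> where "\<kappa> b l = g b l * ?D l / ?E l" for b l
  have inj': "inj_on \<tau> {..<n + 2}" by (rule inj_on_subset[OF inj_\<tau>]) auto
  interpret curve_deformation "n + 2" \<tau> c factor_of First \<kappa>
    by unfold_locales (rule inj')
  have cN: "degree (c v) < n + 2" if "v \<in> pvars n" for v
    using c[OF that] by (auto simp: factor_degree_def split: factor.splits)
  define P where "P = mpoly_subst (\<lambda>c. [:[:c:]:]) curve G"
  have low: "coeff P e = 0" if e: "e < ?r" for e
  proof (rule ccontr)
    assume "coeff P e \<noteq> 0"
    define e0 where "e0 = (LEAST e. coeff P e \<noteq> 0)"
    have e0: "coeff P e0 \<noteq> 0" "\<And>i. i < e0 \<Longrightarrow> coeff P i = 0" "e0 \<le> e"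
      unfolding e0_def using LeastI[of "\<lambda>e. coeff P e \<noteq> 0", OF \<open>coeff P e \<noteq> 0\<close>]
        not_less_Least Least_le[of "\<lambda>e. coeff P e \<noteq> 0", OF \<open>coeff P e \<noteq> 0\<close>] by auto
    have "P \<in> inner_degree (n * d First + (n + 1) * d Second)"
      unfolding P_def
    proof (rule filtration_mpoly_subst[OF filtration_inner_degree const_inner_degree, where \<omega> = "factor_degree n"])
      fix m v assume "m \<in> keys G" "v \<in> keys m"
      then have v: "v \<in> pvars n" using mform_keysD[OF G] by auto
      show "curve v \<in> inner_degree (factor_degree n v)"
      proof (cases "factor_of v")
        case First
        then show ?thesis
          using curve_inner_degree_b0[of v] c[OF v] by (auto simp: factor_degree_def)
      next
        case Second
        then show ?thesis
          using curve_inner_degree[of v] by (auto simp: factor_degree_def)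
      qed
    qed (simp add: wt_factor_degree[OF G])
    then have degP: "degree (coeff P e0) \<le> n * d First + (n + 1) * d Second"
      by (simp add: inner_degree_def)
    \<comment> \<open>Each step in the order in \<open>\<epsilon>\<close> loses one zero at the point that the deformed curves miss.\<close>
    define M' where "M' i = (if i = n + 2 then M i - e0 else M i)" for i
    have dvd: "[:-\<tau> i, 1:] ^ M' i dvd coeff P e0" if i: "i < n + 3" for i
    proof (cases "i = n + 2")
      case False
      with i have i: "i < n + 2" by simp
      obtain s W where sW: "\<And>v. curve v = s (factor_of v) * [:[:poly (c v) (\<tau> i):]:] + W v"
        "\<And>v. node i dvd W v" by (rule curve_through_node[OF i]) blast
      have "P \<in> {p. node i ^ M i dvd p}"
        unfolding P_def sW(1)[abs_def]
        by (rule vanishes_filtration[OF G _ van const2_hom filtration_dvd])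
           (use i sW(2) in \<open>auto intro: power_le_dvd\<close>)
      then obtain Q where Q: "P = node i ^ M i * Q" by (auto elim: dvdE)
      have node0: "coeff (node i ^ M i) 0 = [:-\<tau> i, 1:] ^ M i"
        by (simp add: coeff_0_power node_def)
      have "coeff P e0 = coeff (node i ^ M i) 0 * coeff Q e0"
        unfolding Q by (rule coeff_mult_lowest) (use e0 node0 in \<open>auto simp: Q\<close>)
      then show ?thesis using False by (simp add: node0 M'_def)
    next
      case True
      have "P \<in> jet_filtration (\<tau> i) (M i)"
      proof -
        have "P = mpoly_subst (\<lambda>c. [:[:c:]:])
            (\<lambda>v. (\<lambda>_. 1) (factor_of v) * [:[:poly (c v) (\<tau> i):]:] + (curve v - [:[:poly (c v) (\<tau> i):]:])) G"
          by (simp add: P_def)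
        also have "\<dots> \<in> jet_filtration (\<tau> i) (M i)"
        proof (rule vanishes_filtration[OF G _ van[OF i] const2_hom filtration_jet_filtration])
          fix v assume v: "v \<in> pvars n"
          have "[:-\<tau> i, 1:] ^ (1 - e) dvd coeff (curve v - [:[:poly (c v) (\<tau> i):]:]) e" for e
          proof (cases e)
            case 0
            have "poly (c v - [:poly (c v) (\<tau> i):]) (\<tau> i) = 0" by simp
            then have "[:-\<tau> i, 1:] dvd c v - [:poly (c v) (\<tau> i):]"
              by (simp only: poly_eq_0_iff_dvd)
            then show ?thesis using 0 curve_coeff_0[OF cN[OF v]] by simp
          qed simp
          then show "curve v - [:[:poly (c v) (\<tau> i):]:] \<in> jet_filtration (\<tau> i) 1"
            by (simp add: jet_filtration_def)
        qed (auto simp: jet_filtration_def intro: power_le_dvd elim!: dvd_trans[rotated] intro!: le_imp_power_dvd)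
        finally show ?thesis .
      qed
      then show ?thesis using True by (simp add: jet_filtration_def M'_def)
    qed
    have "(\<Sum>i<n + 3. M' i) \<le> degree (coeff P e0)"
      by (rule sum_multiplicities_le_degree[OF e0(1) _ inj_\<tau>]) (use dvd in auto)
    moreover have "(\<Sum>i<n + 3. M' i) = (\<Sum>i<n + 2. M i) + (M (n + 2) - e0)"
    proof -
      have "(\<Sum>i<n + 3. M' i) = (\<Sum>i<n + 2. M' i) + M' (n + 2)"
        by (simp add: numeral_3_eq_3)
      moreover have "(\<Sum>i<n + 2. M' i) = (\<Sum>i<n + 2. M i)"
        by (rule sum.cong) (auto simp: M'_def)
      ultimately show ?thesis by (simp add: M'_def)
    qed
    moreover have "(\<Sum>i<n + 3. M i) = (\<Sum>i<n + 2. M i) + M (n + 2)"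
      by (simp add: numeral_3_eq_3)
    moreover have "int e < int (\<Sum>i<n + 3. M i) - int n * int (d First) - (int n + 1) * int (d Second)"
      using e by simp
    then have "int e + int (n * d First + (n + 1) * d Second) < int (\<Sum>i<n + 3. M i)"
      by (simp add: algebra_simps)
    then have "e + (n * d First + (n + 1) * d Second) < (\<Sum>i<n + 3. M i)"
      by linarith
    ultimately show False using degP e0(3) by linarith
  qed
  interpret p0: comm_ring_hom "\<lambda>p :: 'a poly. poly p 0"
    by unfold_locales auto
  interpret p0: map_poly_comm_ring_hom "\<lambda>p :: 'a poly. poly p 0" ..
  have "map_poly (\<lambda>p. poly p 0) P =
      mpoly_subst (\<lambda>c. map_poly (\<lambda>p. poly p 0) [:[:c:]:]) (\<lambda>v. map_poly (\<lambda>p. poly p 0) (curve v)) G"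
    unfolding P_def by (rule hom_mpoly_subst) (rule p0.comm_ring_hom_axioms)
  also have "(\<lambda>c. map_poly (\<lambda>p. poly p 0) [:[:c:]:]) = (\<lambda>c::'a. [:c:])"
    by (intro ext poly_eqI) (auto simp: coeff_map_poly coeff_pCons split: nat.splits)
  also have "mpoly_subst (\<lambda>c. [:c:]) (\<lambda>v. map_poly (\<lambda>p. poly p 0) (curve v)) G =
     mpoly_subst (\<lambda>c. [:c:]) (\<lambda>v. [:poly (c v) 0, w v:]) G"
  proof (rule mpoly_subst_mform_cong[OF G])
    fix v assume v: "v \<in> pvars n"
    have "lagrange_coeff v l * \<kappa> (factor_of v) l * ?E l = g (factor_of v) l * poly (c v) (\<tau> l)" if l: "l < n + 2" for l
    proof -
      have "?D l \<noteq> 0" "?E l \<noteq> 0"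
        using inj' l nz by (auto simp: inj_on_def)
      then show ?thesis unfolding lagrange_coeff_def \<kappa>_def by (simp del: prod_zero_iff)
    qed
    then have "(\<Sum>l<n + 2. lagrange_coeff v l * \<kappa> (factor_of v) l * ?E l) = w v"
      using g[OF v refl] by simp
    then show "map_poly (\<lambda>p. poly p 0) (curve v) = [:poly (c v) 0, w v:]"
      using curve_at_0[OF cN[OF v]] by simp
  qed
  finally have "mpoly_subst (\<lambda>c. [:c:]) (\<lambda>v. [:poly (c v) 0, w v:]) G = map_poly (\<lambda>p. poly p 0) P" ..
  then show "[:0, 1:] ^ ?r dvd mpoly_subst (\<lambda>c. [:c:]) (\<lambda>v. [:poly (c v) 0, w v:]) G"
    using low by (simp add: X_power_eq_monom monom_1_dvd_iff' coeff_map_poly)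
qed simp

section \<open>Multiplicity along spans\<close>

text \<open>
  A monomial in the variables \<open>A\<^sub>i\<close> and \<open>W\<close> that is small in \<open>W\<close> is large in the \<open>A\<^sub>i\<close>; but for each \<open>i\<close> its
  degree outside \<open>A\<^sub>i\<close> is at least \<open>r\<close>.
\<close>

theorem multiplicity_along_span:
  fixes G :: "('v::linorder, 'a::field_char_0) mpoly" and z :: "nat \<Rightarrow> 'v \<Rightarrow> 'a"
  assumes G: "mform Vs blk d G" and fin: "finite Vs" "finite B" and B: "blk ` Vs \<subseteq> B"
    and z: "\<And>i. i < k \<Longrightarrow> vanishes G (z i) r"
    and x: "\<And>v. v \<in> Vs \<Longrightarrow> x v = (\<Sum>i<k. a (blk v) i * z i v)" and k: "k \<ge> 1"
  shows "vanishes G x (k * r - (k - 1) * (\<Sum>b\<in>B. d b))"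
    (is "vanishes G x ?R")
proof (rule vanishes_if_lines[where K = 1])
  fix w :: "'v \<Rightarrow> 'a"
  define P where "P = mpoly_subst Const
     (\<lambda>v. (\<Sum>i<k. Var (Inl (i, blk v)) * Const (z i v)) + Var (Inr v) :: ((nat \<times> 'b) + 'v, 'a) mpoly) G"
  define wW :: "(nat \<times> 'b) + 'v \<Rightarrow> nat" where "wW = (\<lambda>u. case u of Inl _ \<Rightarrow> 0 | Inr _ \<Rightarrow> 1)"
  \<comment> \<open>Indices \<open>j \<ge> k\<close> do not occur; with weight 0 for them the weights \<open>wi i\<close>
    add up to at most \<open>k - 1 + wW\<close> at every variable.\<close>
  define wi :: "nat \<Rightarrow> (nat \<times> 'b) + 'v \<Rightarrow> nat" where
    "wi i = (\<lambda>u. case u of Inl (j, _) \<Rightarrow> of_bool (j \<noteq> i \<and> j < k) | Inr _ \<Rightarrow> 1)" for i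
  have Gdeg: "deg m = (\<Sum>b\<in>B. d b)" if m: "m \<in> keys G" for m
  proof -
    have "(\<Sum>b\<in>B. d b) = (\<Sum>b\<in>B. wt (block_wt blk b) m)"
      using G m by (simp add: mform_iff)
    also have "\<dots> = wt (\<lambda>v. \<Sum>b\<in>B. block_wt blk b v) m"
      by (rule wt_sum_weights[OF fin(2)])
    also have "\<dots> = deg m"
    proof (rule wt_cong)
      fix v assume "v \<in> keys m"
      then have "blk v \<in> B" using mform_keysD[OF G m] B by auto
      then show "(\<Sum>b\<in>B. block_wt blk b v) = 1"
        using fin by (simp add: block_wt_def of_bool_def)
    qed
    finally show ?thesis ..
  qed
  have tot: "deg m = (\<Sum>b\<in>B. d b)" if "m \<in> keys P" for m
  proof -
    let ?F = "\<lambda>j. {Q :: ((nat \<times> 'b) + 'v, 'a) mpoly. \<forall>m\<in>keys Q. deg m = j}"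
    have V: "Var u \<in> ?F 1" for u by (auto simp: Var_def split: if_splits)
    have C: "Const u \<in> ?F 0" for u by (auto simp: Const_def split: if_splits)
    have "P \<in> ?F (\<Sum>b\<in>B. d b)"
      unfolding P_def
    proof (rule filtration_mpoly_subst[OF filtration_graded C, where \<omega> = "\<lambda>_. 1"])
      fix v
      have "Var (Inl (i, blk v)) * Const (z i v) \<in> ?F 1" for i
        using filtrationD(4)[OF filtration_graded V C] by simp
      then show "(\<Sum>i<k. Var (Inl (i, blk v)) * Const (z i v)) + Var (Inr v) \<in> ?F 1"
        by (intro filtrationD(2)[OF filtration_graded] filtration_sum[OF filtration_graded] V)
    qed (simp add: Gdeg del: One_nat_def)
    then show ?thesis using that by simp
  qed
  have near: "wt (wi i) m \<ge> r" if i: "i < k" and m: "m \<in> keys P" for i m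
  proof -
    let ?F = "\<lambda>j. {Q :: ((nat \<times> 'b) + 'v, 'a) mpoly. \<forall>m\<in>keys Q. wt (wi i) m \<ge> j}"
    have V: "Var u \<in> ?F (wi i u)" for u by (auto simp: Var_def split: if_splits)
    have C: "Const u \<in> ?F 0" for u by (auto simp: Const_def split: if_splits)
    have "P = mpoly_subst Const (\<lambda>v. (\<lambda>b. Var (Inl (i, b))) (blk v) * Const (z i v) +
        ((\<Sum>j\<in>{..<k} - {i}. Var (Inl (j, blk v)) * Const (z j v)) + Var (Inr v))) G"
      unfolding P_def by (subst sum.remove[of _ i]) (use i in \<open>auto simp: add_ac\<close>)
    also have "\<dots> \<in> ?F r"
    proof (rule vanishes_filtration[OF G fin(1) z[OF i] Const_hom filtration_order_ge])
      fix v
      have "Var (Inl (j, blk v)) * Const (z j v) \<in> ?F 1" if "j \<in> {..<k} - {i}" for j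
        using filtrationD(4)[OF filtration_order_ge V C, of "Inl (j, blk v)" "z j v"] that by (simp add: wi_def)
      moreover have "Var (Inr v) \<in> ?F 1" using V[of "Inr v"] by (simp add: wi_def)
      ultimately show "(\<Sum>j\<in>{..<k} - {i}. Var (Inl (j, blk v)) * Const (z j v)) + Var (Inr v) \<in> ?F 1"
        by (intro filtrationD(2)[OF filtration_order_ge] filtration_sum[OF filtration_order_ge])
    qed (use C in auto)
    finally show ?thesis using m by simp
  qed
  have far: "wt wW m \<ge> ?R" if m: "m \<in> keys P" for m
  proof -
    have "k * r = (\<Sum>i<k. r)" by simp
    also have "\<dots> \<le> (\<Sum>i<k. wt (wi i) m)" by (rule sum_mono) (use near m in auto)
    also have "\<dots> = wt (\<lambda>u. \<Sum>i<k. wi i u) m" by (rule wt_sum_weights) simp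
    also have "\<dots> \<le> wt (\<lambda>u. (k - 1) * 1 + wW u) m"
    proof (rule wt_mono)
      fix u :: "(nat \<times> 'b) + 'v"
      show "(\<Sum>i<k. wi i u) \<le> (k - 1) * 1 + wW u"
      proof (cases u)
        case (Inl jb)
        obtain j b where jb: "jb = (j, b)" by (cases jb)
        have "(\<Sum>i<k. wi i u) \<le> (\<Sum>i\<in>{..<k} - {j}. 1)" if "j < k"
          using that by (subst sum.remove[of _ j]) (auto simp: wi_def Inl jb intro!: sum_mono simp del: sum_constant)
        moreover have "(\<Sum>i<k. wi i u) = 0" if "\<not> j < k"
          using that by (simp add: wi_def Inl jb)
        ultimately show ?thesis by (cases "j < k") auto
      next
        case (Inr v)
        then show ?thesis using k by (simp add: wi_def wW_def)
      qed
    qed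
    also have "\<dots> = (k - 1) * deg m + wt wW m"
      by (simp only: wt_mult_weights wt_plus_weights[symmetric])
    finally show ?thesis using tot[OF m] by simp
  qed
  define ev where "ev = (\<lambda>u. case u of Inl (i, b) \<Rightarrow> [:a b i:] | Inr v \<Rightarrow> [:0, w v:])"
  interpret ev: comm_ring_hom "mpoly_subst (\<lambda>c. [:c:]) ev"
    by (rule mpoly_subst_hom[OF const_poly_hom])
  have X_dvd: "[:0, 1:] dvd [:0, t:]" for t :: 'a
    by (rule dvdI[of _ _ "[:t:]"]) simp
  have "mpoly_subst (\<lambda>c. [:c:]) ev P \<in> {p. [:0, 1:] ^ ?R dvd p}"
  proof (rule filtration_mpoly_subst[OF filtration_dvd, where \<omega> = wW])
    show "ev u \<in> {p. [:0, 1:] ^ wW u dvd p}" for u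
      by (cases u) (auto simp: ev_def wW_def X_dvd split: prod.splits)
    show "{p. [:0, 1:] ^ wt wW m dvd p} \<subseteq> {p :: 'a poly. [:0, 1:] ^ ?R dvd p}"
      if "m \<in> keys P" for m
      using far[OF that] by (auto intro: power_le_dvd)
  qed simp
  moreover have "mpoly_subst (\<lambda>c. [:c:]) ev P = mpoly_subst (\<lambda>c. [:c:]) (\<lambda>v. [:x v, w v:]) G"
  proof -
    have const_sum: "(\<Sum>i\<in>S. [:f i:]) = [:\<Sum>i\<in>S. f i:]" for S :: "nat set" and f :: "nat \<Rightarrow> 'a"
      by (induction S rule: infinite_finite_induct) auto
    have "mpoly_subst (\<lambda>c. [:c:]) ev P =
        mpoly_subst (\<lambda>c. [:c:]) (\<lambda>v. (\<Sum>i<k. [:a (blk v) i * z i v:]) + [:0, w v:]) G"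
      unfolding P_def mpoly_subst_subst[OF const_poly_hom]
      by (simp add: ev.hom_add ev.hom_sum ev.hom_mult) (simp add: ev_def mult.commute)
    also have "\<dots> = mpoly_subst (\<lambda>c. [:c:]) (\<lambda>v. [:x v, w v:]) G"
      by (rule mpoly_subst_mform_cong[OF G]) (simp add: const_sum x)
    finally show ?thesis .
  qed
  ultimately show "[:0, 1:] ^ ?R dvd mpoly_subst (\<lambda>c. [:c:]) (\<lambda>v. [:x v, w v:]) G"
    by simp
qed simp

section \<open>Points and their minors\<close>

lemma PP_iff:
  "x \<in> PP n \<longleftrightarrow> (\<forall>v. v \<notin> pvars n \<longrightarrow> x v = 0) \<and> (\<exists>j\<le>n. x (X j) \<noteq> 0) \<and> (\<exists>k\<le>n + 1. x (Y k) \<noteq> 0)"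
proof -
  have "factor_of ` pvars n = {First, Second}"
    by (auto simp: pvars_def image_Un image_image image_constant_conv)
  moreover have "(\<exists>v\<in>pvars n. factor_of v = First \<and> x v \<noteq> 0) \<longleftrightarrow> (\<exists>j\<le>n. x (X j) \<noteq> 0)"
    "(\<exists>v\<in>pvars n. factor_of v = Second \<and> x v \<noteq> 0) \<longleftrightarrow> (\<exists>k\<le>n + 1. x (Y k) \<noteq> 0)"
    by (simp_all add: pvars_def bex_Un) auto
  ultimately show ?thesis by (simp add: mproj_def)
qed

lemma pvars_simps [simp]: "X j \<in> pvars n \<longleftrightarrow> j \<le> n" "Y k \<in> pvars n \<longleftrightarrow> k \<le> n + 1"
  by (auto simp: pvars_def)

lemma bvars_simps [simp]: "Base v \<in> bvars n \<longleftrightarrow> v \<in> pvars n"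
  "Exc i j k l m \<in> bvars n \<longleftrightarrow> i < n + 3 \<and> j \<le> n \<and> k \<le> n + 1 \<and> l \<le> n \<and> m \<le> n + 1"
  by (auto simp: bvars_def)

lemma mpoly_eval_simps [simp]:
  "mpoly_eval x (P + Q) = mpoly_eval x P + mpoly_eval x Q"
  "mpoly_eval x (P - Q) = mpoly_eval x P - mpoly_eval x Q"
  "mpoly_eval x (P * Q) = mpoly_eval x P * mpoly_eval x Q"
  "mpoly_eval x (P ^ k) = mpoly_eval x P ^ k"
  "mpoly_eval x (\<Prod>i\<in>I. f i) = (\<Prod>i\<in>I. mpoly_eval x (f i))"
  "mpoly_eval x 0 = 0" "mpoly_eval x 1 = 1"
  "mpoly_eval x (Var v) = x v" "mpoly_eval x (Const c) = c"
proof -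
  interpret comm_ring_hom "mpoly_eval x" by (rule mpoly_eval_hom)
  show "mpoly_eval x (P + Q) = mpoly_eval x P + mpoly_eval x Q"
  "mpoly_eval x (P - Q) = mpoly_eval x P - mpoly_eval x Q"
  "mpoly_eval x (P * Q) = mpoly_eval x P * mpoly_eval x Q"
  "mpoly_eval x (P ^ k) = mpoly_eval x P ^ k"
  "mpoly_eval x (\<Prod>i\<in>I. f i) = (\<Prod>i\<in>I. mpoly_eval x (f i))"
  "mpoly_eval x 0 = 0" "mpoly_eval x 1 = 1"
    by (simp_all add: hom_distribs)
  show "mpoly_eval x (Var v) = x v" "mpoly_eval x (Const c) = c"
    unfolding mpoly_eval_def by (rule mpoly_subst_Var mpoly_subst_Const; simp)+
qed

lemma mpoly_nonzero_if_eval: "mpoly_eval x P \<noteq> 0 \<Longrightarrow> P \<noteq> 0"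
  by auto

lemma Var_nonzero: "Var v \<noteq> (0 :: ('v, 'a::field) mpoly)"
  by (rule mpoly_nonzero_if_eval[of "\<lambda>_. 1"]) simp

lemma graph_point_simps [simp]:
  "graph_point p x (Base v) = x v"
  "graph_point p x (Exc i j k l m) = pt p i (X l) * pt p i (Y m) * x (X j) * x (Y k)
     - pt p i (X j) * pt p i (Y k) * x (X l) * x (Y m)"
  by (simp_all add: graph_point_def)

lemma blow_down_graph_point [simp]: "blow_down (graph_point p x) = x"
  by (simp add: blow_down_def fun_eq_iff)

lemma same_point_if_minors_vanish:
  fixes x a :: "pvar \<Rightarrow> 'a::field"
  assumes x: "x \<in> PP n" and a: "a \<in> PP n"
    and minors: "\<And>j k l m. j \<le> n \<Longrightarrow> k \<le> n + 1 \<Longrightarrow> l \<le> n \<Longrightarrow> m \<le> n + 1 \<Longrightarrow>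
      a (X l) * a (Y m) * x (X j) * x (Y k) = a (X j) * a (Y k) * x (X l) * x (Y m)"
  shows "same_point factor_of x a"
proof -
  obtain l m where l: "l \<le> n" "a (X l) \<noteq> 0" and m: "m \<le> n + 1" "a (Y m) \<noteq> 0"
    using a by (auto simp: PP_iff)
  obtain j k where j: "j \<le> n" "x (X j) \<noteq> 0" and k: "k \<le> n + 1" "x (Y k) \<noteq> 0"
    using x by (auto simp: PP_iff)
  have "x (X l) * x (Y m) \<noteq> 0"
    using minors[OF j(1) k(1) l(1) m(1)] l m j k by auto
  then have nz: "x (X l) \<noteq> 0" "x (Y m) \<noteq> 0" by auto
  have X: "x (X j) = x (X l) / a (X l) * a (X j)" if "j \<le> n" for j
    using minors[OF that m(1) l(1) m(1)] nz l m by (simp add: field_simps)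
  have Y: "x (Y k) = x (Y m) / a (Y m) * a (Y k)" if "k \<le> n + 1" for k
    using minors[OF l(1) that l(1) m(1)] nz l m by (simp add: field_simps)
  define c where "c = (\<lambda>b. case b of First \<Rightarrow> x (X l) / a (X l) | Second \<Rightarrow> x (Y m) / a (Y m))"
  have "x v = c (factor_of v) * a v" for v
  proof (cases "v \<in> pvars n")
    case True
    then show ?thesis using X Y by (cases v) (auto simp: c_def)
  next
    case False
    then show ?thesis using x a by (simp add: PP_iff)
  qed
  moreover have "c b \<noteq> 0" for b
    using l m nz by (cases b) (auto simp: c_def)
  ultimately show ?thesis unfolding same_point_def by blast
qed

lemma minors_vanish_if_same_point:
  fixes x a :: "pvar \<Rightarrow> 'a::field"
  assumes "same_point factor_of x a"
  shows "a (X l) * a (Y m) * x (X j) * x (Y k) = a (X j) * a (Y k) * x (X l) * x (Y m)"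
proof -
  obtain c where c: "\<And>v. x v = c (factor_of v) * a v" using assms by (auto simp: same_point_def)
  show ?thesis unfolding c by (simp add: mult_ac)
qed

lemma same_point_sym: "same_point blk u w \<Longrightarrow> same_point blk w (u :: _ \<Rightarrow> 'a::field)"
proof -
  assume "same_point blk u w"
  then obtain c where c: "\<And>b. c b \<noteq> 0" "\<And>v. u v = c (blk v) * w v" by (auto simp: same_point_def)
  have "(\<forall>b. inverse (c b) \<noteq> 0) \<and> (\<forall>v. w v = inverse (c (blk v)) * u v)" using c(1) by (simp add: c(2))
  then show ?thesis unfolding same_point_def by (rule exI[of _ "\<lambda>b. inverse (c b)"])
qed

lemma same_point_trans:
  "same_point blk u w \<Longrightarrow> same_point blk w x \<Longrightarrow> same_point blk u (x :: _ \<Rightarrow> 'a::field)"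
proof -
  assume "same_point blk u w" "same_point blk w x"
  then obtain c d where c: "\<And>b. c b \<noteq> 0" "\<And>v. u v = c (blk v) * w v"
    "\<And>b. d b \<noteq> 0" "\<And>v. w v = d (blk v) * x v" unfolding same_point_def by metis
  have "(\<forall>b. c b * d b \<noteq> 0) \<and> (\<forall>v. u v = (c (blk v) * d (blk v)) * x v)" using c(1,3) by (simp add: c(2,4))
  then show ?thesis unfolding same_point_def by (rule exI[of _ "\<lambda>b. c b * d b"])
qed

section \<open>Local rings of the blow-up\<close>

lemma restrict_form_hom: "comm_ring_hom (restrict_form p)"
  unfolding restrict_form_def [abs_def] by (rule mpoly_subst_hom[OF Const_hom])

lemma restrict_form_simps [simp]:
  "restrict_form p (P + Q) = restrict_form p P + restrict_form p Q"
  "restrict_form p (P - Q) = restrict_form p P - restrict_form p Q"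
  "restrict_form p (P * Q) = restrict_form p P * restrict_form p Q"
  "restrict_form p (P ^ k) = restrict_form p P ^ k"
  "restrict_form p 0 = 0" "restrict_form p 1 = 1"
  "restrict_form p (Var u) = graph_coord p u" "restrict_form p (Const c) = Const c"
proof -
  interpret comm_ring_hom "restrict_form p" by (rule restrict_form_hom)
  show "restrict_form p (P + Q) = restrict_form p P + restrict_form p Q"
  "restrict_form p (P - Q) = restrict_form p P - restrict_form p Q"
  "restrict_form p (P * Q) = restrict_form p P * restrict_form p Q"
  "restrict_form p (P ^ k) = restrict_form p P ^ k"
  "restrict_form p 0 = 0" "restrict_form p 1 = 1"
    by (simp_all add: hom_distribs)
  interpret C: comm_ring_hom "Const :: 'a \<Rightarrow> (pvar, 'a) mpoly" by (rule Const_hom)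
  show "restrict_form p (Var u) = graph_coord p u" "restrict_form p (Const c) = Const c"
    by (simp_all add: restrict_form_def)
qed

lemma mpoly_subst_restrict_form:
  assumes "comm_ring_hom h"
  shows "mpoly_subst h f (restrict_form p A) = mpoly_subst h (\<lambda>u. mpoly_subst h f (graph_coord p u)) A"
proof -
  interpret comm_ring_hom h by fact
  show ?thesis by (simp add: restrict_form_def mpoly_subst_subst[OF assms])
qed

lemma eval_restrict_form: "mpoly_eval x (restrict_form p A) = mpoly_eval (graph_point p x) A"
  unfolding mpoly_eval_def mpoly_subst_restrict_form[OF id_hom]
  by (simp add: graph_point_def[abs_def] mpoly_eval_def)

definition pullback :: "(pvar, 'a::comm_ring_1) mpoly \<Rightarrow> (bvar, 'a) mpoly" where
  "pullback A = mpoly_subst Const (\<lambda>v. Var (Base v)) A"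

lemma restrict_pullback [simp]: "restrict_form p (pullback A) = A"
  unfolding pullback_def hom_mpoly_subst[OF restrict_form_hom]
  by (simp add: mpoly_subst_id)

lemma eval_pullback [simp]: "mpoly_eval q (pullback A) = mpoly_eval (blow_down q) A"
  unfolding pullback_def hom_mpoly_subst[OF mpoly_eval_hom]
  by (simp add: mpoly_eval_def blow_down_def[abs_def])

definition pullback_degree :: "(factor \<Rightarrow> nat) \<Rightarrow> block \<Rightarrow> nat" where
  "pullback_degree d b = (case b of Factor f \<Rightarrow> d f | Exceptional _ \<Rightarrow> 0)"

lemma mform_pullback:
  assumes "mform (pvars n) factor_of d A"
  shows "mform (bvars n) block_of (pullback_degree d) (pullback A)"
proof -
  have graded: "pullback A \<in> {Q. \<forall>m\<in>keys Q. wt \<omega> m = e}"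
    if \<omega>: "\<And>m. m \<in> keys A \<Longrightarrow> wt (\<lambda>v. \<omega> (Base v)) m = e" for \<omega> e
    unfolding pullback_def
    by (rule filtration_mpoly_subst[OF filtration_graded, where \<omega> = "\<lambda>v. \<omega> (Base v)"])
       (use \<omega> in \<open>auto simp: Const_def Var_def split: if_splits\<close>)
  show ?thesis
    unfolding mform_iff
  proof (intro ballI conjI allI)
    fix m assume m: "m \<in> keys (pullback A)"
    show "wt (\<lambda>v. of_bool (v \<notin> bvars n)) m = 0"
      using graded[of "\<lambda>v. of_bool (v \<notin> bvars n)" 0] m assms by (auto simp: mform_iff)
    fix b
    show "wt (block_wt block_of b) m = pullback_degree d b"
    proof (cases b)
      case (Factor f)
      have "(\<lambda>v. block_wt block_of b (Base v)) = block_wt factor_of f"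
        by (auto simp: block_wt_def Factor)
      then show ?thesis
        using graded[of "block_wt block_of b" "d f"] m assms
        by (auto simp: mform_iff Factor pullback_degree_def)
    next
      case (Exceptional i)
      have "(\<lambda>v. block_wt block_of b (Base v)) = (\<lambda>_. 0)"
        by (auto simp: block_wt_def Exceptional)
      then show ?thesis
        using graded[of "block_wt block_of b" 0] m
        by (auto simp: Exceptional pullback_degree_def wt_def)
    qed
  qed
qed

lemma ideal_prodI: "a \<in> I \<Longrightarrow> b \<in> J \<Longrightarrow> a * b \<in> ideal_prod I J"
  unfolding ideal_prod_def by (intro CollectI exI[of _ 1] exI[of _ "\<lambda>_. a"] exI[of _ "\<lambda>_. b"]) auto

lemma ideal_prod_0: "0 \<in> ideal_prod I J"
  unfolding ideal_prod_def by (intro CollectI exI[of _ 0]) auto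

lemma ideal_prod_add:
  assumes "a \<in> ideal_prod I J" "b \<in> ideal_prod I J"
  shows "a + b \<in> ideal_prod I J"
proof -
  from assms obtain N f g N' f' g' where *: "a = (\<Sum>t<(N::nat). f t * g t)" "\<forall>t<N. f t \<in> I \<and> g t \<in> J"
    "b = (\<Sum>t<(N'::nat). f' t * g' t)" "\<forall>t<N'. f' t \<in> I \<and> g' t \<in> J"
    unfolding ideal_prod_def by blast
  define F where "F t = (if t < N then f t else f' (t - N))" for t
  define G where "G t = (if t < N then g t else g' (t - N))" for t
  have "(\<Sum>t<N + N'. F t * G t) = (\<Sum>t<N. F t * G t) + (\<Sum>t<N'. F (N + t) * G (N + t))"
  proof -
    have "(\<Sum>t<N + N'. F t * G t) = (\<Sum>t\<in>{..<N} \<union> {N..<N + N'}. F t * G t)"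
      by (rule sum.cong) auto
    also have "\<dots> = (\<Sum>t<N. F t * G t) + (\<Sum>t\<in>{N..<N + N'}. F t * G t)"
      by (rule sum.union_disjoint) auto
    also have "(\<Sum>t\<in>{N..<N + N'}. F t * G t) = (\<Sum>t<N'. F (N + t) * G (N + t))"
      by (rule sum.reindex_bij_witness[of _ "\<lambda>t. N + t" "\<lambda>t. t - N"]) auto
    finally show ?thesis .
  qed
  also have "\<dots> = a + b" by (simp add: *(1,3) F_def G_def)
  finally have "a + b = (\<Sum>t<N + N'. F t * G t)" ..
  moreover have "\<forall>t<N + N'. F t \<in> I \<and> G t \<in> J"
    using *(2,4) by (auto simp: F_def G_def)
  ultimately show ?thesis unfolding ideal_prod_def by blast
qed

lemma ideal_prod_subset:
  assumes "0 \<in> K" "\<And>a b. a \<in> K \<Longrightarrow> b \<in> K \<Longrightarrow> a + b \<in> K"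
    and "\<And>a b. a \<in> I \<Longrightarrow> b \<in> J \<Longrightarrow> a * b \<in> K"
  shows "ideal_prod I J \<subseteq> K"
proof
  fix x assume "x \<in> ideal_prod I J"
  then obtain N f g where x: "x = (\<Sum>t<(N::nat). f t * g t)" "\<forall>t<N. f t \<in> I \<and> g t \<in> J"
    unfolding ideal_prod_def by blast
  have "(\<Sum>t\<in>S. f t * g t) \<in> K" if "S \<subseteq> {..<N}" for S
    using finite_subset[OF that finite_lessThan] that
    by (induction S rule: finite_induct) (use x(2) in \<open>auto intro!: assms\<close>)
  then show "x \<in> K" using x(1) by auto
qed

lemma to_fract_hom: "comm_ring_hom (to_fract :: 'a::idom \<Rightarrow> _)"
  by unfold_locales auto

lemma to_fract_power [simp]: "to_fract (x ^ k) = to_fract x ^ k"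
  by (induction k) simp_all

lemma zclosure_subset: "A \<subseteq> B \<Longrightarrow> zclosed Vs blk B \<Longrightarrow> zclosure Vs blk A \<subseteq> B"
  unfolding zclosure_def by (rule hull_minimal)

lemma zclosure_increasing: "A \<subseteq> zclosure Vs blk A"
  unfolding zclosure_def by (rule hull_subset)

lemma zclosure_mono: "A \<subseteq> B \<Longrightarrow> zclosure Vs blk A \<subseteq> zclosure Vs blk B"
  unfolding zclosure_def by (rule hull_mono)

lemma zclosedI:
  "(\<And>G. G \<in> S \<Longrightarrow> \<exists>d. mform Vs blk d G) \<Longrightarrow> zclosed Vs blk {q \<in> mproj Vs blk. \<forall>G\<in>S. mpoly_eval q G = 0}"
  unfolding zclosed_def by blast

lemma blow_up_subset_mproj: "blow_up n p \<subseteq> mproj (bvars n) block_of"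
proof -
  have "zclosed (bvars n) block_of (mproj (bvars n) block_of :: (bvar \<Rightarrow> 'a) set)"
    using zclosedI[of "{}" "bvars n" block_of] by simp
  then show ?thesis unfolding blow_up_def by (rule zclosure_subset[rotated]) auto
qed

text \<open>
  The blow-up is the closure of the part of the graph away from the points \<open>p\<^sub>i\<close>.
\<close>

lemma blow_up_form_vanishes:
  assumes q: "q \<in> blow_up n p" and B: "mform (bvars n) block_of d B"
    and "\<And>x. x \<in> PP n \<Longrightarrow> graph_point p x \<in> mproj (bvars n) block_of \<Longrightarrow> mpoly_eval (graph_point p x) B = 0"
  shows "mpoly_eval q B = 0"
proof -
  have "blow_up n p \<subseteq> {q \<in> mproj (bvars n) block_of. \<forall>G\<in>{B}. mpoly_eval q G = 0}"
    unfolding blow_up_def by (rule zclosure_subset[OF _ zclosedI]) (use assms in auto)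
  then show ?thesis using q by auto
qed

lemma blow_down_PP:
  assumes "q \<in> mproj (bvars n) block_of"
  shows "blow_down q \<in> PP n"
proof -
  have F: "\<exists>v\<in>bvars n. block_of v = Factor f \<and> q v \<noteq> 0" for f
  proof -
    have "Factor f \<in> block_of ` bvars n"
      by (cases f) (force intro: rev_image_eqI[of "Base (X 0)"] rev_image_eqI[of "Base (Y 0)"])+
    then show ?thesis using assms by (auto simp: mproj_def)
  qed
  obtain v where v: "v \<in> bvars n" "block_of v = Factor First" "q v \<noteq> 0" using F by blast
  then obtain j where j: "j \<le> n" "q (Base (X j)) \<noteq> 0"
    by (cases v rule: block_of.cases) (auto simp: pvars_def)
  obtain v where v: "v \<in> bvars n" "block_of v = Factor Second" "q v \<noteq> 0" using F by blast
  then obtain k where k: "k \<le> n + 1" "q (Base (Y k)) \<noteq> 0"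
    by (cases v rule: block_of.cases) (auto simp: pvars_def)
  have "q (Base v) = 0" if "v \<notin> pvars n" for v using assms that by (auto simp: mproj_def)
  then show ?thesis using j k by (auto simp: PP_iff blow_down_def)
qed

locale blow_up_point =
  fixes n :: nat and p :: "nat \<times> pvar \<Rightarrow> 'a::field_char_0" and q :: "bvar \<Rightarrow> 'a"
  assumes q: "q \<in> blow_up n p"
begin

abbreviation "LR \<equiv> local_ring n p q"
abbreviation "MM \<equiv> max_ideal n p q"
abbreviation "cf \<equiv> \<lambda>c. to_fract (Const c) :: (pvar, 'a) mpoly fract"
abbreviation "res \<equiv> \<lambda>A. to_fract (restrict_form p A) :: (pvar, 'a) mpoly fract"

lemma q_mproj: "q \<in> mproj (bvars n) block_of"
  using q blow_up_subset_mproj by blast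

lemma blow_down_q: "blow_down q \<in> PP n"
  by (rule blow_down_PP[OF q_mproj])

text \<open>
  Fractions in the local ring have nonzero denominators: a form that restricts to 0 on the graph vanishes on
  all of its closure.
\<close>

lemma restrict_nonzero:
  assumes "mform (bvars n) block_of d B" "mpoly_eval q B \<noteq> 0"
  shows "restrict_form p B \<noteq> 0"
proof
  assume "restrict_form p B = 0"
  then have "mpoly_eval (graph_point p x) B = 0" for x
    using eval_restrict_form[of x p B] by simp
  then show False using blow_up_form_vanishes[OF q assms(1)] assms(2) by blast
qed

lemma local_ringI:
  "mform (bvars n) block_of d A \<Longrightarrow> mform (bvars n) block_of d B \<Longrightarrow> mpoly_eval q B \<noteq> 0 \<Longrightarrow> res A / res B \<in> LR"
  unfolding local_ring_def Fract_conv_to_fract by blast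

lemma max_idealI:
  "mform (bvars n) block_of d A \<Longrightarrow> mform (bvars n) block_of d B \<Longrightarrow> mpoly_eval q B \<noteq> 0 \<Longrightarrow>
    mpoly_eval q A = 0 \<Longrightarrow> res A / res B \<in> MM"
  unfolding max_ideal_def Fract_conv_to_fract by blast

lemma local_ringE:
  assumes "a \<in> LR"
  obtains A B d where "a = res A / res B" "mform (bvars n) block_of d A" "mform (bvars n) block_of d B"
    "mpoly_eval q B \<noteq> 0" "res B \<noteq> 0"
  using assms restrict_nonzero unfolding local_ring_def Fract_conv_to_fract by fastforce

lemma local_ring_const: "cf c \<in> LR"
  using local_ringI[OF mform_Const mform_1, of c] by simp

lemma local_ring_01: "0 \<in> LR" "1 \<in> LR"
proof -
  have "Const 0 = (0 :: (pvar, 'a) mpoly)" "Const 1 = (1 :: (pvar, 'a) mpoly)"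
    by (simp_all add: Const_def)
  then show "0 \<in> LR" "1 \<in> LR" using local_ring_const[of 0] local_ring_const[of 1] by simp_all
qed

lemma frac_add_forms:
  assumes "mform (bvars n) block_of d A" "mform (bvars n) block_of d B" "res B \<noteq> 0"
    "mform (bvars n) block_of e A'" "mform (bvars n) block_of e B'" "res B' \<noteq> 0"
  shows "res A / res B + res A' / res B' = res (A * B' + A' * B) / res (B * B')"
    "mform (bvars n) block_of (\<lambda>b. d b + e b) (A * B' + A' * B)"
    "mform (bvars n) block_of (\<lambda>b. d b + e b) (B * B')"
proof -
  show "res A / res B + res A' / res B' = res (A * B' + A' * B) / res (B * B')"
    using assms by (simp add: field_simps)
  have "mform (bvars n) block_of (\<lambda>b. d b + e b) (A' * B)"
    by (rule mform_cong[OF mform_mult[OF assms(4,2)]]) simp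
  then show "mform (bvars n) block_of (\<lambda>b. d b + e b) (A * B' + A' * B)"
    by (rule mform_add[OF mform_mult[OF assms(1,5)]])
  show "mform (bvars n) block_of (\<lambda>b. d b + e b) (B * B')"
    by (intro mform_mult assms)
qed

lemma local_ring_add: "a \<in> LR \<Longrightarrow> b \<in> LR \<Longrightarrow> a + b \<in> LR"
  by (elim local_ringE) (auto simp del: restrict_form_simps simp: frac_add_forms(1) intro!: local_ringI frac_add_forms(2,3))

lemma local_ring_mult:
  assumes "a \<in> LR" "b \<in> LR" shows "a * b \<in> LR"
proof -
  obtain A B d where a: "a = res A / res B" "mform (bvars n) block_of d A" "mform (bvars n) block_of d B"
    "mpoly_eval q B \<noteq> 0" by (rule local_ringE[OF assms(1)])
  obtain A' B' e where b: "b = res A' / res B'" "mform (bvars n) block_of e A'" "mform (bvars n) block_of e B'"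
    "mpoly_eval q B' \<noteq> 0" by (rule local_ringE[OF assms(2)])
  have "res (A * A') / res (B * B') \<in> LR"
    by (rule local_ringI[OF mform_mult[OF a(2) b(2)] mform_mult[OF a(3) b(3)]]) (use a b in simp)
  then show ?thesis by (simp add: a(1) b(1))
qed

lemma max_ideal_subset: "MM \<subseteq> LR"
  unfolding max_ideal_def local_ring_def by blast

lemma filtration_max_ideal_power: "filtration (max_ideal_power n p q)"
proof (rule filtrationI)
  let ?F = "max_ideal_power n p q"
  show zero: "0 \<in> ?F j" for j
    by (cases j) (auto simp: local_ring_01 ideal_prod_0)
  show add: "a + b \<in> ?F j" if "a \<in> ?F j" "b \<in> ?F j" for j a b
    using that by (cases j) (auto simp: local_ring_add ideal_prod_add)
  show "1 \<in> ?F 0" by (simp add: local_ring_01)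
  have zero_mult: "a * b \<in> ?F j" if "a \<in> LR" "b \<in> ?F j" for a b j
    using that
  proof (induction j arbitrary: b)
    case (Suc j)
    have "ideal_prod MM (?F j) \<subseteq> {b. a * b \<in> ?F (Suc j)}"
    proof (rule ideal_prod_subset)
      fix u v assume "u \<in> MM" "v \<in> ?F j"
      then have "u * (a * v) \<in> ?F (Suc j)" using Suc by (auto intro: ideal_prodI)
      then show "u * v \<in> {b. a * b \<in> ?F (Suc j)}" by (simp add: mult_ac)
    next
      fix u v assume "u \<in> {b. a * b \<in> ?F (Suc j)}" "v \<in> {b. a * b \<in> ?F (Suc j)}"
      then show "u + v \<in> {b. a * b \<in> ?F (Suc j)}" using add[of "a * u" "Suc j" "a * v"]
        by (simp add: algebra_simps)
    qed (use zero[of "Suc j"] in simp)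
    then show ?case using Suc.prems by auto
  qed (simp add: local_ring_mult)
  show "a * b \<in> ?F (i + j)" if "a \<in> ?F i" "b \<in> ?F j" for i j a b
    using that
  proof (induction i arbitrary: a)
    case (Suc i)
    have "ideal_prod MM (?F i) \<subseteq> {a. a * b \<in> ?F (Suc i + j)}"
    proof (rule ideal_prod_subset)
      fix u v assume "u \<in> MM" "v \<in> ?F i"
      then have "u * (v * b) \<in> ?F (Suc (i + j))" using Suc by (auto intro: ideal_prodI)
      then show "u * v \<in> {a. a * b \<in> ?F (Suc i + j)}" by (simp add: mult_ac)
    next
      fix u v assume "u \<in> {a. a * b \<in> ?F (Suc i + j)}" "v \<in> {a. a * b \<in> ?F (Suc i + j)}"
      then show "u + v \<in> {a. a * b \<in> ?F (Suc i + j)}" using add[of "u * b" "Suc i + j" "v * b"]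
        by (simp add: algebra_simps)
    qed (use zero[of "Suc i + j"] in simp)
    then show ?case using Suc.prems by auto
  qed (simp add: zero_mult)
qed

lemma max_ideal_power_Suc_subset: "max_ideal_power n p q (Suc j) \<subseteq> max_ideal_power n p q j"
  unfolding max_ideal_power.simps(2)
proof (rule ideal_prod_subset)
  fix a b assume "a \<in> MM" "b \<in> max_ideal_power n p q j"
  then show "a * b \<in> max_ideal_power n p q j"
    using filtrationD(4)[OF filtration_max_ideal_power, of a 0 b j] max_ideal_subset by auto
qed (use filtrationD[OF filtration_max_ideal_power] in auto)

lemma max_ideal_power_decreasing: "i \<ge> j \<Longrightarrow> max_ideal_power n p q i \<subseteq> max_ideal_power n p q j"
  by (induction i rule: dec_induct) (use max_ideal_power_Suc_subset in auto)

end

text \<open>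
  The quotient is \<open>G\<close> evaluated at the affine coordinates \<open>X\<^sub>v / X\<^sub>\<rho>\<close>, and these differ from the coordinates
  of \<open>x\<close> by elements of \<open>F 1\<close>.  With the powers of the maximal ideal this bounds the multiplicity of a divisor;
  with the multiples of a local equation it shows that the exceptional ideal is principal.
\<close>

lemma dehomogenize_in_filtration:
  fixes G :: "(pvar, 'a::field) mpoly"
  assumes G: "mform (pvars n) factor_of d G" and van: "vanishes G x r"
    and F: "filtration F" and dec: "\<And>i. i \<ge> r \<Longrightarrow> F i \<subseteq> F r"
    and const: "\<And>c. to_fract (Const c) \<in> F 0"
    and nz: "\<And>b. x (\<rho> b) \<noteq> 0" and \<rho>: "\<And>b. factor_of (\<rho> b) = b"
    and \<delta>: "\<And>v. v \<in> pvars n \<Longrightarrow> to_fract (Var v) / to_fract (Var (\<rho> (factor_of v))) -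
         to_fract (Const (x v / x (\<rho> (factor_of v)))) \<in> F 1"
  shows "to_fract G / (to_fract (Var (\<rho> First)) ^ d First * to_fract (Var (\<rho> Second)) ^ d Second) \<in> F r"
proof -
  let ?h = "\<lambda>c. to_fract (Const c) :: (pvar, 'a) mpoly fract"
  have h: "comm_ring_hom ?h" by (rule hom_comp[OF to_fract_hom Const_hom])
  interpret h: comm_ring_hom ?h by (rule h)
  let ?s = "\<lambda>b. to_fract (Var (\<rho> b)) :: (pvar, 'a) mpoly fract"
  let ?\<xi> = "\<lambda>v. to_fract (Var v) / ?s (factor_of v)"
  have Var_nz: "Var v \<noteq> (0 :: (pvar, 'a) mpoly)" for v
    using mpoly_eval_simps(8)[of "\<lambda>_. 1 :: 'a" v] by fastforce
  then have s: "?s b \<noteq> 0" for b by simp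
  have UNIV_factor: "factor_of ` pvars n \<subseteq> {First, Second}" using factor.exhaust by blast
  have "to_fract G = mpoly_subst ?h (\<lambda>v. to_fract (Var v)) G"
    using hom_mpoly_subst[OF to_fract_hom, of Const Var G] by (simp add: mpoly_subst_id)
  also have "\<dots> = mpoly_subst ?h (\<lambda>v. ?s (factor_of v) * ?\<xi> v) G"
    by (simp add: Var_nz)
  also have "\<dots> = (\<Prod>b\<in>{First, Second}. ?s b ^ d b) * mpoly_subst ?h ?\<xi> G"
    by (rule mpoly_subst_scale[OF G _ UNIV_factor]) simp
  finally have eq: "to_fract G / (?s First ^ d First * ?s Second ^ d Second) = mpoly_subst ?h ?\<xi> G"
    using s by simp
  have "mpoly_subst ?h ?\<xi> G =
     mpoly_subst ?h (\<lambda>v. (\<lambda>b. ?h (1 / x (\<rho> b))) (factor_of v) * ?h (x v) +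
       (?\<xi> v - ?h (x v / x (\<rho> (factor_of v))))) G"
    by (simp add: h.hom_mult[symmetric])
  also have "\<dots> \<in> F r"
    by (rule vanishes_filtration[OF G finite_pvars van h F dec]) (use const \<delta> in auto)
  finally show ?thesis using eq by simp
qed

section \<open>Locally regular quotients of forms\<close>

text \<open>
  Each root of \<open>\<beta>\<close> is a root of \<open>\<alpha>\<close>, as \<open>\<gamma>\<close> does not vanish there; cancel the common factor.  This is where
  algebraic closedness enters.
\<close>

lemma poly_dvd_if_locally:
  fixes \<alpha> \<beta> :: "'a::alg_closed_field poly"
  assumes "\<beta> \<noteq> 0" "\<And>t. \<exists>\<gamma> \<eta>. \<alpha> * \<gamma> = \<beta> * \<eta> \<and> poly \<gamma> t \<noteq> 0"
  shows "\<beta> dvd \<alpha>"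
  using assms
proof (induction "degree \<beta>" arbitrary: \<alpha> \<beta>)
  case 0
  then have "is_unit \<beta>" by (simp add: is_unit_iff_degree)
  then show ?case by (rule unit_imp_dvd)
next
  case (Suc d)
  then obtain t where t: "poly \<beta> t = 0" using alg_closed_imp_poly_has_root[of \<beta>] by auto
  obtain \<gamma> \<eta> where g: "\<alpha> * \<gamma> = \<beta> * \<eta>" "poly \<gamma> t \<noteq> 0" using Suc.prems by blast
  have "poly \<alpha> t * poly \<gamma> t = 0" using arg_cong[OF g(1), of "\<lambda>p. poly p t"] t by simp
  then have "poly \<alpha> t = 0" using g by simp
  then obtain \<alpha>' \<beta>' where \<alpha>': "\<alpha> = [:-t, 1:] * \<alpha>'" and \<beta>': "\<beta> = [:-t, 1:] * \<beta>'"
    using t by (metis dvdE poly_eq_0_iff_dvd)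
  have nz: "\<beta>' \<noteq> 0" using \<beta>' Suc.prems by auto
  have "degree \<beta> = Suc (degree \<beta>')" unfolding \<beta>' using nz by (subst degree_mult_eq) auto
  then have "d = degree \<beta>'" using Suc.hyps(2) by simp
  then have "\<beta>' dvd \<alpha>'"
  proof (rule Suc.hyps(1)[OF _ nz])
    fix s
    obtain \<gamma> \<eta> where g: "\<alpha> * \<gamma> = \<beta> * \<eta>" "poly \<gamma> s \<noteq> 0" using Suc.prems by blast
    have "[:-t, 1:] * (\<alpha>' * \<gamma>) = [:-t, 1:] * (\<beta>' * \<eta>)"
      using g(1) unfolding \<alpha>' \<beta>' by (simp only: mult.assoc)
    then have "\<alpha>' * \<gamma> = \<beta>' * \<eta>" by (subst (asm) mult_cancel_left) auto
    then show "\<exists>\<gamma> \<eta>. \<alpha>' * \<gamma> = \<beta>' * \<eta> \<and> poly \<gamma> s \<noteq> 0" using g(2) by blast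
  qed
  then show ?case unfolding \<alpha>' \<beta>' by (intro mult_dvd_mono) auto
qed

lemma coeff_mult_top:
  fixes p q :: "'a::comm_ring_1 poly"
  assumes "degree p \<le> i" "degree q \<le> j"
  shows "coeff (p * q) (i + j) = coeff p i * coeff q j"
proof -
  have "coeff (p * q) (i + j) = (\<Sum>k\<le>i + j. if k = i then coeff p i * coeff q j else 0)"
    unfolding coeff_mult
  proof (rule sum.cong)
    fix k assume "k \<in> {..i + j}"
    show "coeff p k * coeff q (i + j - k) =
        (if k = i then coeff p i * coeff q j else 0)"
    proof (cases "k < i")
      case True
      then have "coeff q (i + j - k) = 0" using assms by (intro coeff_eq_0) auto
      then show ?thesis using True by simp
    next
      case False
      then show ?thesis using assms by (cases "k = i") (auto simp: coeff_eq_0)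
    qed
  qed simp
  then show ?thesis by simp
qed

lemma mono_val_line_top:
  fixes a b :: "'v \<Rightarrow> 'r::comm_ring_1"
  shows "degree (mono_val (\<lambda>v. [:a v, b v:]) m) \<le> deg m"
    "coeff (mono_val (\<lambda>v. [:a v, b v:]) m) (deg m) = mono_val b m"
proof -
  have pow: "degree ([:a v, b v:] ^ k) \<le> k \<and> coeff ([:a v, b v:] ^ k) k = b v ^ k" for v k
  proof (induction k)
    case (Suc k)
    have 1: "degree [:a v, b v:] \<le> 1" by simp
    have "degree ([:a v, b v:] * [:a v, b v:] ^ k) \<le> degree [:a v, b v:] + degree ([:a v, b v:] ^ k)"
      by (rule degree_mult_le)
    also have "\<dots> \<le> 1 + k" using Suc 1 by (intro add_mono) auto
    finally have "degree ([:a v, b v:] ^ Suc k) \<le> Suc k" by simp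
    moreover have "coeff ([:a v, b v:] ^ Suc k) (Suc k) = b v ^ Suc k"
      using coeff_mult_top[OF 1, of "[:a v, b v:] ^ k" k] Suc by (simp del: mult_pCons_left)
    ultimately show ?case ..
  qed simp
  have "degree (\<Prod>v\<in>S. [:a v, b v:] ^ lookup m v) \<le> (\<Sum>v\<in>S. 1 * lookup m v) \<and>
     coeff (\<Prod>v\<in>S. [:a v, b v:] ^ lookup m v) (\<Sum>v\<in>S. 1 * lookup m v) =
     (\<Prod>v\<in>S. b v ^ lookup m v)" for S
  proof (induction S rule: infinite_finite_induct)
    case (insert v S)
    then show ?case
      using coeff_mult_top[of "[:a v, b v:] ^ lookup m v" "lookup m v"
          "\<Prod>v\<in>S. [:a v, b v:] ^ lookup m v" "\<Sum>v\<in>S. 1 * lookup m v"]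
        pow[of v "lookup m v"]
      by (auto intro!: order.trans[OF degree_mult_le] add_mono)
  qed auto
  then show "degree (mono_val (\<lambda>v. [:a v, b v:]) m) \<le> deg m"
    "coeff (mono_val (\<lambda>v. [:a v, b v:]) m) (deg m) = mono_val b m"
    by (simp_all add: mono_val_def wt_def)
qed

lemma line_top:
  fixes h :: "'a::comm_ring_1 \<Rightarrow> 'r::comm_ring_1" and P :: "('v, 'a) mpoly"
  assumes "\<And>m. m \<in> keys P \<Longrightarrow> deg m = D"
  shows "degree (mpoly_subst (\<lambda>c. [:h c:]) (\<lambda>v. [:a v, b v:]) P) \<le> D"
    "coeff (mpoly_subst (\<lambda>c. [:h c:]) (\<lambda>v. [:a v, b v:]) P) D = mpoly_subst h b P"
proof -
  show "degree (mpoly_subst (\<lambda>c. [:h c:]) (\<lambda>v. [:a v, b v:]) P) \<le> D"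
    unfolding mpoly_subst_alt
    by (intro degree_sum_le) (use mono_val_line_top(1)[of a b] assms in
        \<open>auto intro: order.trans[OF degree_mult_le] order.trans[OF degree_smult_le]\<close>)
  show "coeff (mpoly_subst (\<lambda>c. [:h c:]) (\<lambda>v. [:a v, b v:]) P) D = mpoly_subst h b P"
    unfolding mpoly_subst_alt coeff_sum
  proof (rule sum.cong)
    fix m assume m: "m \<in> keys P"
    show "coeff ([:h (lookup P m):] * mono_val (\<lambda>v. [:a v, b v:]) m) D =
        h (lookup P m) * mono_val b m"
      using mono_val_line_top(2)[of a b m, unfolded assms[OF m]] by simp
  qed simp
qed

lemma mform_deg:
  assumes "mform (pvars n) factor_of d G" "m \<in> keys G"
  shows "deg m = d First + d Second"
proof -
  have "deg m = wt (\<lambda>v. block_wt factor_of First v + block_wt factor_of Second v) m"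
  proof (rule wt_cong)
    fix v show "1 = block_wt factor_of First v + block_wt factor_of Second v"
      by (cases "factor_of v") (auto simp: block_wt_def)
  qed
  then show ?thesis using assms by (simp add: mform_iff flip: wt_plus_weights)
qed

text \<open>
  The cross product of \<open>w\<close> and \<open>b\<close> works unless its last entry is 0; then \<open>(w1, -w0, 0)\<close> does.
\<close>

lemma linear_form_through:
  fixes w0 w1 w2 b0 b1 b2 :: "'a::field"
  assumes "w0 \<noteq> 0"
  shows "\<exists>l0 l1 l2. (l0 \<noteq> 0 \<or> l1 \<noteq> 0 \<or> l2 \<noteq> 0) \<and> l0 * w0 + l1 * w1 + l2 * w2 = 0 \<and>
     l0 * b0 + l1 * b1 + l2 * b2 = 0"
proof (cases "w0 * b1 - w1 * b0 = 0")
  case True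
  then show ?thesis using assms
    by (intro exI[of _ w1] exI[of _ "- w0"] exI[of _ 0]) (auto simp: algebra_simps)
next
  case False
  then show ?thesis
    by (intro exI[of _ "w1 * b2 - w2 * b1"] exI[of _ "w2 * b0 - w0 * b2"] exI[of _ "w0 * b1 - w1 * b0"])
       (auto simp: algebra_simps)
qed

text \<open>
  Choose a direction \<open>w\<close> with \<open>B(w) \<noteq> 0\<close>.  As a polynomial in \<open>t\<close>, \<open>B(X + t w)\<close> has the nonzero constant \<open>B(w)\<close>
  as its leading coefficient, so \<open>A(X + t w)\<close> can be divided by it with remainder over the ring of polynomials
  in \<open>X\<close>.  For general \<open>x\<close> the line \<open>x + t w\<close> misses the points \<open>P i\<close> and the loci where one block of
  coordinates vanishes; on it \<open>A / B\<close> is regular, thus a polynomial, and the remainder is 0.  Put \<open>t = 0\<close>.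
\<close>

theorem form_quotient_polynomial:
  fixes A B :: "(pvar, 'a::{alg_closed_field, field_char_0}) mpoly" and P :: "nat \<Rightarrow> pvar \<Rightarrow> 'a"
  assumes n: "n \<ge> 1"
    and A: "mform (pvars n) factor_of dA A" and B: "mform (pvars n) factor_of dB B" "B \<noteq> 0"
    and loc: "\<And>x. x \<in> PP n \<Longrightarrow> (\<And>i. i < N \<Longrightarrow> \<not> same_point factor_of x (P i)) \<Longrightarrow>
        \<exists>C E. A * C = B * E \<and> mpoly_eval x C \<noteq> 0"
  shows "\<exists>G. A = G * B"
proof -
  have "B * Var (X 0) * Var (Y 0) \<noteq> 0" by (simp add: B Var_nonzero)
  then obtain w' where w': "mpoly_eval w' (B * Var (X 0) * Var (Y 0)) \<noteq> 0"
    using mpoly_eq_0_if_eval_0 by blast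
  define w where "w v = (if v \<in> pvars n then w' v else 0)" for v
  have "mpoly_eval w B = mpoly_eval w' B"
    unfolding mpoly_eval_def by (rule mpoly_subst_mform_cong[OF B(1)]) (simp add: w_def)
  then have wB: "mpoly_eval w B \<noteq> 0" and w0: "w (X 0) \<noteq> 0" "w (Y 0) \<noteq> 0"
    using w' by (auto simp: w_def)
  define D where "D = dB First + dB Second"
  define L :: "(pvar, 'a) mpoly \<Rightarrow> (pvar, 'a) mpoly poly" where
    "L = mpoly_subst (\<lambda>c. [:Const c:]) (\<lambda>v. [:Var v, Const (w v):])"
  define l :: "(pvar \<Rightarrow> 'a) \<Rightarrow> (pvar, 'a) mpoly \<Rightarrow> 'a poly" where
    "l x = mpoly_subst (\<lambda>c. [:c:]) (\<lambda>v. [:x v, w v:])" for x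
  have degLB: "degree (L B) \<le> D" and coeffLB: "coeff (L B) D = Const (mpoly_eval w B)"
  proof -
    show "degree (L B) \<le> D"
      unfolding L_def D_def by (rule line_top(1)) (rule mform_deg[OF B(1)])
    have "coeff (L B) D = mpoly_subst Const (\<lambda>v. Const (w v)) B"
      unfolding L_def D_def by (rule line_top(2)) (rule mform_deg[OF B(1)])
    also have "\<dots> = Const (mpoly_eval w B)"
      by (rule mpoly_subst_const_point[OF Const_hom])
    finally show "coeff (L B) D = Const (mpoly_eval w B)" .
  qed
  have Const_nz: "Const c \<noteq> (0 :: (pvar, 'a) mpoly)" if "c \<noteq> 0" for c
    by (rule mpoly_nonzero_if_eval[of "\<lambda>_. 0"]) (use that in simp)
  have LB0: "L B \<noteq> 0" using coeffLB Const_nz[OF wB] by auto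
  have degLB': "degree (L B) = D"
    using degLB coeffLB Const_nz[OF wB] by (metis le_antisym le_degree)
  obtain Q R where QR: "pseudo_divmod (L A) (L B) = (Q, R)" by fastforce
  define k where "k = Suc (degree (L A)) - degree (L B)"
  have div: "Polynomial.smult (Const (mpoly_eval w B) ^ k) (L A) = L B * Q + R"
    using pseudo_divmod(1)[OF LB0 QR] by (simp add: k_def degLB' coeffLB)
  have degR: "R = 0 \<or> degree R < D"
    using pseudo_divmod(2)[OF LB0 QR] by (simp add: degLB')
  have "\<exists>l0 l1 l2. (l0 \<noteq> 0 \<or> l1 \<noteq> 0 \<or> l2 \<noteq> 0) \<and> l0 * w (Y 0) + l1 * w (Y 1) + l2 * w (Y 2) = 0 \<and>
     l0 * P i (Y 0) + l1 * P i (Y 1) + l2 * P i (Y 2) = 0" for i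
    by (rule linear_form_through[OF w0(2)])
  then obtain l0 l1 l2 where lam: "\<And>i. l0 i \<noteq> 0 \<or> l1 i \<noteq> 0 \<or> l2 i \<noteq> 0"
    "\<And>i. l0 i * w (Y 0) + l1 i * w (Y 1) + l2 i * w (Y 2) = 0"
    "\<And>i. l0 i * P i (Y 0) + l1 i * P i (Y 1) + l2 i * P i (Y 2) = 0" by metis
  define lX :: "(pvar, 'a) mpoly" where "lX = Const (w (X 0)) * Var (X 1) - Const (w (X 1)) * Var (X 0)"
  define lY :: "nat \<Rightarrow> (pvar, 'a) mpoly" where
    "lY i = Const (l0 i) * Var (Y 0) + Const (l1 i) * Var (Y 1) + Const (l2 i) * Var (Y 2)" for i
  \<comment> \<open>The first two factors keep both blocks of coordinates nonzero on the line,
    the others keep the line off the points.\<close>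
  define K where "K = lX * lY N * (\<Prod>i<N. lY i)"
  have "lX \<noteq> 0"
    by (rule mpoly_nonzero_if_eval[of "\<lambda>v. if v = X 1 then 1 else 0"]) (simp add: lX_def w0)
  moreover have "lY i \<noteq> 0" for i
  proof -
    consider "l0 i \<noteq> 0" | "l1 i \<noteq> 0" | "l2 i \<noteq> 0" using lam(1) by blast
    then show ?thesis
    proof cases
      case 1 then show ?thesis
        by (intro mpoly_nonzero_if_eval[of "\<lambda>v. if v = Y 0 then 1 else 0"]) (simp add: lY_def)
    next
      case 2 then show ?thesis
        by (intro mpoly_nonzero_if_eval[of "\<lambda>v. if v = Y 1 then 1 else 0"]) (simp add: lY_def)
    next
      case 3 then show ?thesis
        by (intro mpoly_nonzero_if_eval[of "\<lambda>v. if v = Y 2 then 1 else 0"]) (simp add: lY_def)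
    qed
  qed
  ultimately have K: "K \<noteq> 0" by (simp add: K_def)
  have dvd: "l x B dvd l x A \<and> l x B \<noteq> 0 \<and> degree (l x B) = D" if x: "mpoly_eval x K \<noteq> 0" for x
  proof -
    define xr where "xr v = (if v \<in> pvars n then x v else 0)" for v
    have restr: "l xr F = l x F" if "mform (pvars n) factor_of dF F" for F dF
      unfolding l_def by (rule mpoly_subst_mform_cong[OF that]) (simp add: xr_def)
    have degB: "degree (l x B) \<le> D" "coeff (l x B) D = mpoly_eval w B"
      unfolding l_def D_def mpoly_eval_def
      by (rule line_top, rule mform_deg[OF B(1)], assumption)+
    then have "l x B \<noteq> 0" using wB by auto
    moreover have "degree (l x B) = D" using degB wB by (metis le_antisym le_degree)
    moreover have "l xr B dvd l xr A"
    proof (rule poly_dvd_if_locally)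
      show "l xr B \<noteq> 0" using \<open>l x B \<noteq> 0\<close> restr[OF B(1)] by simp
      fix t
      define y where "y v = xr v + t * w v" for v
      have lX: "w (X 0) * y (X 1) - w (X 1) * y (X 0) \<noteq> 0"
        using x n by (auto simp: K_def lX_def y_def xr_def algebra_simps)
      have lY: "l0 i * y (Y 0) + l1 i * y (Y 1) + l2 i * y (Y 2) \<noteq> 0" if "i \<le> N" for i
      proof -
        have "l0 i * y (Y 0) + l1 i * y (Y 1) + l2 i * y (Y 2) =
          (l0 i * x (Y 0) + l1 i * x (Y 1) + l2 i * x (Y 2)) + t * (l0 i * w (Y 0) + l1 i * w (Y 1) + l2 i * w (Y 2))"
          using n by (simp add: y_def xr_def algebra_simps)
        also have "\<dots> = mpoly_eval x (lY i)" using lam(2)[of i] by (simp add: lY_def)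
        also have "\<dots> \<noteq> 0" using x that by (cases "i = N") (auto simp: K_def)
        finally show ?thesis .
      qed
      have "\<exists>j\<le>n. y (X j) \<noteq> 0"
        using lX n by (metis diff_self le0 mult_zero_right)
      moreover have "\<exists>k\<le>n + 1. y (Y k) \<noteq> 0"
      proof (rule ccontr)
        assume "\<not> ?thesis"
        then have "y (Y 0) = 0" "y (Y 1) = 0" "y (Y 2) = 0" using n by auto
        then show False using lY[of N] by simp
      qed
      ultimately have "y \<in> PP n" by (auto simp: PP_iff y_def xr_def w_def)
      moreover have "\<not> same_point factor_of y (P i)" if i: "i < N" for i
      proof
        assume "same_point factor_of y (P i)"
        then obtain c where c: "\<And>v. y v = c (factor_of v) * P i v" by (auto simp: same_point_def)
        have "l0 i * y (Y 0) + l1 i * y (Y 1) + l2 i * y (Y 2) =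
          c Second * (l0 i * P i (Y 0) + l1 i * P i (Y 1) + l2 i * P i (Y 2))"
          unfolding c by (simp add: algebra_simps)
        then show False using lY[of i] i lam(3)[of i] by simp
      qed
      ultimately obtain C E where CE: "A * C = B * E" "mpoly_eval y C \<noteq> 0" using loc by blast
      interpret lh: comm_ring_hom "l xr" unfolding l_def by (rule mpoly_subst_hom[OF const_poly_hom])
      have "l xr A * l xr C = l xr B * l xr E"
        using arg_cong[OF CE(1), of "l xr"] by (simp add: lh.hom_mult)
      moreover have "poly (l xr C) t = mpoly_eval y C"
      proof -
        have "comm_ring_hom (\<lambda>p :: 'a poly. poly p t)" by unfold_locales auto
        from hom_mpoly_subst[OF this, of "\<lambda>c. [:c:]" "\<lambda>v. [:xr v, w v:]" C]
        show ?thesis by (simp add: l_def mpoly_eval_def y_def[abs_def])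
      qed
      ultimately show "\<exists>\<gamma> \<eta>. l xr A * \<gamma> = l xr B * \<eta> \<and> poly \<gamma> t \<noteq> 0" using CE(2) by metis
    qed
    ultimately show ?thesis using restr[OF A] restr[OF B(1)] by simp
  qed
  have "R = 0"
  proof (rule poly_eqI, simp)
    fix j
    show "coeff R j = 0"
    proof (rule mpoly_eq_0_if_generic_eval_0[OF K])
      fix x assume x: "mpoly_eval x K \<noteq> 0"
      interpret ev: comm_ring_hom "mpoly_eval x :: (pvar, 'a) mpoly \<Rightarrow> 'a" by (rule mpoly_eval_hom)
      interpret evp: map_poly_comm_ring_hom "mpoly_eval x :: (pvar, 'a) mpoly \<Rightarrow> 'a" ..
      have evL: "map_poly (mpoly_eval x) (L F) = l x F" for F
      proof -
        have "map_poly (mpoly_eval x) [:Const c:] = [:c:]" "map_poly (mpoly_eval x) [:Var v, Const c:] = [:x v, c:]" for c v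
          by (auto intro!: poly_eqI simp: coeff_map_poly coeff_pCons split: nat.splits)
        then show ?thesis
          unfolding L_def l_def hom_mpoly_subst[OF evp.comm_ring_hom_axioms] by simp
      qed
      have "map_poly (mpoly_eval x) (Polynomial.smult (Const (mpoly_eval w B) ^ k) (L A)) =
         l x B * map_poly (mpoly_eval x) Q + map_poly (mpoly_eval x) R"
        unfolding div by (simp add: evp.hom_add evp.hom_mult evL)
      moreover have "map_poly (mpoly_eval x) (Polynomial.smult (Const (mpoly_eval w B) ^ k) (L A)) =
          Polynomial.smult (mpoly_eval w B ^ k) (l x A)"
        by (rule poly_eqI) (simp add: coeff_map_poly flip: evL)
      ultimately have "map_poly (mpoly_eval x) R =
         Polynomial.smult (mpoly_eval w B ^ k) (l x A) - l x B * map_poly (mpoly_eval x) Q" by simp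
      then have "l x B dvd map_poly (mpoly_eval x) R"
        using dvd[OF x] by (simp add: dvd_smult)
      moreover have "map_poly (mpoly_eval x) R = 0 \<or> degree (map_poly (mpoly_eval x) R) < degree (l x B)"
        using degR degree_map_poly_le[of "mpoly_eval x" R] dvd[OF x] by auto
      ultimately have "map_poly (mpoly_eval x) R = 0"
        using dvd_imp_degree_le[of "l x B" "map_poly (mpoly_eval x) R"] by linarith
      then have "coeff (map_poly (mpoly_eval x) R) j = 0" by simp
      then show "mpoly_eval x (coeff R j) = 0" by (simp add: coeff_map_poly)
    qed
  qed
  have L0: "poly (L F) 0 = F" for F
  proof -
    have "comm_ring_hom (\<lambda>p :: (pvar, 'a) mpoly poly. poly p 0)" by unfold_locales auto
    from hom_mpoly_subst[OF this, of "\<lambda>c. [:Const c:]" "\<lambda>v. [:Var v, Const (w v):]" F]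
    show ?thesis by (simp add: L_def mpoly_subst_id)
  qed
  let ?b = "mpoly_eval w B ^ k"
  have Const_pow: "Const c ^ j = (Const (c ^ j) :: (pvar, 'a) mpoly)" for c j
  proof -
    interpret C: comm_ring_hom "Const :: 'a \<Rightarrow> (pvar, 'a) mpoly" by (rule Const_hom)
    show ?thesis by (simp add: C.hom_power)
  qed
  have "Const ?b * A = B * poly Q 0"
    using arg_cong[OF div, of "\<lambda>p. poly p 0"] \<open>R = 0\<close> by (simp add: L0 Const_pow)
  moreover have "Const (1 / ?b) * Const ?b = (1 :: (pvar, 'a) mpoly)"
    using wB by (simp add: Const_def mult_single)
  ultimately have "A = Const (1 / ?b) * (B * poly Q 0)"
    by (metis (no_types) mult.assoc mult_1)
  also have "\<dots> = (Const (1 / ?b) * poly Q 0) * B"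
    by (simp only: mult_ac)
  finally show ?thesis by (rule exI)
qed

text \<open>
  Substituting \<open>s\<^sup>\<omega>\<^sup>(\<^sup>v\<^sup>) X\<^sub>v\<close> for \<open>X\<^sub>v\<close> multiplies a homogeneous polynomial of weight \<open>e\<close> by \<open>s\<^sup>e\<close>.  Comparing
  the coefficients of \<open>s\<close> after cancelling \<open>Q\<close> shows that only the weight \<open>a - b\<close> occurs in \<open>G\<close>.
\<close>

lemma homogeneous_quotient:
  fixes P G Q :: "('v::linorder, 'a::field) mpoly"
  assumes PGQ: "P = G * Q" and Q: "Q \<noteq> 0"
    and P: "\<And>m. m \<in> keys P \<Longrightarrow> wt \<omega> m = a"
    and Qb: "\<And>m. m \<in> keys Q \<Longrightarrow> wt \<omega> m = b"
    and m: "m \<in> keys G"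
  shows "wt \<omega> m + b = a"
proof -
  let ?h = "\<lambda>c. [:Const c:] :: ('v, 'a) mpoly poly"
  define \<phi> where "\<phi> = mpoly_subst ?h (\<lambda>v. monom (Var v) (\<omega> v))"
  have h: "comm_ring_hom ?h" by (rule hom_comp[OF const_poly_hom Const_hom])
  interpret \<phi>: comm_ring_hom \<phi> unfolding \<phi>_def by (rule mpoly_subst_hom[OF h])
  have mono: "mono_val (\<lambda>v. monom (Var v) (\<omega> v)) m = monom (Poly_Mapping.single m (1::'a)) (wt \<omega> m)" for m
  proof -
    have "(\<Prod>v\<in>S. monom (Var v) (\<omega> v) ^ lookup m v) =
      monom (\<Prod>v\<in>S. Var v ^ lookup m v :: ('v, 'a) mpoly) (\<Sum>v\<in>S. \<omega> v * lookup m v)" for S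
      by (induction S rule: infinite_finite_induct) (auto simp: mult_monom monom_power)
    then show ?thesis by (simp add: mono_val_def wt_def flip: mono_val_Var)
  qed
  have \<phi>: "\<phi> F = (\<Sum>m\<in>keys F. monom (Poly_Mapping.single m (lookup F m)) (wt \<omega> m))" for F
    unfolding \<phi>_def mpoly_subst_alt mono by (simp add: Const_def smult_monom mult_single)
  have hom: "\<phi> F = monom F e" if "\<And>m. m \<in> keys F \<Longrightarrow> wt \<omega> m = e" for F e
  proof -
    have "\<phi> F = (\<Sum>m\<in>keys F. monom (Poly_Mapping.single m (lookup F m)) e)"
      unfolding \<phi> using that by simp
    also have "\<dots> = monom F e"
      by (subst (2) poly_mapping_as_sum[of F]) (simp add: monom_sum)
    finally show ?thesis .
  qed
  have "\<phi> G * monom Q b = monom (G * Q) a"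
    using hom[of P a] P hom[of Q b] Qb by (simp add: PGQ \<phi>.hom_mult)
  then have "coeff (\<phi> G * monom Q b) (wt \<omega> m + b) = coeff (monom (G * Q) a) (wt \<omega> m + b)"
    by simp
  then have eq: "Q * coeff (\<phi> G) (wt \<omega> m) = (if a = wt \<omega> m + b then G * Q else 0)"
    by (simp add: mult.commute[of "\<phi> G"] coeff_monom_mult)
  have "lookup (coeff (\<phi> G) (wt \<omega> m)) m =
      (\<Sum>m'\<in>keys G. if m' = m then lookup G m else 0)"
    unfolding \<phi> coeff_sum lookup_sum by (intro sum.cong) (auto simp: lookup_single when_def)
  then have "coeff (\<phi> G) (wt \<omega> m) \<noteq> 0"
    using m by (auto simp: in_keys_iff)
  then show ?thesis using eq Q by (auto split: if_splits)
qed

lemma mform_quotient: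
  fixes P G Q :: "('v::linorder, 'a::field) mpoly"
  assumes PGQ: "P = G * Q" and nz: "Q \<noteq> 0" "P \<noteq> 0"
    and P: "mform Vs blk a P" and Q: "mform Vs blk b Q"
  shows "mform Vs blk (\<lambda>u. a u - b u) G" "b u \<le> a u"
proof -
  have blk: "wt (block_wt blk u) m + b u = a u" if "m \<in> keys G" for m u
    by (rule homogeneous_quotient[OF PGQ nz(1) _ _ that]) (use P Q in \<open>auto simp: mform_iff\<close>)
  have out: "wt (\<lambda>v. of_bool (v \<notin> Vs)) m + 0 = 0" if "m \<in> keys G" for m
    by (rule homogeneous_quotient[OF PGQ nz(1) _ _ that]) (use P Q in \<open>auto simp: mform_iff\<close>)
  show "mform Vs blk (\<lambda>u. a u - b u) G"
    unfolding mform_iff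
  proof (intro ballI conjI allI)
    fix m u assume m: "m \<in> keys G"
    show "wt (\<lambda>v. of_bool (v \<notin> Vs)) m = 0" using out[OF m] by simp
    show "wt (block_wt blk u) m = a u - b u" using blk[OF m, of u] by simp
  qed
  have "G \<noteq> 0" using nz PGQ by auto
  then obtain m where "m \<in> keys G" by (metis keys_eq_empty ex_in_conv)
  then show "b u \<le> a u" using blk by (metis le_add2)
qed

section \<open>Exceptional divisors\<close>

lemma mform_minor:
  assumes "j \<le> n" "k \<le> n + 1" "l \<le> n" "m \<le> n + 1"
  shows "mform (pvars n) factor_of (\<lambda>_. 1) (graph_coord p (Exc i j k l m) :: (pvar, 'a::field) mpoly)"
proof -
  have "mform (pvars n) factor_of (\<lambda>_. 1) (Const c * Var (X j) * Var (Y k) :: (pvar, 'a) mpoly)"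
    if "j \<le> n" "k \<le> n + 1" for c j k
  proof (rule mform_cong[OF mform_mult[OF mform_mult[OF mform_Const mform_Var] mform_Var]])
    show "0 + of_bool (factor_of (X j) = b) + of_bool (factor_of (Y k) = b) = (1::nat)" for b
      by (cases b) auto
  qed (use that in auto)
  then show ?thesis using assms by (simp add: mform_diff del: One_nat_def)
qed

lemma normalised_minor:
  fixes a b c1 c2 p r s t x :: "'k::field"
  assumes "r * a * b = 1" "r * b = s" "s * p = t" "c1 \<noteq> 0" "c2 \<noteq> 0"
  shows "r * ((a * b * x * c2 - p * b * c1 * c2) / (c1 * c2)) = x / c1 - t"
proof -
  have "r * (a * b * x * c2 - p * b * c1 * c2) = (r * a * b) * x * c2 - ((r * b) * p) * c1 * c2"
    by (simp add: algebra_simps)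
  also have "\<dots> = x * c2 - t * c1 * c2" by (simp add: assms(1-3))
  finally have "r * ((a * b * x * c2 - p * b * c1 * c2) / (c1 * c2)) = (x * c2 - t * c1 * c2) / (c1 * c2)"
    by simp
  also have "\<dots> = x / c1 - t" using assms(4,5) by (simp add: field_simps)
  finally show ?thesis .
qed

context blow_up_point
begin

definition local_unit :: "(pvar, 'a) mpoly fract \<Rightarrow> bool" where
  "local_unit u \<longleftrightarrow> u \<in> LR \<and> inverse u \<in> LR \<and> u \<noteq> 0"

lemma local_unit_mult: "local_unit u \<Longrightarrow> local_unit v \<Longrightarrow> local_unit (u * v)"
  by (auto simp: local_unit_def local_ring_mult)

lemma local_unit_inverse: "local_unit u \<Longrightarrow> local_unit (inverse u)"
  by (auto simp: local_unit_def)

lemma local_unit_1: "local_unit 1"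
  by (simp add: local_unit_def local_ring_01)

lemma local_unit_power: "local_unit u \<Longrightarrow> local_unit (u ^ k)"
  by (induction k) (auto intro: local_unit_mult local_unit_1)

lemma local_unit_power_int: "local_unit u \<Longrightarrow> local_unit (u powi k)"
  by (auto simp: power_int_def intro: local_unit_power local_unit_inverse)

lemma local_unit_prod: "(\<And>i. i \<in> I \<Longrightarrow> local_unit (f i)) \<Longrightarrow> local_unit (\<Prod>i\<in>I. f i)"
  by (induction I rule: infinite_finite_induct) (auto intro: local_unit_mult local_unit_1)

lemma local_unitI:
  assumes "u \<in> LR" "v \<in> LR" "u * v = 1" shows "local_unit u"
proof -
  have "u \<noteq> 0" using assms(3) by auto
  then have "inverse u = v" using assms(3) by (metis inverse_unique)
  then show ?thesis using assms \<open>u \<noteq> 0\<close> by (simp add: local_unit_def)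
qed

lemma base_local_ringI:
  assumes "mform (pvars n) factor_of d A" "mform (pvars n) factor_of d B" "mpoly_eval (blow_down q) B \<noteq> 0"
  shows "to_fract A / to_fract B \<in> LR"
  using local_ringI[OF mform_pullback[OF assms(1)] mform_pullback[OF assms(2)]] assms(3) by simp

text \<open>
  The coordinates that the divisors \<open>H1\<close> and \<open>H2\<close> use as denominators near \<open>q\<close>.
\<close>

definition chart :: "factor \<Rightarrow> pvar" where
  "chart b = (case b of First \<Rightarrow> X (LEAST j. q (Base (X j)) \<noteq> 0) | Second \<Rightarrow> Y (LEAST k. q (Base (Y k)) \<noteq> 0))"

lemma chart: "chart b \<in> pvars n" "factor_of (chart b) = b" "blow_down q (chart b) \<noteq> 0"
proof -
  obtain j k where jk: "j \<le> n" "q (Base (X j)) \<noteq> 0" "k \<le> n + 1" "q (Base (Y k)) \<noteq> 0"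
    using blow_down_q by (auto simp: PP_iff blow_down_def)
  have "(LEAST j. q (Base (X j)) \<noteq> 0) \<le> n"
    using jk Least_le[of "\<lambda>j. q (Base (X j)) \<noteq> 0" j] by auto
  moreover have "(LEAST k. q (Base (Y k)) \<noteq> 0) \<le> n + 1"
    using jk Least_le[of "\<lambda>k. q (Base (Y k)) \<noteq> 0" k] by auto
  ultimately show "chart b \<in> pvars n" by (cases b) (auto simp: chart_def)
  show "factor_of (chart b) = b" by (cases b) (auto simp: chart_def)
  show "blow_down q (chart b) \<noteq> 0"
    using jk LeastI[of "\<lambda>j. q (Base (X j)) \<noteq> 0" j] LeastI[of "\<lambda>k. q (Base (Y k)) \<noteq> 0" k]
    by (cases b) (auto simp: chart_def blow_down_def)
qed

abbreviation "cv b \<equiv> to_fract (Var (chart b)) :: (pvar, 'a) mpoly fract"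

lemma cv_nonzero: "cv b \<noteq> 0"
  by (simp add: Var_nonzero)

lemma H1_chart: "H1 q = to_fract (Var (X 0)) / cv First"
  by (simp add: H1_def Fract_conv_to_fract chart_def)

lemma H2_chart: "H2 q = to_fract (Var (Y 0)) / cv Second"
  by (simp add: H2_def Fract_conv_to_fract chart_def)

lemma coordinate_in_max_ideal:
  assumes v: "v \<in> pvars n"
  shows "to_fract (Var v) / cv (factor_of v) -
      cf (blow_down q v / blow_down q (chart (factor_of v))) \<in> MM"
proof -
  let ?r = "chart (factor_of v)" and ?c = "blow_down q v / blow_down q (chart (factor_of v))"
  let ?d = "\<lambda>b. of_bool (block_of (Base v) = b) :: nat"
  let ?A = "Var (Base v) - Const ?c * Var (Base ?r) :: (bvar, 'a) mpoly"
  have r: "mform (bvars n) block_of ?d (Var (Base ?r) :: (bvar, 'a) mpoly)"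
    by (rule mform_cong[OF mform_Var]) (use chart[of "factor_of v"] in auto)
  have "mform (bvars n) block_of ?d (Const ?c * Var (Base ?r))"
    by (rule mform_cong[OF mform_mult[OF mform_Const r]]) simp
  then have A: "mform (bvars n) block_of ?d ?A"
    by (intro mform_diff mform_Var) (use v in auto)
  have "res ?A / res (Var (Base ?r)) \<in> MM"
    by (rule max_idealI[OF A r]) (use chart(3)[of "factor_of v"] in \<open>auto simp: blow_down_def\<close>)
  also have "res ?A / res (Var (Base ?r)) = to_fract (Var v) / cv (factor_of v) - cf ?c"
    by (simp add: diff_divide_distrib Var_nonzero)
  finally show ?thesis .
qed

lemma form_in_max_ideal_power:
  assumes "mform (pvars n) factor_of d G" "vanishes G (blow_down q) r"
  shows "to_fract G / (cv First ^ d First * cv Second ^ d Second) \<in> max_ideal_power n p q r"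
proof (rule dehomogenize_in_filtration[OF assms filtration_max_ideal_power])
  fix v assume v: "v \<in> pvars n"
  have "a \<in> max_ideal_power n p q 1" if "a \<in> MM" for a
    using ideal_prodI[OF that local_ring_01(2)] by simp
  then show "to_fract (Var v) / cv (factor_of v) -
      cf (blow_down q v / blow_down q (chart (factor_of v))) \<in> max_ideal_power n p q 1"
    using coordinate_in_max_ideal[OF v] by blast
qed (use max_ideal_power_decreasing local_ring_const chart in auto)

subsection \<open>The exceptional ideal\<close>

abbreviation "pt_ideal i \<equiv> {Fraction_Field.Fract A B | A B d. mform (pvars n) factor_of d A \<and>
    mform (pvars n) factor_of d B \<and> mpoly_eval (blow_down q) B \<noteq> 0 \<and> mpoly_eval (pt p i) A = 0}"

lemma pt_ideal_subset: "pt_ideal i \<subseteq> LR"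
  using base_local_ringI by (auto simp: Fract_conv_to_fract)

lemma exceptional_ideal_subset: "exceptional_ideal n p i q \<subseteq> LR"
  unfolding exceptional_ideal_def
  by (rule ideal_prod_subset)
     (use pt_ideal_subset local_ring_01 local_ring_add local_ring_mult in blast)+

text \<open>
  Two generators of a principal ideal differ by a unit; in this form the choice made in \<open>exc_divisor\<close>
  is immaterial.
\<close>

lemma exc_divisor_generator:
  assumes "exceptional_ideal n p i q = (\<lambda>g. e * g) ` LR" "e \<noteq> 0"
  obtains u where "local_unit u" "exc_divisor n p i q = e * u"
proof -
  let ?e = "exc_divisor n p i q"
  have e': "exceptional_ideal n p i q = (\<lambda>g. ?e * g) ` LR"
    unfolding exc_divisor_def by (rule someI) (rule assms(1))
  have "e * 1 \<in> (\<lambda>g. ?e * g) ` LR"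
    unfolding e'[symmetric] assms(1) using local_ring_01(2) by (rule imageI)
  then obtain g where g: "g \<in> LR" "e = ?e * g" by (elim imageE) simp
  have "?e * 1 \<in> (\<lambda>g. e * g) ` LR"
    unfolding assms(1)[symmetric] e' using local_ring_01(2) by (rule imageI)
  then obtain g' where g': "g' \<in> LR" "?e = e * g'" by (elim imageE) simp
  have "e * 1 = e * (g' * g)" using g g' by (simp add: mult.assoc)
  then have "g' * g = 1" using assms(2) by (metis mult_cancel_left)
  then have "local_unit g'" using g g' by (intro local_unitI)
  then show thesis using that g' by blast
qed

lemma exc_divisor_unit:
  assumes "mform (pvars n) factor_of d A" "mpoly_eval (pt p i) A = 0" "mpoly_eval (blow_down q) A \<noteq> 0"
  shows "local_unit (exc_divisor n p i q)"
proof -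
  have "A \<noteq> 0" using assms(3) by auto
  then have "1 = Fraction_Field.Fract A A" by (simp add: Fract_conv_to_fract)
  then have one: "1 \<in> pt_ideal i" using assms by blast
  have "LR \<subseteq> exceptional_ideal n p i q"
    using ideal_prodI[OF one] by (fastforce simp: exceptional_ideal_def)
  then have "exceptional_ideal n p i q = (\<lambda>g. 1 * g) ` LR"
    using exceptional_ideal_subset by auto
  from exc_divisor_generator[OF this] show ?thesis by auto
qed

text \<open>
  The differences \<open>X\<^sub>v / X\<^sub>\<rho> - a\<^sub>v / a\<^sub>\<rho>\<close> that generate the ideal of \<open>p\<^sub>i = a\<close> are, up to constants, minors divided by
  coordinates.  Any two minors have a ratio that is regular at \<open>q\<close> once the denominator is a coordinate of the
  exceptional block that is nonzero at \<open>q\<close>, so this minor generates the ideal.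
\<close>

lemma exc_divisor_over_point:
  assumes over: "blow_down q = pt p i" and i: "i < n + 3"
    and idx: "j \<le> n" "k \<le> n + 1" "l \<le> n" "m \<le> n + 1" and nz: "q (Exc i j k l m) \<noteq> 0"
  obtains u where "local_unit u"
    "exc_divisor n p i q = to_fract (graph_coord p (Exc i j k l m)) / (cv First * cv Second) * u"
proof -
  let ?\<mu> = "\<lambda>j k l m. graph_coord p (Exc i j k l m)"
  define M where "M = to_fract (?\<mu> j k l m) / (cv First * cv Second)"
  have mu_form: "mform (bvars n) block_of (\<lambda>b. of_bool (Exceptional i = b)) (Var (Exc i j k l m) :: (bvar, 'a) mpoly)"
    if "j \<le> n" "k \<le> n + 1" "l \<le> n" "m \<le> n + 1" for j k l m
    by (rule mform_cong[OF mform_Var]) (use that i in auto)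
  have mu_nz: "?\<mu> j k l m \<noteq> 0"
    using restrict_nonzero[OF mu_form[OF idx]] nz by (simp del: graph_coord.simps)
  then have M_nz: "M \<noteq> 0" by (simp add: M_def Var_nonzero del: graph_coord.simps)
  have ratio: "to_fract (?\<mu> j' k' l' m') / to_fract (?\<mu> j k l m) \<in> LR"
    if "j' \<le> n" "k' \<le> n + 1" "l' \<le> n" "m' \<le> n + 1" for j' k' l' m'
    using local_ringI[OF mu_form[OF that] mu_form[OF idx]] nz by (simp del: graph_coord.simps)
  have "M \<in> pt_ideal i"
  proof -
    have "mform (pvars n) factor_of (\<lambda>_. 1) (Var (chart First) * Var (chart Second) :: (pvar, 'a) mpoly)"
    proof (rule mform_cong[OF mform_mult[OF mform_Var mform_Var]])
      show "of_bool (factor_of (chart First) = b) + of_bool (factor_of (chart Second) = b) = (1::nat)" for b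
        by (cases b) (auto simp: chart)
    qed (auto simp: chart)
    moreover have "M = Fraction_Field.Fract (?\<mu> j k l m) (Var (chart First) * Var (chart Second))"
      by (simp add: M_def Fract_conv_to_fract del: graph_coord.simps)
    moreover have "mpoly_eval (blow_down q) (Var (chart First) * Var (chart Second)) \<noteq> 0"
      using chart(3) by simp
    moreover have "mpoly_eval (pt p i) (?\<mu> j k l m) = 0" by simp
    ultimately show ?thesis using mform_minor[OF idx] by blast
  qed
  \<comment> \<open>All positive steps of the filtration are the ideal generated by \<open>M\<close>.\<close>
  define F where "F = (\<lambda>j::nat. if j = 0 then LR else (\<lambda>g. M * g) ` LR)"
  have M_LR: "M \<in> LR" using \<open>M \<in> pt_ideal i\<close> pt_ideal_subset by blast
  have mult_M: "a * (M * g) \<in> (\<lambda>g. M * g) ` LR" if "a \<in> LR" "g \<in> LR" for a g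
    using that by (intro image_eqI[of _ _ "a * g"]) (auto simp: mult_ac local_ring_mult)
  have add_M: "a + b \<in> (\<lambda>g. M * g) ` LR" if "a \<in> (\<lambda>g. M * g) ` LR" "b \<in> (\<lambda>g. M * g) ` LR" for a b
  proof -
    from that obtain g h where "g \<in> LR" "h \<in> LR" "a = M * g" "b = M * h" by auto
    then show ?thesis by (intro image_eqI[of _ _ "g + h"]) (auto simp: algebra_simps local_ring_add)
  qed
  have zero_M: "0 \<in> (\<lambda>g. M * g) ` LR" using local_ring_01 by (intro image_eqI[of _ _ 0]) auto
  have F: "filtration F"
  proof (rule filtrationI)
    show "0 \<in> F j" "1 \<in> F 0" for j using zero_M local_ring_01 by (auto simp: F_def)
    show "a + b \<in> F j" if "a \<in> F j" "b \<in> F j" for a b j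
      using that add_M local_ring_add by (auto simp only: F_def split: if_splits)
    fix a b i j assume a: "a \<in> F i" and b: "b \<in> F j"
    have LR: "a \<in> LR" "b \<in> LR"
      using a b M_LR by (auto simp: F_def local_ring_mult split: if_splits)
    show "a * b \<in> F (i + j)"
    proof (cases "i = 0")
      case True
      then show ?thesis using LR b mult_M by (auto simp: F_def local_ring_mult split: if_splits)
    next
      case False
      then obtain g where g: "g \<in> LR" "a = M * g" using a by (auto simp: F_def)
      have "b * (M * g) \<in> (\<lambda>g. M * g) ` LR" by (rule mult_M[OF LR(2) g(1)])
      then show ?thesis using False g by (simp add: F_def mult.commute)
    qed
  qed
  have coords: "to_fract (Var v) / cv (factor_of v) -
      cf (blow_down q v / blow_down q (chart (factor_of v))) \<in> F 1" if v: "v \<in> pvars n" for v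
  proof -
    obtain \<alpha> \<beta> where ab: "chart First = X \<alpha>" "chart Second = Y \<beta>"
      by (auto simp: chart_def)
    let ?a = "pt p i (X \<alpha>)" and ?b = "pt p i (Y \<beta>)"
    have abn: "\<alpha> \<le> n" "\<beta> \<le> n + 1" "?a \<noteq> 0" "?b \<noteq> 0"
      using chart[of First] chart[of Second] by (simp_all add: ab over)
    interpret cf: comm_ring_hom cf by (rule hom_comp[OF to_fract_hom Const_hom])
    obtain \<mu>' where mu': "\<mu>' / to_fract (?\<mu> j k l m) \<in> LR"
      and eq: "to_fract (Var v) / cv (factor_of v) - cf (blow_down q v / blow_down q (chart (factor_of v))) =
        cf (1 / (?a * ?b)) * (\<mu>' / (cv First * cv Second))"
    proof (cases v)
      case (X j')
      have mu: "to_fract (?\<mu> j' \<beta> \<alpha> \<beta>) = cf ?a * cf ?b * to_fract (Var (X j')) * cv Second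
         - cf (pt p i (X j')) * cf ?b * cv First * cv Second"
        by (simp add: ab cf.hom_mult)
      have "cf (1 / (?a * ?b)) * cf ?a * cf ?b = 1" "cf (1 / (?a * ?b)) * cf ?b = cf (1 / ?a)"
        "cf (1 / ?a) * cf (pt p i (X j')) = cf (pt p i (X j') / ?a)"
        using abn by (simp_all flip: cf.hom_mult)
      from normalised_minor[OF this cv_nonzero[of First] cv_nonzero[of Second], of "to_fract (Var (X j'))"]
      have "cf (1 / (?a * ?b)) * (to_fract (?\<mu> j' \<beta> \<alpha> \<beta>) / (cv First * cv Second)) =
         to_fract (Var (X j')) / cv First - cf (pt p i (X j') / ?a)"
        unfolding mu .
      then show thesis
        using X v abn by (intro that[OF ratio[of j' \<beta> \<alpha> \<beta>]]) (simp_all add: ab over del: graph_coord.simps)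
    next
      case (Y k')
      have mu: "to_fract (?\<mu> \<alpha> k' \<alpha> \<beta>) = cf ?b * cf ?a * to_fract (Var (Y k')) * cv First
         - cf (pt p i (Y k')) * cf ?a * cv Second * cv First"
        by (simp add: ab cf.hom_mult mult_ac)
      have "cf (1 / (?a * ?b)) * cf ?b * cf ?a = 1" "cf (1 / (?a * ?b)) * cf ?a = cf (1 / ?b)"
        "cf (1 / ?b) * cf (pt p i (Y k')) = cf (pt p i (Y k') / ?b)"
        using abn by (simp_all flip: cf.hom_mult)
      from normalised_minor[OF this cv_nonzero[of Second] cv_nonzero[of First], of "to_fract (Var (Y k'))"]
      have "cf (1 / (?a * ?b)) * (to_fract (?\<mu> \<alpha> k' \<alpha> \<beta>) / (cv First * cv Second)) =
         to_fract (Var (Y k')) / cv Second - cf (pt p i (Y k') / ?b)"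
        unfolding mu by (simp only: mult.commute[of "cv First"])
      then show thesis
        using Y v abn by (intro that[OF ratio[of \<alpha> k' \<alpha> \<beta>]]) (simp_all add: ab over del: graph_coord.simps)
    qed
    have "to_fract (Var v) / cv (factor_of v) - cf (blow_down q v / blow_down q (chart (factor_of v))) =
        M * (cf (1 / (?a * ?b)) * (\<mu>' / to_fract (?\<mu> j k l m)))"
      unfolding eq M_def using mu_nz by (simp del: graph_coord.simps)
    also have "\<dots> \<in> F 1"
    proof -
      have "F 1 = (\<lambda>g. M * g) ` LR" by (simp add: F_def)
      then show ?thesis by (simp only:) (intro imageI local_ring_mult local_ring_const mu')
    qed
    finally show ?thesis .
  qed
  have "exceptional_ideal n p i q \<subseteq> (\<lambda>g. M * g) ` LR"
    unfolding exceptional_ideal_def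
  proof (rule ideal_prod_subset[OF zero_M add_M])
    fix a b assume "a \<in> pt_ideal i" and b: "b \<in> LR"
    then obtain A B d where AB: "a = to_fract A / to_fract B" "mform (pvars n) factor_of d A"
      "mform (pvars n) factor_of d B" "mpoly_eval (blow_down q) B \<noteq> 0" "mpoly_eval (blow_down q) A = 0"
      by (auto simp: Fract_conv_to_fract over)
    let ?c = "cv First ^ d First * cv Second ^ d Second"
    have "to_fract A / ?c \<in> F 1"
      by (rule dehomogenize_in_filtration[OF AB(2) vanishes_1[OF AB(5)] F])
         (use coords chart local_ring_const in \<open>auto simp: F_def\<close>)
    then obtain g where g: "g \<in> LR" "to_fract A / ?c = M * g" by (auto simp: F_def)
    have "mform (pvars n) factor_of d (Var (chart First) ^ d First * Var (chart Second) ^ d Second :: (pvar, 'a) mpoly)"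
    proof (rule mform_cong[OF mform_mult[OF mform_power[OF mform_Var] mform_power[OF mform_Var]]])
      show "d First * of_bool (factor_of (chart First) = b) + d Second * of_bool (factor_of (chart Second) = b) = d b" for b
        by (cases b) (auto simp: chart)
    qed (auto simp: chart)
    from base_local_ringI[OF this AB(3,4)] have cB: "?c / to_fract B \<in> LR" by simp
    have a: "a = (?c / to_fract B) * (M * g)"
      using g(2)[symmetric] cv_nonzero[of First] cv_nonzero[of Second] by (simp add: AB(1))
    have "a \<in> (\<lambda>g. M * g) ` LR" unfolding a by (rule mult_M[OF cB g(1)])
    then obtain g' where "a = M * g'" "g' \<in> LR" by auto
    then show "a * b \<in> (\<lambda>g. M * g) ` LR" using mult_M[OF b, of g'] by (simp add: mult.commute)
  qed
  moreover have "(\<lambda>g. M * g) ` LR \<subseteq> exceptional_ideal n p i q"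
    using ideal_prodI[OF \<open>M \<in> pt_ideal i\<close>] by (auto simp: exceptional_ideal_def)
  ultimately have "exceptional_ideal n p i q = (\<lambda>g. M * g) ` LR" by blast
  from exc_divisor_generator[OF this M_nz] show thesis using that by (auto simp: M_def)
qed

end

section \<open>Points of the blow-up\<close>

lemma tuple_PP:
  assumes "p \<in> mproj (tuple_vars n) tuple_block" "i < n + 3"
  shows "pt p i \<in> PP n"
proof -
  have "\<exists>v\<in>pvars n. factor_of v = b \<and> p (i, v) \<noteq> 0" for b
  proof -
    have "(i, b) \<in> tuple_block ` tuple_vars n"
    proof (cases b)
      case First
      then show ?thesis using assms(2)
        by (intro image_eqI[of _ _ "(i, X 0)"]) (auto simp: tuple_block_def tuple_vars_def)
    next
      case Second
      then show ?thesis using assms(2)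
        by (intro image_eqI[of _ _ "(i, Y 0)"]) (auto simp: tuple_block_def tuple_vars_def)
    qed
    then show ?thesis using assms(1) by (fastforce simp: mproj_def tuple_block_def tuple_vars_def)
  qed
  then show ?thesis using assms by (auto simp: mproj_def pt_def tuple_vars_def)
qed

lemma tuple_zero:
  assumes "p \<in> mproj (tuple_vars n) tuple_block" "\<not> (i < n + 3 \<and> v \<in> pvars n)"
  shows "pt p i v = 0"
  using assms by (auto simp: mproj_def pt_def tuple_vars_def)

lemma graph_point_outside:
  assumes p: "p \<in> mproj (tuple_vars n) tuple_block" and x: "\<And>v. v \<notin> pvars n \<Longrightarrow> x v = 0"
    and u: "u \<notin> bvars n"
  shows "graph_point p x u = 0"
proof (cases u)
  case (Base v)
  then show ?thesis using u x by simp
next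
  case (Exc i j k l m)
  then have "\<not> i < n + 3 \<or> X j \<notin> pvars n \<or> Y k \<notin> pvars n \<or> X l \<notin> pvars n \<or> Y m \<notin> pvars n"
    using u by auto
  then show ?thesis
    unfolding Exc graph_point_simps using x tuple_zero[OF p] by (metis diff_zero mult_zero_left mult_zero_right)
qed

lemma block_cases:
  assumes "b \<in> block_of ` bvars n"
  obtains f where "b = Factor f" | i where "b = Exceptional i" "i < n + 3"
  using assms by (auto simp: bvars_def)

lemma mproj_bvarsI:
  assumes "\<And>u. u \<notin> bvars n \<Longrightarrow> q u = 0" and "(\<lambda>v. q (Base v)) \<in> PP n"
    and "\<And>i. i < n + 3 \<Longrightarrow> \<exists>j k l m. j \<le> n \<and> k \<le> n + 1 \<and> l \<le> n \<and> m \<le> n + 1 \<and> q (Exc i j k l m) \<noteq> 0"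
  shows "q \<in> mproj (bvars n) block_of"
proof -
  have "\<exists>u\<in>bvars n. block_of u = b \<and> q u \<noteq> 0" if b: "b \<in> block_of ` bvars n" for b
    using b
  proof (cases rule: block_cases)
    case (1 f)
    obtain j k where "j \<le> n" "q (Base (X j)) \<noteq> 0" "k \<le> n + 1" "q (Base (Y k)) \<noteq> 0"
      using assms(2) by (auto simp: PP_iff)
    then show ?thesis using 1
      by (cases f) (auto intro: bexI[of _ "Base (X j)"] bexI[of _ "Base (Y k)"])
  next
    case (2 i)
    obtain j k l m where "j \<le> n" "k \<le> n + 1" "l \<le> n" "m \<le> n + 1" "q (Exc i j k l m) \<noteq> 0"
      using assms(3)[OF 2(2)] by blast
    then show ?thesis using 2 by (intro bexI[of _ "Exc i j k l m"]) auto
  qed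
  then show ?thesis using assms(1) by (auto simp: mproj_def)
qed

lemma nonzero_minor:
  assumes "x \<in> PP n" "pt p i \<in> PP n" "\<not> same_point factor_of x (pt p i)"
  obtains j k l m where "j \<le> n" "k \<le> n + 1" "l \<le> n" "m \<le> n + 1"
    "mpoly_eval x (graph_coord p (Exc i j k l m)) \<noteq> 0"
proof (rule ccontr)
  assume "\<not> thesis"
  then have "pt p i (X l) * pt p i (Y m) * x (X j) * x (Y k) = pt p i (X j) * pt p i (Y k) * x (X l) * x (Y m)"
    if "j \<le> n" "k \<le> n + 1" "l \<le> n" "m \<le> n + 1" for j k l m
    using that(1-4) \<open>\<And>j k l m. j \<le> n \<Longrightarrow> k \<le> n + 1 \<Longrightarrow> l \<le> n \<Longrightarrow> m \<le> n + 1 \<Longrightarrow>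
      mpoly_eval x (graph_coord p (Exc i j k l m)) \<noteq> 0 \<Longrightarrow> thesis\<close>[of j k l m] by auto
  from same_point_if_minors_vanish[OF assms(1,2) this] assms(3) show False by blast
qed

lemma graph_point_in_mproj:
  assumes p: "p \<in> mproj (tuple_vars n) tuple_block" and x: "x \<in> PP n"
    and away: "\<And>i. i < n + 3 \<Longrightarrow> \<not> same_point factor_of x (pt p i)"
  shows "graph_point p x \<in> mproj (bvars n) block_of"
  proof (rule mproj_bvarsI)
    show "graph_point p x u = 0" if "u \<notin> bvars n" for u
      by (rule graph_point_outside[OF p _ that]) (use x in \<open>auto simp: PP_iff\<close>)
    show "(\<lambda>v. graph_point p x (Base v)) \<in> PP n" using x by simp
    fix i assume i: "i < n + 3"
    obtain j k l m where "j \<le> n" "k \<le> n + 1" "l \<le> n" "m \<le> n + 1"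
      "mpoly_eval x (graph_coord p (Exc i j k l m)) \<noteq> 0"
      by (rule nonzero_minor[OF x tuple_PP[OF p i] away[OF i]])
    then show "\<exists>j k l m. j \<le> n \<and> k \<le> n + 1 \<and> l \<le> n \<and> m \<le> n + 1 \<and> graph_point p x (Exc i j k l m) \<noteq> 0"
      unfolding graph_point_def by blast
  qed

lemma graph_point_in_blow_up:
  assumes p: "p \<in> mproj (tuple_vars n) tuple_block" and x: "x \<in> PP n"
    and away: "\<And>i. i < n + 3 \<Longrightarrow> \<not> same_point factor_of x (pt p i)"
  shows "graph_point p x \<in> blow_up n p"
proof -
  have "graph_point p x \<in> mproj (bvars n) block_of"
    by (rule graph_point_in_mproj[OF assms])
  then show ?thesis
    unfolding blow_up_def zclosure_def using x by (auto intro: hull_inc)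
qed

lemma exc_divisor_unit_away:
  assumes q: "q \<in> blow_up n p" and "pt p i \<in> PP n" "\<not> same_point factor_of (blow_down q) (pt p i)"
  shows "blow_up_point.local_unit n p q (exc_divisor n p i (q :: bvar \<Rightarrow> 'a::field_char_0))"
proof -
  interpret blow_up_point n p q by unfold_locales (rule q)
  obtain j k l m where *: "j \<le> n" "k \<le> n + 1" "l \<le> n" "m \<le> n + 1"
    "mpoly_eval (blow_down q) (graph_coord p (Exc i j k l m)) \<noteq> 0"
    by (rule nonzero_minor[OF blow_down_q assms(2,3)])
  show ?thesis
    by (rule exc_divisor_unit[OF mform_minor[OF *(1-4)] _ *(5)]) simp
qed

section \<open>Effective divisors as forms\<close>

definition bidegree :: "nat \<Rightarrow> nat \<Rightarrow> factor \<Rightarrow> nat" where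
  "bidegree a b f = (case f of First \<Rightarrow> a | Second \<Rightarrow> b)"

lemma mform_chart_power:
  assumes "u \<in> pvars n" "factor_of u = First" "v \<in> pvars n" "factor_of v = Second"
  shows "mform (pvars n) factor_of (bidegree a b) (Var u ^ a * Var v ^ b :: (pvar, 'a::field) mpoly)"
proof (rule mform_cong[OF mform_mult[OF mform_power[OF mform_Var] mform_power[OF mform_Var]]])
  show "a * of_bool (factor_of u = f) + b * of_bool (factor_of v = f) = bidegree a b f" for f
    by (cases f) (auto simp: assms bidegree_def)
qed (use assms in auto)

lemma power_int_nat_split: "x \<noteq> 0 \<Longrightarrow> x powi d = x ^ nat d / x ^ nat (- d)" for x :: "'k::field"
  by (cases "d \<ge> 0") (auto simp: power_int_def power_inverse field_simps)

text \<open>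
  Multiplying by local equations of the \<open>E\<^sub>i\<close> changes nothing off the exceptional divisors, so the rational
  function \<open>f X\<^sub>0\<close> to the power \<open>d\<^sub>1\<close> times \<open>Y\<^sub>0\<close> to the power \<open>d\<^sub>2\<close> satisfies the hypothesis of
  \<open>form_quotient_polynomial\<close>.
\<close>

theorem section_is_form:
  fixes p :: "nat \<times> pvar \<Rightarrow> 'a::{alg_closed_field, field_char_0}"
  assumes n: "n \<ge> 1" and p: "p \<in> mproj (tuple_vars n) tuple_block"
    and f: "f \<in> function_field n" "f \<noteq> 0"
    and reg: "\<And>q. q \<in> blow_up n p \<Longrightarrow> f * class_divisor n p d1 d2 m q \<in> local_ring n p q"
  obtains G where "mform (pvars n) factor_of (bidegree (nat d1) (nat d2)) G" "d1 \<ge> 0" "d2 \<ge> 0"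
    "f * to_fract (Var (X 0)) powi d1 * to_fract (Var (Y 0)) powi d2 = to_fract G"
proof -
  obtain A B d where AB: "f = to_fract A / to_fract B" "mform (pvars n) factor_of d A"
    "mform (pvars n) factor_of d B" "B \<noteq> 0"
    using f(1) by (auto simp: function_field_def Fract_conv_to_fract)
  let ?x = "to_fract (Var (X 0)) :: (pvar, 'a) mpoly fract" and ?y = "to_fract (Var (Y 0)) :: (pvar, 'a) mpoly fract"
  define NN :: "(pvar, 'a) mpoly" where "NN = Var (X 0) ^ nat d1 * Var (Y 0) ^ nat d2"
  \<comment> \<open>Negative exponents go to the denominator.\<close>
  define DD :: "(pvar, 'a) mpoly" where "DD = Var (X 0) ^ nat (- d1) * Var (Y 0) ^ nat (- d2)"
  have nz: "NN \<noteq> 0" "DD \<noteq> 0" by (auto simp: NN_def DD_def Var_nonzero)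
  have NN: "mform (pvars n) factor_of (bidegree (nat d1) (nat d2)) NN"
    and DD: "mform (pvars n) factor_of (bidegree (nat (- d1)) (nat (- d2))) DD"
    unfolding NN_def DD_def by (rule mform_chart_power; simp)+
  have xy: "f * ?x powi d1 * ?y powi d2 = to_fract (A * NN) / to_fract (B * DD)"
    by (simp add: power_int_nat_split Var_nonzero NN_def DD_def AB(1) mult.assoc)
  have forms: "mform (pvars n) factor_of (\<lambda>b. d b + bidegree (nat d1) (nat d2) b) (A * NN)"
    "mform (pvars n) factor_of (\<lambda>b. d b + bidegree (nat (- d1)) (nat (- d2)) b) (B * DD)"
    by (intro mform_mult AB NN DD)+
  have BD: "B * DD \<noteq> 0" using AB nz by simp
  have "A \<noteq> 0" using f(2) AB(1) by auto
  then have AN: "A * NN \<noteq> 0" using nz by simp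
  have "\<exists>G. A * NN = G * (B * DD)"
  proof (rule form_quotient_polynomial[OF n forms BD])
    fix x :: "pvar \<Rightarrow> 'a"
    assume x: "x \<in> PP n" and away: "\<And>i. i < n + 3 \<Longrightarrow> \<not> same_point factor_of x (pt p i)"
    define q where "q = graph_point p x"
    have q: "q \<in> blow_up n p" unfolding q_def by (rule graph_point_in_blow_up[OF p x away])
    interpret blow_up_point n p q by unfold_locales (rule q)
    have bd: "blow_down q = x" by (simp add: q_def)
    define u where "u = (\<Prod>i<n + 3. exc_divisor n p i q powi (- m i))"
    have u: "class_divisor n p d1 d2 m q = H1 q powi d1 * H2 q powi d2 * u"
      by (simp add: class_divisor_def u_def)
    have "local_unit u"
      unfolding u_def
    proof (intro local_unit_prod local_unit_power_int)
      fix i assume "i \<in> {..<n + 3}"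
      then show "local_unit (exc_divisor n p i q)"
        by (intro exc_divisor_unit_away[OF q tuple_PP[OF p]]) (use away bd in auto)
    qed
    then have ui: "inverse u \<in> LR" "u \<noteq> 0" by (auto simp: local_unit_def)
    have "f * class_divisor n p d1 d2 m q * inverse u \<in> LR"
      by (rule local_ring_mult[OF reg[OF q] ui(1)])
    also have "f * class_divisor n p d1 d2 m q * inverse u = f * H1 q powi d1 * H2 q powi d2"
      using ui(2) by (simp add: u)
    finally have "f * H1 q powi d1 * H2 q powi d2 \<in> LR" .
    then obtain A' B' e where AB': "f * H1 q powi d1 * H2 q powi d2 = res A' / res B'"
      "mpoly_eval q B' \<noteq> 0" "res B' \<noteq> 0" by (rule local_ringE)
    define C where "C = restrict_form p B' * (Var (chart First) ^ nat (- d1) * Var (chart Second) ^ nat (- d2))"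
    define E where "E = restrict_form p A' * (Var (chart First) ^ nat d1 * Var (chart Second) ^ nat d2)"
    have H: "H1 q powi d1 * H2 q powi d2 = ?x powi d1 * ?y powi d2 / (cv First powi d1 * cv Second powi d2)"
      by (simp add: H1_chart H2_chart power_int_divide_distrib)
    have cvp: "cv First powi d1 * cv Second powi d2 \<noteq> 0" using cv_nonzero by simp
    have "to_fract (A * NN) / to_fract (B * DD) = res A' / res B' * (cv First powi d1 * cv Second powi d2)"
    proof -
      have "f * (?x powi d1 * ?y powi d2) / (cv First powi d1 * cv Second powi d2) = res A' / res B'"
        using AB'(1) by (simp only: mult.assoc H times_divide_eq_right)
      then have "f * (?x powi d1 * ?y powi d2) = res A' / res B' * (cv First powi d1 * cv Second powi d2)"
        by (simp only: nonzero_divide_eq_eq[OF cvp])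
      then show ?thesis by (simp only: xy[symmetric] mult.assoc)
    qed
    also have "\<dots> = to_fract E / to_fract C"
      by (simp add: power_int_nat_split Var_nonzero E_def C_def)
    finally have "to_fract (A * NN) / to_fract (B * DD) = to_fract E / to_fract C" .
    moreover have "to_fract C \<noteq> 0" using AB'(3) by (simp add: C_def Var_nonzero)
    moreover have "to_fract (B * DD) \<noteq> 0" using BD by simp
    ultimately have "to_fract (A * NN) * to_fract C = to_fract (B * DD) * to_fract E"
      by (metis frac_eq_eq mult.commute)
    then have "to_fract (A * NN * C) = to_fract (B * DD * E)" by simp
    then have "A * NN * C = B * DD * E" by (simp only: to_fract_eq_iff)
    moreover have "mpoly_eval x C \<noteq> 0"
      using AB'(2) chart(3) by (simp add: C_def eval_restrict_form bd flip: q_def)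
    ultimately show "\<exists>C E. A * NN * C = B * DD * E \<and> mpoly_eval x C \<noteq> 0" by blast
  qed
  then obtain G where G: "A * NN = G * (B * DD)" by blast
  note quot = mform_quotient[OF G BD AN forms]
  have d: "d1 \<ge> 0" "d2 \<ge> 0"
    using quot(2)[of First] quot(2)[of Second] by (auto simp: bidegree_def)
  have "mform (pvars n) factor_of (bidegree (nat d1) (nat d2)) G"
    by (rule mform_cong[OF quot(1)]) (use d in \<open>auto simp: bidegree_def split: factor.splits\<close>)
  moreover have "f * ?x powi d1 * ?y powi d2 = to_fract G"
    unfolding xy G using BD by simp
  ultimately show thesis using d that by blast
qed

section \<open>Multiplicity at the blown-up points\<close>

lemma X_power_dvd_cancel:
  fixes a w :: "'a::field poly"
  assumes "[:0, 1:] ^ k dvd a * w" "poly w 0 \<noteq> 0"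
  shows "[:0, 1:] ^ k dvd a"
proof (cases "a = 0")
  case False
  then have nz: "a * w \<noteq> 0" using assms(2) by auto
  have "[:-0, 1:] ^ k dvd a * w" using assms(1) by simp
  then have "k \<le> order 0 (a * w)" using nz by (simp only: order_divides) simp
  also have "\<dots> = order 0 a" using order_mult[OF nz, of 0] order_0I[OF assms(2)] by simp
  finally have "[:-0, 1:] ^ k dvd a" by (simp only: order_divides) simp
  then show ?thesis by simp
qed simp

lemma finite_block_of_bvars: "finite (block_of ` bvars n)"
proof (rule finite_subset)
  show "block_of ` bvars n \<subseteq> {Factor First, Factor Second} \<union> Exceptional ` {..<n + 3}"
  proof (rule image_subsetI)
    fix u assume u: "u \<in> bvars n"
    show "block_of u \<in> {Factor First, Factor Second} \<union> Exceptional ` {..<n + 3}"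
    proof (cases u)
      case (Base v)
      then show ?thesis by (cases "factor_of v") auto
    qed (use u in auto)
  qed
qed simp

lemma cancel_unit_factors:
  fixes f h g E K M U Q :: "'k::field"
  assumes "E = K / (M * U)" "f * h = g" "Q \<noteq> 0" "U \<noteq> 0"
  shows "f * (h * (E * Q)) * (inverse Q * U) = g * (K / M)"
proof -
  have "f * (h * (E * Q)) * (inverse Q * U) = (f * h) * (E * U) * (Q * inverse Q)"
    by (simp only: mult_ac)
  then show ?thesis using assms by simp
qed

text \<open>
  Let \<open>w\<close> be a general direction and lift the line \<open>p\<^sub>i + t w\<close> to the blow-up by dividing the coordinates of the
  \<open>i\<close>-th exceptional block by \<open>t\<close>.  The lifted line meets \<open>E\<^sub>i\<close> at \<open>t = 0\<close> in a point \<open>q\<close> where one of these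
  coordinates is not 0, so a local equation of \<open>E\<^sub>i\<close> at \<open>q\<close> restricts to \<open>t\<close> times a unit.  Regularity at \<open>q\<close>
  of \<open>G\<close> divided by the power \<open>m\<^sub>i\<close> of that equation says that this power of \<open>t\<close> divides \<open>G\<close> on the line.
\<close>

theorem section_vanishes_at_point:
  fixes p :: "nat \<times> pvar \<Rightarrow> 'a::field_char_0"
  assumes n: "n \<ge> 1" and p: "p \<in> mproj (tuple_vars n) tuple_block" and i: "i < n + 3"
    and distinct: "\<And>i'. i' < n + 3 \<Longrightarrow> i' \<noteq> i \<Longrightarrow> \<not> same_point factor_of (pt p i) (pt p i')"
    and reg: "\<And>q. q \<in> blow_up n p \<Longrightarrow> f * class_divisor n p d1 d2 m q \<in> local_ring n p q"
    and G: "mform (pvars n) factor_of (bidegree (nat d1) (nat d2)) G" and d: "d1 \<ge> 0" "d2 \<ge> 0"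
    and fG: "f * to_fract (Var (X 0)) powi d1 * to_fract (Var (Y 0)) powi d2 = to_fract G"
  shows "vanishes G (pt p i) (nat (m i))"
proof (cases "m i > 0")
  case m: True
  let ?a = "pt p i" and ?T = "[:0, 1:] :: 'a poly"
  have a: "?a \<in> PP n" by (rule tuple_PP[OF p i])
  obtain \<alpha> \<beta> where ab: "\<alpha> \<le> n" "?a (X \<alpha>) \<noteq> 0" "\<beta> \<le> n + 1" "?a (Y \<beta>) \<noteq> 0"
    using a by (auto simp: PP_iff)
  obtain j where j: "j \<le> n" "j \<noteq> \<alpha>" using n by (metis le0 zero_neq_one)
  \<comment> \<open>The derivative at \<open>t = 0\<close> of a minor along the line is a multiple of this linear form.\<close>
  define K :: "(pvar, 'a) mpoly" where "K = Const (?a (X \<alpha>)) * Var (X j) - Const (?a (X j)) * Var (X \<alpha>)"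
  show ?thesis
  proof (rule vanishes_if_lines[where K = K])
    show "K \<noteq> 0"
      by (rule mpoly_nonzero_if_eval[of "\<lambda>v. if v = X j then 1 else 0"]) (use j ab in \<open>simp add: K_def\<close>)
    fix w' :: "pvar \<Rightarrow> 'a" assume w': "mpoly_eval w' K \<noteq> 0"
    define w where "w v = (if v \<in> pvars n then w' v else 0)" for v
    have w: "?a (X \<alpha>) * w (X j) - ?a (X j) * w (X \<alpha>) \<noteq> 0" using w' ab j by (simp add: K_def w_def)
    define line where "line v = [:?a v, w v:]" for v
    define gl where "gl u = mpoly_subst (\<lambda>c. [:c:]) line (graph_coord p u)" for u
    define lift where "lift u = (if block_of u = Exceptional i then gl u div ?T else gl u)" for u
    define y where "y t v = ?a v + t * w v" for t v
    have poly_line: "poly (mpoly_subst (\<lambda>c. [:c:]) line F) t = mpoly_eval (y t) F" for F t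
      using hom_mpoly_subst[OF poly_at_hom[of t], of "\<lambda>c. [:c:]" line F]
      by (simp add: mpoly_eval_def line_def y_def[abs_def])
    have gl_poly: "poly (gl u) t = graph_point p (y t) u" for u t
      unfolding gl_def poly_line graph_point_def ..
    have y0: "y 0 = ?a" by (simp add: y_def fun_eq_iff)
    define s where "s b = (if b = Exceptional i then ?T else 1)" for b
    have gl: "gl u = s (block_of u) * lift u" for u
    proof (cases "block_of u = Exceptional i")
      case True
      then obtain j k l m where "u = Exc i j k l m" by (cases u) auto
      then have "poly (gl u) 0 = 0" unfolding gl_poly y0 by simp
      then have "?T dvd gl u" by (simp add: poly_eq_0_iff_dvd)
      then have "?T * (gl u div ?T) = gl u" by (rule dvd_mult_div_cancel)
      then show ?thesis by (simp only: s_def lift_def True simp_thms if_True)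
    qed (simp add: s_def lift_def)
    define q where "q u = poly (lift u) 0" for u
    have gl_Base: "gl (Base v) = line v" for v
      by (simp add: gl_def)
    have bd: "blow_down q = ?a"
      by (simp add: fun_eq_iff blow_down_def q_def lift_def gl_Base line_def)
    have qi: "q (Exc i j \<beta> \<alpha> \<beta>) \<noteq> 0"
    proof -
      interpret ln: comm_ring_hom "mpoly_subst (\<lambda>c. [:c:]) line"
        by (rule mpoly_subst_hom[OF const_poly_hom])
      have "gl (Exc i j \<beta> \<alpha> \<beta>) = [:?a (Y \<beta>):] * line (Y \<beta>) *
           ([:?a (X \<alpha>):] * line (X j) - [:?a (X j):] * line (X \<alpha>))"
        by (simp add: gl_def ln.hom_minus ln.hom_mult algebra_simps)
      also have "[:?a (X \<alpha>):] * line (X j) - [:?a (X j):] * line (X \<alpha>) =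
          ?T * [:?a (X \<alpha>) * w (X j) - ?a (X j) * w (X \<alpha>):]"
        by (simp add: line_def mult.commute)
      finally have "?T * lift (Exc i j \<beta> \<alpha> \<beta>) =
          ?T * ([:?a (Y \<beta>):] * line (Y \<beta>) * [:?a (X \<alpha>) * w (X j) - ?a (X j) * w (X \<alpha>):])"
        unfolding gl by (simp add: s_def mult_ac)
      then have "lift (Exc i j \<beta> \<alpha> \<beta>) =
          [:?a (Y \<beta>):] * line (Y \<beta>) * [:?a (X \<alpha>) * w (X j) - ?a (X j) * w (X \<alpha>):]"
        by (subst (asm) mult_cancel_left) auto
      then show ?thesis using ab w by (simp add: q_def line_def)
    qed
    have y_out: "y t v = 0" if "v \<notin> pvars n" for t v
      using that a by (simp add: y_def w_def PP_iff)
    have exc: "\<exists>j k l m. j \<le> n \<and> k \<le> n + 1 \<and> l \<le> n \<and> m \<le> n + 1 \<and> q (Exc i' j k l m) \<noteq> 0" if i': "i' < n + 3" for i'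
    proof (cases "i' = i")
      case True
      then show ?thesis using qi j ab by blast
    next
      case False
      obtain j k l m where "j \<le> n" "k \<le> n + 1" "l \<le> n" "m \<le> n + 1"
        "mpoly_eval ?a (graph_coord p (Exc i' j k l m)) \<noteq> 0"
        by (rule nonzero_minor[OF a tuple_PP[OF p i'] distinct[OF i' False]])
      moreover have "q (Exc i' j k l m) = mpoly_eval ?a (graph_coord p (Exc i' j k l m))" for j k l m
        unfolding q_def lift_def using False gl_poly[of "Exc i' j k l m" 0] by (simp add: y0 graph_point_def)
      ultimately show ?thesis by metis
    qed
    have q_mproj: "q \<in> mproj (bvars n) block_of"
    proof (rule mproj_bvarsI)
      fix u assume u: "u \<notin> bvars n"
      have "poly (gl u) t = 0" for t
        unfolding gl_poly by (rule graph_point_outside[OF p y_out u])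
      then have "gl u = 0" using poly_all_0_iff_0 by blast
      then show "q u = 0" by (simp add: q_def lift_def)
    next
      show "(\<lambda>v. q (Base v)) \<in> PP n" using a bd by (simp add: blow_down_def[abs_def])
    qed (rule exc)
    have scale: "mpoly_subst (\<lambda>c. [:c:]) gl B = ?T ^ e (Exceptional i) * mpoly_subst (\<lambda>c. [:c:]) lift B"
      if B: "mform (bvars n) block_of e B" for B e
    proof -
      let ?Bl = "block_of ` bvars n"
      have iBl: "Exceptional i \<in> ?Bl"
        using i by (intro image_eqI[of _ _ "Exc i 0 0 0 0"]) auto
      have "mpoly_subst (\<lambda>c. [:c:]) gl B = (\<Prod>b\<in>?Bl. s b ^ e b) * mpoly_subst (\<lambda>c. [:c:]) lift B"
        unfolding gl[abs_def] by (rule mpoly_subst_scale[OF B finite_block_of_bvars]) simp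
      also have "(\<Prod>b\<in>?Bl. s b ^ e b) = s (Exceptional i) ^ e (Exceptional i) * (\<Prod>b\<in>?Bl - {Exceptional i}. s b ^ e b)"
        by (rule prod.remove[OF finite_block_of_bvars iBl])
      also have "(\<Prod>b\<in>?Bl - {Exceptional i}. s b ^ e b) = 1"
        by (rule prod.neutral) (simp add: s_def)
      finally show ?thesis by (simp add: s_def)
    qed
    have eval_q: "poly (mpoly_subst (\<lambda>c. [:c:]) lift B) 0 = mpoly_eval q B" for B
      using hom_mpoly_subst[OF poly_at_hom[of 0], of "\<lambda>c. [:c:]" lift B] by (simp add: mpoly_eval_def q_def[abs_def])
    have "\<exists>u. \<forall>i'<n + 3. (\<exists>j k l m. u i' = Exc i' j k l m) \<and> q (u i') \<noteq> 0"
      using exc by (intro choice) metis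
    then obtain \<mu> where mu: "\<And>i'. i' < n + 3 \<Longrightarrow> \<exists>j k l m. \<mu> i' = Exc i' j k l m" "\<And>i'. i' < n + 3 \<Longrightarrow> q (\<mu> i') \<noteq> 0"
      by blast
    \<comment> \<open>Off the zeros of \<open>N\<close> the point \<open>y t\<close> of the line lies in the product and differs from all \<open>p\<^sub>i\<close>.\<close>
    define N where "N = ?T * line (X \<alpha>) * line (Y \<beta>) * (\<Prod>i'<n + 3. lift (\<mu> i'))"
    have "line (X \<alpha>) \<noteq> 0" "line (Y \<beta>) \<noteq> 0" using ab by (auto simp: line_def)
    moreover have "lift (\<mu> i') \<noteq> 0" if "i' < n + 3" for i' using mu(2)[OF that] by (auto simp: q_def)
    ultimately have N: "N \<noteq> 0" by (simp add: N_def)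
    have q: "q \<in> blow_up n p"
      unfolding blow_up_def zclosure_def hull_def
    proof (intro InterI, elim CollectE conjE)
      fix Z assume "zclosed (bvars n) block_of Z" and Z: "graph_point p ` PP n \<inter> mproj (bvars n) block_of \<subseteq> Z"
      then obtain S where S: "\<And>B. B \<in> S \<Longrightarrow> \<exists>e. mform (bvars n) block_of e B"
        "Z = {q \<in> mproj (bvars n) block_of. \<forall>B\<in>S. mpoly_eval q B = 0}"
        unfolding zclosed_def by blast
      have "mpoly_eval q B = 0" if B: "B \<in> S" for B
      proof -
        obtain e where e: "mform (bvars n) block_of e B" using S(1)[OF B] by blast
        let ?\<beta> = "mpoly_subst (\<lambda>c. [:c:]) lift B"
        have "poly (?\<beta> * N) t = 0" for t
        proof (cases "poly N t = 0")
          case False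
          then have t: "t \<noteq> 0" "y t (X \<alpha>) \<noteq> 0" "y t (Y \<beta>) \<noteq> 0" "\<And>i'. i' < n + 3 \<Longrightarrow> poly (lift (\<mu> i')) t \<noteq> 0"
          proof -
            have "poly N t = t * y t (X \<alpha>) * y t (Y \<beta>) * (\<Prod>i'<n + 3. poly (lift (\<mu> i')) t)"
              unfolding N_def poly_mult poly_prod by (simp add: line_def y_def)
            then show "t \<noteq> 0" "y t (X \<alpha>) \<noteq> 0" "y t (Y \<beta>) \<noteq> 0" "\<And>i'. i' < n + 3 \<Longrightarrow> poly (lift (\<mu> i')) t \<noteq> 0"
              using False by auto
          qed
          have yPP: "y t \<in> PP n" using t(2,3) ab y_out by (auto simp: PP_iff)
          have "\<not> same_point factor_of (y t) (pt p i')" if i': "i' < n + 3" for i'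
          proof
            assume same: "same_point factor_of (y t) (pt p i')"
            obtain j k l m where u: "\<mu> i' = Exc i' j k l m" using mu(1)[OF i'] by blast
            have "poly (gl (\<mu> i')) t = 0"
              unfolding gl_poly u graph_point_simps using minors_vanish_if_same_point[OF same] by simp
            moreover have "poly (s b) t \<noteq> 0" for b using t(1) by (simp add: s_def)
            ultimately show False using t(4)[OF i'] unfolding gl by simp
          qed
          then have "graph_point p (y t) \<in> Z"
            using Z graph_point_in_mproj[OF p yPP] yPP by blast
          then have "mpoly_eval (graph_point p (y t)) B = 0" using S(2) B by blast
          moreover have "poly (mpoly_subst (\<lambda>c. [:c:]) gl B) t = mpoly_eval (graph_point p (y t)) B"
            using hom_mpoly_subst[OF poly_at_hom[of t], of "\<lambda>c. [:c:]" gl B] by (simp add: mpoly_eval_def gl_poly)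
          ultimately have "poly (?T ^ e (Exceptional i) * ?\<beta>) t = 0" by (simp add: scale[OF e])
          then show ?thesis using t(1) by simp
        qed simp
        then have "?\<beta> * N = 0" using poly_all_0_iff_0 by blast
        then have "?\<beta> = 0" using N by simp
        then show ?thesis using eval_q[of B] by simp
      qed
      then show "q \<in> Z" using S(2) q_mproj by blast
    qed
    interpret blow_up_point n p q by unfold_locales (rule q)
    let ?\<mu> = "graph_coord p (Exc i j \<beta> \<alpha> \<beta>)"
    obtain u where u: "local_unit u" "exc_divisor n p i q = to_fract ?\<mu> / (cv First * cv Second) * u"
      by (rule exc_divisor_over_point[OF bd i j(1) ab(3) ab(1) ab(3) qi])
    define k where "k = nat (m i)"
    define v where "v = inverse (\<Prod>i'\<in>{..<n + 3} - {i}. exc_divisor n p i' q powi (- m i')) * u ^ k"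
    have "local_unit (exc_divisor n p i' q)" if "i' \<in> {..<n + 3} - {i}" for i'
      by (rule exc_divisor_unit_away[OF q tuple_PP[OF p]]) (use that distinct bd in auto)
    then have v: "local_unit v"
      unfolding v_def by (intro local_unit_mult local_unit_inverse local_unit_prod local_unit_power_int local_unit_power u)
    let ?c = "cv First ^ nat d1 * cv Second ^ nat d2"
    have \<mu>_nz: "?\<mu> \<noteq> 0"
    proof
      assume "?\<mu> = 0"
      then have "poly (gl (Exc i j \<beta> \<alpha> \<beta>)) t = 0" for t
        unfolding gl_poly graph_point_def by (simp only: \<open>?\<mu> = 0\<close> mpoly_eval_simps)
      then have "gl (Exc i j \<beta> \<alpha> \<beta>) = 0" using poly_all_0_iff_0 by blast
      then show False using qi by (simp add: q_def lift_def)
    qed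
    have "f * class_divisor n p d1 d2 m q * v = to_fract G / ?c * ((cv First * cv Second) ^ k / to_fract ?\<mu> ^ k)"
    proof -
      let ?P = "\<Prod>i'\<in>{..<n + 3} - {i}. exc_divisor n p i' q powi (- m i')"
      have prod: "(\<Prod>i'<n + 3. exc_divisor n p i' q powi (- m i')) = exc_divisor n p i q powi (- m i) * ?P"
        by (rule prod.remove) (use i in auto)
      have nz: "?P \<noteq> 0" "u ^ k \<noteq> 0" using v u by (auto simp: v_def local_unit_def)
      have E: "exc_divisor n p i q powi (- m i) = (cv First * cv Second) ^ k / (to_fract ?\<mu> ^ k * u ^ k)"
        using m by (simp add: u(2) k_def power_int_def power_inverse[symmetric] power_mult_distrib power_divide
            field_simps del: graph_coord.simps)
      have fH: "f * (H1 q powi d1 * H2 q powi d2) = to_fract G / ?c"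
        using d by (simp add: fG[symmetric] H1_chart H2_chart power_int_def power_divide mult_ac)
      show ?thesis
        unfolding class_divisor_def v_def prod by (rule cancel_unit_factors[OF E fH nz])
    qed
    moreover have "f * class_divisor n p d1 d2 m q * v \<in> LR"
      using local_ring_mult[OF reg[OF q]] v by (auto simp: local_unit_def)
    ultimately obtain A B e where AB: "to_fract G / ?c * ((cv First * cv Second) ^ k / to_fract ?\<mu> ^ k) = res A / res B"
      "mform (bvars n) block_of e A" "mform (bvars n) block_of e B" "mpoly_eval q B \<noteq> 0" "res B \<noteq> 0"
      by (metis local_ringE)
    define c1 c2 where "c1 = (Var (chart First) :: (pvar, 'a) mpoly)" and "c2 = (Var (chart Second) :: (pvar, 'a) mpoly)"
    have "to_fract G * (cv First * cv Second) ^ k * res B = res A * to_fract ?\<mu> ^ k * ?c"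
      using AB(1,5) cv_nonzero[of First] cv_nonzero[of Second] \<mu>_nz
      by (simp add: field_simps del: graph_coord.simps)
    then have "to_fract (G * (c1 * c2) ^ k * restrict_form p B) =
        to_fract (restrict_form p A * ?\<mu> ^ k * (c1 ^ nat d1 * c2 ^ nat d2))"
      by (simp add: c1_def c2_def del: graph_coord.simps)
    then have eq: "G * (c1 * c2) ^ k * restrict_form p B = restrict_form p A * ?\<mu> ^ k * (c1 ^ nat d1 * c2 ^ nat d2)"
      by (simp only: to_fract_eq_iff)
    let ?L = "mpoly_subst (\<lambda>c. [:c:]) line"
    interpret ln: comm_ring_hom ?L by (rule mpoly_subst_hom[OF const_poly_hom])
    have Lres: "?L (restrict_form p F) = ?T ^ e (Exceptional i) * mpoly_subst (\<lambda>c. [:c:]) lift F"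
      if "mform (bvars n) block_of e F" for F
      unfolding mpoly_subst_restrict_form[OF const_poly_hom] gl_def[symmetric] by (rule scale[OF that])
    have L\<mu>: "?L ?\<mu> = ?T * lift (Exc i j \<beta> \<alpha> \<beta>)"
      using gl[of "Exc i j \<beta> \<alpha> \<beta>"] by (simp add: gl_def s_def del: graph_coord.simps)
    have "?T ^ e (Exceptional i) * (?L G * ((?L c1 * ?L c2) ^ k * mpoly_subst (\<lambda>c. [:c:]) lift B)) =
       ?T ^ e (Exceptional i) * (?T ^ k * (mpoly_subst (\<lambda>c. [:c:]) lift A * lift (Exc i j \<beta> \<alpha> \<beta>) ^ k *
          (?L c1 ^ nat d1 * ?L c2 ^ nat d2)))"
      using arg_cong[OF eq, of ?L]
      unfolding ln.hom_mult ln.hom_power Lres[OF AB(2)] Lres[OF AB(3)] L\<mu> power_mult_distrib by (simp only: mult_ac)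
    then have "?L G * ((?L c1 * ?L c2) ^ k * mpoly_subst (\<lambda>c. [:c:]) lift B) =
       ?T ^ k * (mpoly_subst (\<lambda>c. [:c:]) lift A * lift (Exc i j \<beta> \<alpha> \<beta>) ^ k * (?L c1 ^ nat d1 * ?L c2 ^ nat d2))"
      by (subst (asm) mult_cancel_left) auto
    then have dvd: "?T ^ k dvd ?L G * ((?L c1 * ?L c2) ^ k * mpoly_subst (\<lambda>c. [:c:]) lift B)" by simp
    have "?T ^ k dvd ?L G"
    proof (rule X_power_dvd_cancel[OF dvd])
      show "poly ((?L c1 * ?L c2) ^ k * mpoly_subst (\<lambda>c. [:c:]) lift B) 0 \<noteq> 0"
        using AB(4) chart(3)[of First] chart(3)[of Second] by (simp add: eval_q c1_def c2_def line_def bd)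
    qed
    moreover have "?L G = mpoly_subst (\<lambda>c. [:c:]) (\<lambda>v. [:?a v, w' v:]) G"
      by (rule mpoly_subst_mform_cong[OF G]) (simp add: line_def w_def)
    ultimately show "?T ^ nat (m i) dvd mpoly_subst (\<lambda>c. [:c:]) (\<lambda>v. [:?a v, w' v:]) G"
      by (simp add: k_def)
  qed
qed simp

section \<open>The distinguished curve and its bilinear secants\<close>

lemma binary_form_scale: "binary_form a f (l * s) (l * t) = l ^ a * binary_form a f s t"
proof -
  have "coeff f j * (l * s) ^ j * (l * t) ^ (a - j) = l ^ a * (coeff f j * s ^ j * t ^ (a - j))" if "j \<le> a" for j
  proof -
    have "l ^ a = l ^ j * l ^ (a - j)" using that by (simp flip: power_add)
    then show ?thesis by (simp add: power_mult_distrib mult_ac)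
  qed
  then show ?thesis unfolding binary_form_def sum_distrib_left by (intro sum.cong) auto
qed

definition curve_degree :: "nat \<Rightarrow> factor \<Rightarrow> nat" where
  "curve_degree n b = (case b of First \<Rightarrow> n | Second \<Rightarrow> n + 1)"

lemma factor_degree_eq: "factor_degree n v = curve_degree n (factor_of v)"
  by (simp add: factor_degree_def curve_degree_def)

lemma curve_point_alt:
  "curve_point n n (n + 1) f s t v = (if v \<in> pvars n then binary_form (factor_degree n v) (f v) s t else 0)"
  unfolding curve_point_def factor_degree_def ..

lemma curve_point_scale:
  "l \<noteq> 0 \<Longrightarrow> same_point factor_of (curve_point n n (n + 1) f (l * s) (l * t)) (curve_point n n (n + 1) f s t)"
  unfolding same_point_def
  by (intro exI[of _ "\<lambda>b. l ^ curve_degree n b"])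
     (auto simp: curve_point_alt binary_form_scale factor_degree_eq simp del: One_nat_def)

text \<open>
  The curve in the affine parameter \<open>T \<mapsto> (s + T a : t + T g)\<close>.
\<close>

definition curve_line :: "nat \<Rightarrow> (pvar \<Rightarrow> 'a::field poly) \<Rightarrow> 'a \<Rightarrow> 'a \<Rightarrow> 'a \<Rightarrow> 'a \<Rightarrow> pvar \<Rightarrow> 'a poly" where
  "curve_line n f s t a g v = (if v \<in> pvars n then
     \<Sum>j\<le>factor_degree n v. Polynomial.smult (coeff (f v) j) ([:s, a:] ^ j * [:t, g:] ^ (factor_degree n v - j)) else 0)"

lemma poly_curve_line:
  "poly (curve_line n f s t a g v) T = curve_point n n (n + 1) f (s + T * a) (t + T * g) v"
  unfolding curve_point_alt by (simp add: curve_line_def binary_form_def poly_sum mult.assoc)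

lemma degree_curve_line: "degree (curve_line n f s t a g v) \<le> factor_degree n v"
proof -
  have "degree ([:s, a:] ^ j * [:t, g:] ^ (k - j)) \<le> k" if "j \<le> k" for j k
  proof -
    have "degree ([:s, a:] ^ j) \<le> j" "degree ([:t, g:] ^ (k - j)) \<le> k - j"
      by (rule order.trans[OF degree_power_le], simp)+
    then show ?thesis using that order.trans[OF degree_mult_le, of "[:s, a:] ^ j" "[:t, g:] ^ (k - j)" k] by simp
  qed
  then show ?thesis
    by (auto simp: curve_line_def intro!: degree_sum_le intro: order.trans[OF degree_smult_le])
qed

text \<open>
  Under this condition the deformations in \<open>multiplicity_along_curve\<close> reach all directions.
\<close>

definition spanning :: "nat \<Rightarrow> (nat \<Rightarrow> pvar \<Rightarrow> 'a::field) \<Rightarrow> bool" where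
  "spanning n P \<longleftrightarrow> (\<forall>w b. \<exists>g. \<forall>v\<in>pvars n. factor_of v = b \<longrightarrow> w v = (\<Sum>l<n + 2. g l * P l v))"

text \<open>
  The point \<open>(a : g)\<close> of the parameter line plays the role of infinity.  The three inequalities say that
  \<open>z\<close>, \<open>(a : g)\<close> and the parameters of the \<open>p\<^sub>i\<close> are distinct, so that in the affine parameter \<open>z\<close> is at 0 and
  the \<open>p\<^sub>i\<close> are at finite nonzero places.
\<close>

lemma curve_vanishes_generic:
  fixes f :: "pvar \<Rightarrow> 'a::field_char_0 poly"
  assumes G: "mform (pvars n) factor_of d G"
    and on: "\<And>i. i < n + 3 \<Longrightarrow> same_point factor_of (P i) (curve_point n n (n + 1) f (s i) (t i))"
    and distinct: "\<And>i j. i < n + 3 \<Longrightarrow> j < n + 3 \<Longrightarrow> i \<noteq> j \<Longrightarrow> \<not> same_point factor_of (P i) (P j)"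
    and span: "spanning n P"
    and van: "\<And>i. i < n + 3 \<Longrightarrow> vanishes G (P i) (M i)"
    and PQ: "s0 * g - t0 * a \<noteq> 0" and Pi: "\<And>i. i < n + 3 \<Longrightarrow> s0 * t i - t0 * s i \<noteq> 0"
    and Qi: "\<And>i. i < n + 3 \<Longrightarrow> s i * g - t i * a \<noteq> 0"
  shows "vanishes G (curve_point n n (n + 1) f s0 t0)
     (nat (int (\<Sum>i<n + 3. M i) - int n * int (d First) - (int n + 1) * int (d Second)))"
proof -
  let ?cp = "curve_point n n (n + 1) f"
  define \<tau> where "\<tau> i = (s0 * t i - t0 * s i) / (s i * g - t i * a)" for i
  define \<mu> where "\<mu> i = (s0 * g - t0 * a) / (s i * g - t i * a)" for i
  define c where "c = curve_line n f s0 t0 a g"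
  \<comment> \<open>Cramer's rule expresses the parameter of \<open>p\<^sub>i\<close> in the basis formed by the two chosen parameters.\<close>
  have cramer: "s0 + \<tau> i * a = \<mu> i * s i" "t0 + \<tau> i * g = \<mu> i * t i" if "i < n + 3" for i
    using Qi[OF that] by (simp_all add: \<tau>_def \<mu>_def divide_simps) (simp_all add: algebra_simps)
  have \<mu>_nz: "\<mu> i \<noteq> 0" if "i < n + 3" for i using PQ Qi[OF that] by (simp add: \<mu>_def)
  have c_at: "(\<lambda>v. poly (c v) (\<tau> i)) = ?cp (\<mu> i * s i) (\<mu> i * t i)" if "i < n + 3" for i
    by (simp add: c_def poly_curve_line cramer[OF that] fun_eq_iff)
  have same: "same_point factor_of (\<lambda>v. poly (c v) (\<tau> i)) (P i)" if i: "i < n + 3" for i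
    unfolding c_at[OF i]
    by (rule same_point_trans[OF curve_point_scale[OF \<mu>_nz[OF i]] same_point_sym[OF on[OF i]]])
  have "vanishes G (\<lambda>v. poly (c v) 0)
     (nat (int (\<Sum>i<n + 3. M i) - int n * int (d First) - (int n + 1) * int (d Second)))"
  proof (rule multiplicity_along_curve[OF G])
    show "degree (c v) \<le> factor_degree n v" for v
      unfolding c_def by (rule degree_curve_line)
    show "inj_on \<tau> {..<n + 3}"
    proof (rule inj_onI, rule ccontr)
      fix i j assume ij: "i \<in> {..<n + 3}" "j \<in> {..<n + 3}" "\<tau> i = \<tau> j" "i \<noteq> j"
      have "same_point factor_of (P i) (P j)"
        using same_point_trans[OF same_point_sym[OF same[of i]], of "P j"] same[of j] ij by simp
      then show False using distinct ij by simp
    qed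
    show "\<tau> l \<noteq> 0" if "l < n + 2" for l using that Pi[of l] Qi[of l] by (simp add: \<tau>_def)
    show "vanishes G (\<lambda>v. poly (c v) (\<tau> i)) (M i)" if "i < n + 3" for i
      by (rule vanishes_same_point[OF G finite_pvars same[OF that] van[OF that]])
    fix w b
    obtain h where h: "\<And>v. v \<in> pvars n \<Longrightarrow> factor_of v = b \<Longrightarrow> w v = (\<Sum>l<n + 2. h l * P l v)"
      using span unfolding spanning_def by meson
    have "\<exists>k. \<forall>l<n + 3. \<forall>v. P l v = k l (factor_of v) * poly (c v) (\<tau> l)"
    proof (rule choice, rule allI)
      fix l show "\<exists>k. l < n + 3 \<longrightarrow> (\<forall>v. P l v = k (factor_of v) * poly (c v) (\<tau> l))"
        using same_point_sym[OF same[of l]] by (auto simp: same_point_def)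
    qed
    then obtain k where k: "\<And>l v. l < n + 3 \<Longrightarrow> P l v = k l (factor_of v) * poly (c v) (\<tau> l)" by blast
    show "\<exists>g. \<forall>v\<in>pvars n. factor_of v = b \<longrightarrow> w v = (\<Sum>l<n + 2. g l * poly (c v) (\<tau> l))"
    proof (intro exI[of _ "\<lambda>l. h l * k l b"] ballI impI)
      fix v assume v: "v \<in> pvars n" "factor_of v = b"
      have "w v = (\<Sum>l<n + 2. h l * P l v)" by (rule h[OF v])
      also have "\<dots> = (\<Sum>l<n + 2. h l * k l b * poly (c v) (\<tau> l))"
        by (rule sum.cong) (auto simp: k v(2))
      finally show "w v = (\<Sum>l<n + 2. h l * k l b * poly (c v) (\<tau> l))" .
    qed
  qed
  moreover have "(\<lambda>v. poly (c v) 0) = ?cp s0 t0"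
    by (simp add: c_def poly_curve_line fun_eq_iff)
  ultimately show ?thesis by simp
qed

text \<open>
  At the points \<open>p\<^sub>i\<close> of the curve the deformation argument breaks down.  But a Hasse derivative of \<open>G\<close>, restricted to
  the curve, is a polynomial in the parameter; it vanishes at all but finitely many places, hence everywhere.
\<close>

theorem form_vanishes_on_curve:
  fixes p :: "nat \<times> pvar \<Rightarrow> 'a::field_char_0"
  assumes G: "mform (pvars n) factor_of d G"
    and C: "distinguished_curve n p C"
    and distinct: "\<And>i j. i < n + 3 \<Longrightarrow> j < n + 3 \<Longrightarrow> i \<noteq> j \<Longrightarrow> \<not> same_point factor_of (pt p i) (pt p j)"
    and span: "spanning n (pt p)"
    and van: "\<And>i. i < n + 3 \<Longrightarrow> vanishes G (pt p i) (M i)"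
    and z: "z \<in> C"
  shows "vanishes G z (nat (int (\<Sum>i<n + 3. M i) - int n * int (d First) - (int n + 1) * int (d Second)))"
    (is "vanishes G z ?r")
proof -
  obtain f where C_eq: "C = {x \<in> PP n. \<exists>s t. (s, t) \<noteq> (0, 0) \<and> same_point factor_of x (curve_point n n (n + 1) f s t)}"
    using C unfolding distinguished_curve_def rational_curve_def by blast
  let ?cp = "curve_point n n (n + 1) f"
  have "\<exists>st. \<forall>i<n + 3. st i \<noteq> (0, 0) \<and> same_point factor_of (pt p i) (?cp (fst (st i)) (snd (st i)))"
  proof (rule choice, rule allI)
    fix i show "\<exists>st. i < n + 3 \<longrightarrow> st \<noteq> (0, 0) \<and> same_point factor_of (pt p i) (?cp (fst st) (snd st))"
      using C unfolding distinguished_curve_def C_eq by fastforce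
  qed
  then obtain st where st: "\<And>i. i < n + 3 \<Longrightarrow> st i \<noteq> (0, 0)"
    "\<And>i. i < n + 3 \<Longrightarrow> same_point factor_of (pt p i) (?cp (fst (st i)) (snd (st i)))" by blast
  define s t where "s = (\<lambda>i. fst (st i))" and "t = (\<lambda>i. snd (st i))"
  have st_nz: "s i \<noteq> 0 \<or> t i \<noteq> 0" if "i < n + 3" for i
    using st(1)[OF that] by (auto simp: s_def t_def prod_eq_iff)
  obtain s0 t0 where s0: "(s0, t0) \<noteq> (0, 0)" and same: "same_point factor_of z (?cp s0 t0)"
    using z C_eq by blast
  have "[:- t0, s0:] \<noteq> 0" using s0 by auto
  moreover have "(\<Prod>i<n + 3. [:- t i, s i:]) \<noteq> 0" using st_nz by (subst prod_zero_iff) auto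
  ultimately have "[:- t0, s0:] * (\<Prod>i<n + 3. [:- t i, s i:]) \<noteq> 0"
    by (simp only: mult_eq_0_iff simp_thms)
  then obtain y where y: "poly ([:- t0, s0:] * (\<Prod>i<n + 3. [:- t i, s i:])) y \<noteq> 0"
    using poly_all_0_iff_0 by blast
  have Q: "s0 * y - t0 * 1 \<noteq> 0" "\<And>i. i < n + 3 \<Longrightarrow> s i * y - t i * 1 \<noteq> 0"
    using y unfolding poly_mult poly_prod by (auto simp: mult.commute)
  \<comment> \<open>The zeros of \<open>N\<close> are the places of the \<open>p\<^sub>i\<close>; infinity is \<open>(1 : y)\<close>.\<close>
  define N where "N = (\<Prod>i<n + 3. [:s0 * t i - t0 * s i, t i - y * s i:])"
  have "[:s0 * t i - t0 * s i, t i - y * s i:] \<noteq> 0" if "i < n + 3" for i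
    using Q(2)[OF that] by (auto simp: mult.commute)
  then have N: "N \<noteq> 0" by (simp add: N_def)
  define c where "c = curve_line n f s0 t0 1 y"
  have c_poly: "poly (c v) T = ?cp (s0 + T) (t0 + T * y) v" for v T
    by (simp add: c_def poly_curve_line)
  have "vanishes G (?cp s0 t0) ?r"
    unfolding vanishes_def
  proof (intro allI impI)
    fix \<alpha> :: "pvar \<Rightarrow>\<^sub>0 nat" assume \<alpha>: "deg \<alpha> < ?r"
    let ?H = "mpoly_subst (\<lambda>c. [:c:]) c (hasse \<alpha> G)"
    have H: "poly ?H T = mpoly_eval (?cp (s0 + T) (t0 + T * y)) (hasse \<alpha> G)" for T
      using hom_mpoly_subst[OF poly_at_hom[of T], of "\<lambda>c. [:c:]" c "hasse \<alpha> G"]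
      by (simp add: mpoly_eval_def c_poly[abs_def])
    have "poly (?H * N) T = 0" for T
    proof (cases "poly N T = 0")
      case False
      have Pi: "(s0 + T) * t i - (t0 + T * y) * s i \<noteq> 0" if "i < n + 3" for i
      proof -
        have "poly N T = (\<Prod>i<n + 3. (s0 + T) * t i - (t0 + T * y) * s i)"
          unfolding N_def poly_prod by (rule prod.cong) (simp_all add: algebra_simps)
        then show ?thesis using False that by simp
      qed
      have "vanishes G (?cp (s0 + T) (t0 + T * y)) ?r"
      proof (rule curve_vanishes_generic[OF G _ distinct span van _ Pi])
        show "same_point factor_of (pt p i) (?cp (s i) (t i))" if "i < n + 3" for i
          using st(2)[OF that] by (simp add: s_def t_def)
        show "(s0 + T) * y - (t0 + T * y) * 1 \<noteq> 0" using Q(1) by (simp add: algebra_simps)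
        show "s i * y - t i * 1 \<noteq> 0" if "i < n + 3" for i using Q(2)[OF that] .
      qed
      then show ?thesis using \<alpha> H[of T] by (simp add: vanishes_def)
    qed simp
    then have "?H * N = 0" using poly_all_0_iff_0 by blast
    then have "?H = 0" using N by simp
    then show "mpoly_eval (?cp s0 t0) (hasse \<alpha> G) = 0" using H[of 0] by simp
  qed
  then show ?thesis by (rule vanishes_same_point[OF G finite_pvars same])
qed

theorem form_vanishes_on_BS:
  fixes G :: "(pvar, 'a::field_char_0) mpoly"
  assumes G: "mform (pvars n) factor_of d G" and k: "k \<ge> 1"
    and C: "\<And>z. z \<in> C \<Longrightarrow> vanishes G z r"
  shows "BS n k C \<subseteq> {x \<in> PP n. \<forall>F\<in>{hasse \<alpha> G | \<alpha>. deg \<alpha> < k * r - (k - 1) * (d First + d Second)}. mpoly_eval x F = 0}"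
  unfolding BS_def
proof (rule zclosure_subset[OF _ zclosedI])
  fix F assume "F \<in> {hasse \<alpha> G | \<alpha>. deg \<alpha> < k * r - (k - 1) * (d First + d Second)}"
  then show "\<exists>e. mform (pvars n) factor_of e F" using hasse_mform[OF G] by blast
next
  have "vanishes G x (k * r - (k - 1) * (d First + d Second))"
    if z: "\<And>i. i < k \<Longrightarrow> z i \<in> C" and x: "x \<in> bilinear_span n k z" for x z
  proof -
    have "\<exists>a. \<forall>b. \<forall>v\<in>pvars n. factor_of v = b \<longrightarrow> x v = (\<Sum>i<k. a b i * z i v)"
      using x unfolding bilinear_span_def by (intro choice) blast
    then obtain a where a: "\<And>v. v \<in> pvars n \<Longrightarrow> x v = (\<Sum>i<k. a (factor_of v) i * z i v)" by blast
    have B: "factor_of ` pvars n \<subseteq> {First, Second}" using factor.exhaust by blast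
    have "vanishes G x (k * r - (k - 1) * (\<Sum>b\<in>{First, Second}. d b))"
      by (rule multiplicity_along_span[OF G finite_pvars _ B C[OF z] a k]) auto
    then show ?thesis by simp
  qed
  then show "(\<Union>z\<in>{z. (\<forall>i<k. z i \<in> C) \<and> general_points n k z}. bilinear_span n k z)
    \<subseteq> {x \<in> PP n. \<forall>F\<in>{hasse \<alpha> G | \<alpha>. deg \<alpha> < k * r - (k - 1) * (d First + d Second)}. mpoly_eval x F = 0}"
    unfolding vanishes_def by (auto simp: bilinear_span_def)
qed

section \<open>The strict transform\<close>

lemma strict_transform_blow_up: "strict_transform n p V \<subseteq> blow_up n p"
proof -
  have "strict_transform n p V \<subseteq> zclosure (bvars n) block_of (blow_up n p)"
    unfolding strict_transform_def by (rule zclosure_mono) auto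
  also have "\<dots> = blow_up n p"
    unfolding blow_up_def zclosure_def by simp
  finally show ?thesis .
qed

text \<open>
  The complement of the exceptional divisors, as an open subset of the ambient multiprojective space.
\<close>

definition away :: "nat \<Rightarrow> (nat \<times> pvar \<Rightarrow> 'a::field) \<Rightarrow> (bvar \<Rightarrow> 'a) set" where
  "away n p = {q \<in> mproj (bvars n) block_of. \<forall>i<n + 3. \<not> same_point factor_of (blow_down q) (pt p i)}"

text \<open>
  A point lies over some \<open>p\<^sub>i\<close> iff all products of one minor for each index \<open>i\<close> vanish at it.
\<close>

lemma zopen_away:
  assumes p: "p \<in> mproj (tuple_vars n) tuple_block"
  shows "zopen (bvars n) block_of (away n p)"
proof -
  define idx where "idx = {c :: nat \<Rightarrow> bvar. \<forall>i<n + 3. \<exists>j k l m. j \<le> n \<and> k \<le> n + 1 \<and> l \<le> n \<and> m \<le> n + 1 \<and> c i = Exc i j k l m}"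
  define S where "S = (\<lambda>c. \<Prod>i<n + 3. pullback (graph_coord p (c i))) ` idx"
  have "mproj (bvars n) block_of - away n p = {q \<in> mproj (bvars n) block_of. \<forall>F\<in>S. mpoly_eval q F = 0}"
  proof (intro equalityI subsetI)
    fix q assume q: "q \<in> mproj (bvars n) block_of - away n p"
    then obtain i where i: "i < n + 3" "same_point factor_of (blow_down q) (pt p i)" by (auto simp: away_def)
    have "mpoly_eval q (\<Prod>i<n + 3. pullback (graph_coord p (c i))) = 0" if cidx: "c \<in> idx" for c
    proof -
      obtain j k l m where c: "c i = Exc i j k l m" using cidx i(1) unfolding idx_def by blast
      have "mpoly_eval (blow_down q) (graph_coord p (c i)) = 0"
        unfolding c using minors_vanish_if_same_point[OF i(2)] by simp
      then show ?thesis using i(1) by auto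
    qed
    then show "q \<in> {q \<in> mproj (bvars n) block_of. \<forall>F\<in>S. mpoly_eval q F = 0}" using q by (auto simp: S_def)
  next
    fix q assume q: "q \<in> {q \<in> mproj (bvars n) block_of. \<forall>F\<in>S. mpoly_eval q F = 0}"
    then have bq: "blow_down q \<in> PP n" by (auto intro: blow_down_PP)
    have "q \<notin> away n p"
    proof
      assume "q \<in> away n p"
      then have aw: "\<not> same_point factor_of (blow_down q) (pt p i)" if "i < n + 3" for i
        using that by (auto simp: away_def)
      have "\<exists>c. \<forall>i<n + 3. (\<exists>j k l m. j \<le> n \<and> k \<le> n + 1 \<and> l \<le> n \<and> m \<le> n + 1 \<and> c i = Exc i j k l m) \<and>
         mpoly_eval (blow_down q) (graph_coord p (c i)) \<noteq> 0"
      proof (rule choice, rule allI)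
        fix i
        show "\<exists>u. i < n + 3 \<longrightarrow> (\<exists>j k l m. j \<le> n \<and> k \<le> n + 1 \<and> l \<le> n \<and> m \<le> n + 1 \<and> u = Exc i j k l m) \<and>
           mpoly_eval (blow_down q) (graph_coord p u) \<noteq> 0"
        proof (cases "i < n + 3")
          case True
          show ?thesis by (rule nonzero_minor[OF bq tuple_PP[OF p True] aw[OF True]]) blast
        qed simp
      qed
      then obtain c where c: "c \<in> idx" "\<And>i. i < n + 3 \<Longrightarrow> mpoly_eval (blow_down q) (graph_coord p (c i)) \<noteq> 0"
        unfolding idx_def by blast
      then have "mpoly_eval q (\<Prod>i<n + 3. pullback (graph_coord p (c i))) \<noteq> 0" by simp
      then show False using q c(1) by (auto simp: S_def)
    qed
    then show "q \<in> mproj (bvars n) block_of - away n p" using q by simp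
  qed
  moreover have "zclosed (bvars n) block_of {q \<in> mproj (bvars n) block_of. \<forall>F\<in>S. mpoly_eval q F = 0}"
  proof (rule zclosedI)
    fix F assume "F \<in> S"
    then obtain c where c: "c \<in> idx" "F = (\<Prod>i<n + 3. pullback (graph_coord p (c i)))" by (auto simp: S_def)
    have each: "mform (bvars n) block_of (pullback_degree (\<lambda>_. 1)) (pullback (graph_coord p (c i)))" if i: "i < n + 3" for i
    proof -
      obtain j k l m where "j \<le> n" "k \<le> n + 1" "l \<le> n" "m \<le> n + 1" "c i = Exc i j k l m"
        using c(1) i unfolding idx_def by blast
      then show ?thesis using mform_pullback[OF mform_minor] by metis
    qed
    have "mform (bvars n) block_of (\<lambda>b. \<Sum>i<n + 3. pullback_degree (\<lambda>_. 1) b) F"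
      unfolding c(2) by (rule mform_prod) (use each in auto)
    then show "\<exists>d. mform (bvars n) block_of d F" by blast
  qed
  ultimately show ?thesis unfolding zopen_def by (auto simp: away_def)
qed

lemma strict_transform_dense:
  "strict_transform n p V \<subseteq> zclosure (bvars n) block_of (strict_transform n p V \<inter> away n p)"
proof -
  let ?S = "{q \<in> blow_up n p. blow_down q \<in> V \<and> (\<forall>i<n + 3. \<not> same_point factor_of (blow_down q) (pt p i))}"
  have "?S \<subseteq> strict_transform n p V \<inter> away n p"
    using zclosure_increasing[of ?S "bvars n" block_of] blow_up_subset_mproj[of n p]
    by (auto simp: strict_transform_def away_def)
  from zclosure_mono[OF this, of "bvars n" block_of] show ?thesis
    unfolding strict_transform_def[of n p V, symmetric] .
qed

lemma strict_transform_forms: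
  assumes V: "V \<subseteq> {x \<in> PP n. \<forall>F\<in>S. mpoly_eval x F = 0}" and S: "\<And>F. F \<in> S \<Longrightarrow> \<exists>d. mform (pvars n) factor_of d F"
    and q: "q \<in> strict_transform n p V" and F: "F \<in> S"
  shows "mpoly_eval (blow_down q) F = 0"
proof -
  have "strict_transform n p V \<subseteq> {q \<in> mproj (bvars n) block_of. \<forall>F\<in>pullback ` S. mpoly_eval q F = 0}"
    unfolding strict_transform_def
  proof (rule zclosure_subset[OF _ zclosedI])
    fix F' assume "F' \<in> pullback ` S"
    then show "\<exists>d. mform (bvars n) block_of d F'" using S mform_pullback by blast
  qed (use V blow_up_subset_mproj[of n p] in auto)
  then show ?thesis using q F by fastforce
qed

lemma divisor_multiplicity:
  fixes q :: "bvar \<Rightarrow> 'a::field_char_0"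
  assumes p: "p \<in> mproj (tuple_vars n) tuple_block" and qq: "q \<in> blow_up n p" "q \<in> away n p"
    and G: "mform (pvars n) factor_of (bidegree (nat d1) (nat d2)) G" and d: "d1 \<ge> 0" "d2 \<ge> 0"
    and fG: "f * to_fract (Var (X 0)) powi d1 * to_fract (Var (Y 0)) powi d2 = to_fract G"
    and van: "vanishes G (blow_down q) r"
  shows "f * class_divisor n p d1 d2 m q \<in> max_ideal_power n p q r"
proof -
  interpret blow_up_point n p q by unfold_locales (rule qq)
  let ?u = "\<Prod>i<n + 3. exc_divisor n p i q powi (- m i)"
  have "local_unit ?u"
  proof (intro local_unit_prod local_unit_power_int)
    fix i assume "i \<in> {..<n + 3}"
    then show "local_unit (exc_divisor n p i q)"
      by (intro exc_divisor_unit_away[OF qq(1) tuple_PP[OF p]]) (use qq(2) in \<open>auto simp: away_def\<close>)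
  qed
  then have u: "?u \<in> max_ideal_power n p q 0" by (simp add: local_unit_def)
  have "f * class_divisor n p d1 d2 m q = to_fract G / (cv First ^ nat d1 * cv Second ^ nat d2) * ?u"
    using d by (simp add: class_divisor_def fG[symmetric] H1_chart H2_chart power_int_def power_divide mult_ac)
  also have "\<dots> \<in> max_ideal_power n p q (r + 0)"
    by (rule filtrationD(4)[OF filtration_max_ideal_power _ u])
       (use form_in_max_ideal_power[OF G van] in \<open>simp add: bidegree_def\<close>)
  finally show ?thesis by simp
qed

section \<open>Points in general position\<close>

definition coord_mat :: "nat \<Rightarrow> (nat \<Rightarrow> pvar) \<Rightarrow> (nat \<times> pvar \<Rightarrow> 'r) \<Rightarrow> 'r mat" where
  "coord_mat N c p = mat N N (\<lambda>(i, j). p (i, c j))"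

definition coord_det :: "nat \<Rightarrow> (nat \<Rightarrow> pvar) \<Rightarrow> (nat \<times> pvar, 'a::comm_ring_1) mpoly" where
  "coord_det N c = det (coord_mat N c Var)"

lemma eval_coord_det: "mpoly_eval p (coord_det N c) = det (coord_mat N c p)"
proof -
  interpret ev: comm_ring_hom "mpoly_eval p" by (rule mpoly_eval_hom)
  have "map_mat (mpoly_eval p) (coord_mat N c Var) = coord_mat N c p"
    by (rule eq_matI) (auto simp: coord_mat_def)
  then show ?thesis by (simp add: coord_det_def flip: ev.hom_det)
qed

lemma coord_det_mform:
  assumes "\<And>i j. i < N \<Longrightarrow> j < N \<Longrightarrow> (i, c j) \<in> Vs" "\<And>i j. i < N \<Longrightarrow> j < N \<Longrightarrow> blk (i, c j) = b i"
  shows "\<exists>d. mform Vs blk d (coord_det N c :: (nat \<times> pvar, 'a::comm_ring_1) mpoly)"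
proof -
  let ?d = "\<lambda>u. \<Sum>i\<in>{0..<N}. of_bool (b i = u) :: nat"
  have "coord_det N c = (\<Sum>\<pi> \<in> {\<pi>. \<pi> permutes {0..<N}}. signof \<pi> *
      (\<Prod>i\<in>{0..<N}. coord_mat N c (Var :: _ \<Rightarrow> (nat \<times> pvar, 'a) mpoly) $$ (i, \<pi> i)))"
    unfolding coord_det_def by (rule det_def') (simp add: coord_mat_def)
  also have "mform Vs blk ?d \<dots>"
  proof (rule mform_sum)
    fix \<pi> assume "\<pi> \<in> {\<pi>. \<pi> permutes {0..<N}}"
    then have \<pi>: "\<pi> i < N" if "i < N" for i using that permutes_in_image[of \<pi> "{0..<N}" i] by auto
    have "mform Vs blk ?d (\<Prod>i\<in>{0..<N}. coord_mat N c (Var :: _ \<Rightarrow> (nat \<times> pvar, 'a) mpoly) $$ (i, \<pi> i))"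
    proof (rule mform_prod)
      fix i assume "i \<in> {0..<N}"
      then have i: "i < N" "\<pi> i < N" using \<pi> by auto
      show "mform Vs blk (\<lambda>u. of_bool (b i = u)) (coord_mat N c (Var :: _ \<Rightarrow> (nat \<times> pvar, 'a) mpoly) $$ (i, \<pi> i))"
        using mform_Var[of "(i, c (\<pi> i))" Vs blk] assms[OF i] i by (simp add: coord_mat_def)
    qed
    moreover have "mform Vs blk (\<lambda>_. 0) (signof \<pi> :: (nat \<times> pvar, 'a) mpoly)"
      using mform_1[of Vs blk] mform_diff[OF mform_0 mform_1, of Vs blk]
      by (cases "evenperm \<pi>") (simp_all add: sign_def)
    ultimately show "mform Vs blk ?d (signof \<pi> * (\<Prod>i\<in>{0..<N}. coord_mat N c (Var :: _ \<Rightarrow> (nat \<times> pvar, 'a) mpoly) $$ (i, \<pi> i)))"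
      using mform_mult[of Vs blk "\<lambda>_. 0" _ ?d] by simp
  qed
  finally show ?thesis by blast
qed

text \<open>
  The coefficients \<open>g\<close> come from the adjugate of the transposed matrix.
\<close>

lemma span_if_det:
  fixes p :: "nat \<times> pvar \<Rightarrow> 'a::field"
  assumes "det (coord_mat N c p) \<noteq> 0"
  obtains g where "\<And>j. j < N \<Longrightarrow> w j = (\<Sum>l<N. g l * p (l, c j))"
proof
  let ?A = "coord_mat N c p"
  let ?T = "transpose_mat ?A"
  have A: "?A \<in> carrier_mat N N" by (simp add: coord_mat_def)
  then have T: "?T \<in> carrier_mat N N" by simp
  note adj = adj_mat[OF T]
  define v where "v = (1 / det ?A) \<cdot>\<^sub>v (adj_mat ?T *\<^sub>v vec N w)"
  have v: "v \<in> carrier_vec N" using adj by (simp add: v_def)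
  have "?T *\<^sub>v v = (1 / det ?A) \<cdot>\<^sub>v (?T *\<^sub>v (adj_mat ?T *\<^sub>v vec N w))"
    unfolding v_def by (rule mult_mat_vec[OF T]) (use adj in auto)
  also have "?T *\<^sub>v (adj_mat ?T *\<^sub>v vec N w) = (?T * adj_mat ?T) *\<^sub>v vec N w"
    by (rule assoc_mult_mat_vec[OF T adj(1), symmetric]) simp
  also have "\<dots> = det ?A \<cdot>\<^sub>v vec N w"
    using adj(2) det_transpose[OF A] by auto
  also have "(1 / det ?A) \<cdot>\<^sub>v (det ?A \<cdot>\<^sub>v vec N w) = vec N w"
    using assms by (simp add: smult_smult_assoc)
  finally have eq: "?T *\<^sub>v v = vec N w" .
  fix j assume j: "j < N"
  have "w j = (?T *\<^sub>v v) $ j" using j eq by simp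
  also have "\<dots> = (\<Sum>l\<in>{0..<N}. p (l, c j) * v $ l)"
    using j A v by (simp add: scalar_prod_def coord_mat_def)
  finally show "w j = (\<Sum>l<N. (v $ l) * p (l, c j))"
    by (simp add: mult.commute lessThan_atLeast0)
qed

text \<open>
  A second column for the minor that tells the points \<open>i < j\<close> apart.  It is chosen such that the minor is 1 for the
  tuple of coordinate points completed by points with all coordinates 1.
\<close>

definition other_index :: "nat \<Rightarrow> nat \<Rightarrow> nat \<Rightarrow> nat" where
  "other_index n i j = (if j < n + 2 then j else if i = 0 then 1 else 0)"

definition pair_minor :: "nat \<Rightarrow> nat \<Rightarrow> nat \<Rightarrow> (nat \<times> pvar, 'a::comm_ring_1) mpoly" where
  "pair_minor n i j = Var (i, Y i) * Var (j, Y (other_index n i j)) - Var (i, Y (other_index n i j)) * Var (j, Y i)"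

text \<open>
  A tuple is general enough if the first \<open>n + 1\<close> points are independent in the first factor, the first
  \<open>n + 2\<close> points are independent in the second factor, and the points are distinct.  The last condition is
  replaced by the nonvanishing of one minor for each pair, which suffices for it.
\<close>

definition general_form :: "nat \<Rightarrow> (nat \<times> pvar, 'a::comm_ring_1) mpoly" where
  "general_form n = coord_det (n + 1) X * coord_det (n + 2) Y * (\<Prod>j<n + 3. \<Prod>i<j. pair_minor n i j)"

lemma general_form_mform: "\<exists>d. mform (tuple_vars n) tuple_block d (general_form n :: (nat \<times> pvar, 'a::comm_ring_1) mpoly)"
proof -
  have X: "\<exists>d. mform (tuple_vars n) tuple_block d (coord_det (n + 1) X :: (nat \<times> pvar, 'a) mpoly)"
    by (rule coord_det_mform[where b = "\<lambda>i. (i, First)"]) (auto simp: tuple_vars_def tuple_block_def)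
  have Y: "\<exists>d. mform (tuple_vars n) tuple_block d (coord_det (n + 2) Y :: (nat \<times> pvar, 'a) mpoly)"
    by (rule coord_det_mform[where b = "\<lambda>i. (i, Second)"]) (auto simp: tuple_vars_def tuple_block_def)
  have M: "mform (tuple_vars n) tuple_block (\<lambda>b. of_bool ((i, Second) = b) + of_bool ((j, Second) = b))
      (pair_minor n i j :: (nat \<times> pvar, 'a) mpoly)" if "i < j" "j < n + 3" for i j
  proof -
    have o: "other_index n i j \<le> n + 1" using that by (auto simp: other_index_def)
    have V: "mform (tuple_vars n) tuple_block (\<lambda>b. of_bool ((i, Second) = b)) (Var (i, Y k) :: (nat \<times> pvar, 'a) mpoly)"
      if "i < n + 3" "k \<le> n + 1" for i k
      by (rule mform_cong[OF mform_Var]) (use that in \<open>auto simp: tuple_vars_def tuple_block_def\<close>)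
    show ?thesis
      unfolding pair_minor_def by (intro mform_diff mform_mult V) (use that o in auto)
  qed
  obtain dX dY where "mform (tuple_vars n) tuple_block dX (coord_det (n + 1) X :: (nat \<times> pvar, 'a) mpoly)"
    "mform (tuple_vars n) tuple_block dY (coord_det (n + 2) Y :: (nat \<times> pvar, 'a) mpoly)" using X Y by blast
  moreover have "mform (tuple_vars n) tuple_block
      (\<lambda>b. \<Sum>j<n + 3. \<Sum>i<j. of_bool ((i, Second) = b) + of_bool ((j, Second) = b))
      (\<Prod>j<n + 3. \<Prod>i<j. pair_minor n i j :: (nat \<times> pvar, 'a) mpoly)"
    by (intro mform_prod M) auto
  ultimately show ?thesis unfolding general_form_def using mform_mult by blast
qed

definition general_tuples :: "nat \<Rightarrow> (nat \<times> pvar \<Rightarrow> 'a::field) set" where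
  "general_tuples n = {p \<in> mproj (tuple_vars n) tuple_block. mpoly_eval p (general_form n) \<noteq> 0}"

lemma zopen_general_tuples: "zopen (tuple_vars n) tuple_block (general_tuples n :: (nat \<times> pvar \<Rightarrow> 'a::field) set)"
proof -
  have "mproj (tuple_vars n) tuple_block - general_tuples n =
     {p \<in> mproj (tuple_vars n) tuple_block. \<forall>F\<in>{general_form n}. mpoly_eval p F = (0 :: 'a)}"
    by (auto simp: general_tuples_def)
  moreover have "zclosed (tuple_vars n) tuple_block \<dots>"
    by (rule zclosedI) (use general_form_mform in auto)
  ultimately show ?thesis by (auto simp: zopen_def general_tuples_def)
qed

text \<open>
  The first points of the tuple are the coordinate points of each factor; in the remaining points all
  coordinates are 1.
\<close>

lemma general_tuples_nonempty:
  assumes "n \<ge> 1"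
  shows "general_tuples n \<noteq> ({} :: (nat \<times> pvar \<Rightarrow> 'a::field) set)"
proof -
  define p :: "nat \<times> pvar \<Rightarrow> 'a" where
    "p = (\<lambda>(i, v). if (i, v) \<in> tuple_vars n then
        (case v of X j \<Rightarrow> of_bool (i = j \<or> i \<ge> n + 1) | Y k \<Rightarrow> of_bool (i = k \<or> i \<ge> n + 2)) else 0)"
  have pX: "p (i, X j) = of_bool (i = j \<or> i \<ge> n + 1)" if "i < n + 3" "j \<le> n" for i j
    using that by (simp add: p_def tuple_vars_def)
  have pY: "p (i, Y k) = of_bool (i = k \<or> i \<ge> n + 2)" if "i < n + 3" "k \<le> n + 1" for i k
    using that by (simp add: p_def tuple_vars_def)
  have "p \<in> mproj (tuple_vars n) tuple_block"
    unfolding mproj_def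
  proof (intro CollectI conjI allI impI ballI)
    show "p u = 0" if "u \<notin> tuple_vars n" for u using that by (cases u) (auto simp: p_def)
    fix b assume "b \<in> tuple_block ` tuple_vars n"
    then obtain i v where b: "b = (i, factor_of v)" "i < n + 3" by (auto simp: tuple_vars_def tuple_block_def)
    show "\<exists>u\<in>tuple_vars n. tuple_block u = b \<and> p u \<noteq> 0"
    proof (cases "factor_of v")
      case First
      then show ?thesis using b pX[of i "if i \<le> n then i else 0"]
        by (intro bexI[of _ "(i, X (if i \<le> n then i else 0))"]) (auto simp: tuple_block_def tuple_vars_def)
    next
      case Second
      then show ?thesis using b pY[of i "if i \<le> n + 1 then i else 0"]
        by (intro bexI[of _ "(i, Y (if i \<le> n + 1 then i else 0))"]) (auto simp: tuple_block_def tuple_vars_def)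
    qed
  qed
  moreover have "coord_mat (n + 1) X p = 1\<^sub>m (n + 1)"
    by (rule eq_matI) (auto simp: coord_mat_def pX)
  moreover have "coord_mat (n + 2) Y p = 1\<^sub>m (n + 2)"
    by (rule eq_matI) (auto simp: coord_mat_def pY)
  moreover have "mpoly_eval p (pair_minor n i j) \<noteq> 0" if "i < j" "j < n + 3" for i j
  proof -
    have "other_index n i j \<le> n + 1" "other_index n i j \<noteq> i" using that by (auto simp: other_index_def)
    moreover have "p (j, Y (other_index n i j)) = 1"
      using that by (subst pY) (auto simp: other_index_def)
    ultimately show ?thesis using that by (simp add: pair_minor_def pY)
  qed
  ultimately have "p \<in> general_tuples n"
    by (simp add: general_tuples_def general_form_def eval_coord_det del: One_nat_def)
  then show ?thesis by blast
qed

lemma general_tuples_distinct: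
  assumes p: "p \<in> general_tuples n" and ij: "i < n + 3" "j < n + 3" "i \<noteq> j"
  shows "\<not> same_point factor_of (pt p i) (pt p j)"
proof -
  have *: "\<not> same_point factor_of (pt p i) (pt p j)" if ij: "i < j" "j < n + 3" for i j
  proof
    assume "same_point factor_of (pt p i) (pt p j)"
    then obtain c where "\<And>v. pt p i v = c (factor_of v) * pt p j v" by (auto simp: same_point_def)
    then have c: "p (i, Y k) = c Second * p (j, Y k)" for k by (simp add: pt_def)
    have "mpoly_eval p (pair_minor n i j) = 0"
      by (simp add: pair_minor_def c)
    moreover have "mpoly_eval p (pair_minor n i j) \<noteq> 0"
      using p ij by (auto simp: general_tuples_def general_form_def)
    ultimately show False by simp
  qed
  show ?thesis
  proof (cases "i < j")
    case True
    then show ?thesis using * ij by blast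
  next
    case False
    then show ?thesis using *[of j i] ij same_point_sym by fastforce
  qed
qed

lemma general_tuples_spanning:
  assumes p: "p \<in> general_tuples n"
  shows "spanning n (pt p)"
  unfolding spanning_def
proof (intro allI)
  fix w :: "pvar \<Rightarrow> 'a" and b
  have det: "det (coord_mat (n + 1) X p) \<noteq> 0" "det (coord_mat (n + 2) Y p) \<noteq> 0"
    using p by (auto simp: general_tuples_def general_form_def eval_coord_det)
  show "\<exists>g. \<forall>v\<in>pvars n. factor_of v = b \<longrightarrow> w v = (\<Sum>l<n + 2. g l * pt p l v)"
  proof (cases b)
    case First
    obtain g where g: "\<And>j. j < n + 1 \<Longrightarrow> w (X j) = (\<Sum>l<n + 1. g l * p (l, X j))"
      by (rule span_if_det[OF det(1), of "\<lambda>j. w (X j)"]) blast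
    have "w (X j) = (\<Sum>l<n + 2. (if l < n + 1 then g l else 0) * pt p l (X j))" if "j \<le> n" for j
    proof -
      have "(\<Sum>l<n + 2. (if l < n + 1 then g l else 0) * pt p l (X j)) =
          (\<Sum>l<n + 1. (if l < n + 1 then g l else 0) * pt p l (X j))"
        by simp
      also have "\<dots> = (\<Sum>l<n + 1. g l * p (l, X j))" by (rule sum.cong) (auto simp: pt_def)
      finally show ?thesis using g[of j] that by simp
    qed
    then show ?thesis
      by (intro exI[of _ "\<lambda>l. if l < n + 1 then g l else 0"]) (auto simp: pvars_def First)
  next
    case Second
    obtain g where g: "\<And>j. j < n + 2 \<Longrightarrow> w (Y j) = (\<Sum>l<n + 2. g l * p (l, Y j))"
      by (rule span_if_det[OF det(2), of "\<lambda>j. w (Y j)"]) blast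
    then show ?thesis
      by (intro exI[of _ g]) (auto simp: pvars_def Second pt_def)
  qed
qed

section \<open>The base locus\<close>

text \<open>
  A negative \<open>m\<^sub>i\<close> imposes no condition on \<open>G\<close>, whence the truncation to \<open>nat (m i)\<close>; it can only increase the bound.
\<close>

lemma multiplicity_bound:
  fixes m :: "nat \<Rightarrow> int" and n k :: nat and d1 d2 :: int
  assumes k: "k \<ge> 1" and d: "d1 \<ge> 0" "d2 \<ge> 0"
  defines "r \<equiv> nat (int (\<Sum>i<n + 3. nat (m i)) - int n * int (nat d1) - (int n + 1) * int (nat d2))"
  shows "nat (max 0 (int k * (\<Sum>i<n + 3. m i) - (int n * int k + int k - 1) * d1
       - (int n * int k + 2 * int k - 1) * d2)) \<le> k * r - (k - 1) * (nat d1 + nat d2)"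
proof -
  define S where "S = (\<Sum>i<n + 3. int (nat (m i)))"
  have "(\<Sum>i<n + 3. m i) \<le> S" unfolding S_def by (rule sum_mono) simp
  then have "int k * (\<Sum>i<n + 3. m i) \<le> int k * S" by (simp add: mult_left_mono)
  moreover have "int k * S - (int n * int k + int k - 1) * d1 - (int n * int k + 2 * int k - 1) * d2 =
      int k * (S - int n * d1 - (int n + 1) * d2) - (int k - 1) * (d1 + d2)"
    by (simp add: algebra_simps)
  moreover have "int k * (S - int n * d1 - (int n + 1) * d2) \<le> int k * int r"
    using d by (intro mult_left_mono) (auto simp: r_def S_def)
  moreover have "int k * int r - (int k - 1) * (d1 + d2) \<le> int (k * r - (k - 1) * (nat d1 + nat d2))"
  proof -
    have "int ((k - 1) * (nat d1 + nat d2)) = (int k - 1) * (d1 + d2)"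
      using k d by (simp add: of_nat_diff)
    moreover have "int (k * r) - int ((k - 1) * (nat d1 + nat d2)) \<le> int (k * r - (k - 1) * (nat d1 + nat d2))"
      by linarith
    ultimately show ?thesis by simp
  qed
  ultimately show ?thesis by (simp add: nat_le_iff)
qed

theorem proposition4p6:
  fixes n :: nat
  assumes "n \<ge> 1"
  shows "\<exists>U :: (nat \<times> pvar \<Rightarrow> 'a::{alg_closed_field, field_char_0}) set.
    zopen (tuple_vars n) tuple_block U \<and> U \<noteq> {} \<and>
    (\<forall>p\<in>U. \<forall>C. distinguished_curve n p C \<longrightarrow>
      (\<forall>k\<in>{1..n + 1}. \<forall>(d1 :: int) (d2 :: int) (m :: nat \<Rightarrow> int).
        in_base_locus_at_least n p (class_divisor n p d1 d2 m) (strict_transform n p (BS n k C))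
          (nat (max 0 (int k * (\<Sum>i<n + 3. m i)
                        - (int n * int k + int k - 1) * d1
                        - (int n * int k + 2 * int k - 1) * d2)))))"
proof (intro exI[of _ "general_tuples n"] conjI ballI allI impI)
  show "zopen (tuple_vars n) tuple_block (general_tuples n :: (nat \<times> pvar \<Rightarrow> 'a) set)"
    by (rule zopen_general_tuples)
  show "general_tuples n \<noteq> ({} :: (nat \<times> pvar \<Rightarrow> 'a) set)"
    by (rule general_tuples_nonempty[OF assms])
  fix p :: "nat \<times> pvar \<Rightarrow> 'a" and C k and d1 d2 :: int and m :: "nat \<Rightarrow> int"
  assume p: "p \<in> general_tuples n" and C: "distinguished_curve n p C" and k: "k \<in> {1..n + 1}"
  let ?V = "strict_transform n p (BS n k C)"
  let ?R = "nat (max 0 (int k * (\<Sum>i<n + 3. m i) - (int n * int k + int k - 1) * d1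
      - (int n * int k + 2 * int k - 1) * d2))"
  have pm: "p \<in> mproj (tuple_vars n) tuple_block" using p by (simp add: general_tuples_def)
  note distinct = general_tuples_distinct[OF p]
  show "in_base_locus_at_least n p (class_divisor n p d1 d2 m) ?V ?R"
    unfolding in_base_locus_at_least_def
  proof
    fix D assume "D \<in> linear_system n p (class_divisor n p d1 d2 m)"
    then obtain f where f: "f \<in> function_field n" "f \<noteq> 0"
      "\<And>q. q \<in> blow_up n p \<Longrightarrow> f * class_divisor n p d1 d2 m q \<in> local_ring n p q"
      and D: "D = (\<lambda>q. f * class_divisor n p d1 d2 m q)"
      unfolding linear_system_def by blast
    obtain G where G: "mform (pvars n) factor_of (bidegree (nat d1) (nat d2)) G" and d: "d1 \<ge> 0" "d2 \<ge> 0"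
      and fG: "f * to_fract (Var (X 0)) powi d1 * to_fract (Var (Y 0)) powi d2 = to_fract G"
      by (rule section_is_form[OF assms pm f])
    have at_points: "vanishes G (pt p i) (nat (m i))" if i: "i < n + 3" for i
      by (rule section_vanishes_at_point[OF assms pm i _ f(3) G d fG]) (use distinct i in auto)
    define r where "r = nat (int (\<Sum>i<n + 3. nat (m i)) - int n * int (nat d1) - (int n + 1) * int (nat d2))"
    have "vanishes G z r" if "z \<in> C" for z
      using form_vanishes_on_curve[OF G C distinct general_tuples_spanning[OF p] at_points that]
      by (simp add: r_def bidegree_def)
    note BS = form_vanishes_on_BS[OF G _ this, of k]
    have van: "vanishes G (blow_down q) ?R" if q: "q \<in> ?V" for q
    proof (rule vanishes_mono)
      show "vanishes G (blow_down q) (k * r - (k - 1) * (nat d1 + nat d2))"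
        unfolding vanishes_def
      proof (intro allI impI)
        fix \<alpha> :: "pvar \<Rightarrow>\<^sub>0 nat" assume \<alpha>: "deg \<alpha> < k * r - (k - 1) * (nat d1 + nat d2)"
        show "mpoly_eval (blow_down q) (hasse \<alpha> G) = 0"
        proof (rule strict_transform_forms[OF BS _ q])
          show "k \<ge> 1" using k by simp
        next
          fix F assume "F \<in> {hasse \<alpha> G | \<alpha>. deg \<alpha> < k * r - (k - 1) * (bidegree (nat d1) (nat d2) First + bidegree (nat d1) (nat d2) Second)}"
          then show "\<exists>d. mform (pvars n) factor_of d F" using hasse_mform[OF G] by blast
        qed (use \<alpha> in \<open>auto simp: bidegree_def\<close>)
      qed
      show "?R \<le> k * r - (k - 1) * (nat d1 + nat d2)"
        unfolding r_def by (rule multiplicity_bound) (use k d in auto)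
    qed
    show "mult_along_at_least n p D ?V ?R"
      unfolding mult_along_at_least_def mult_at_least_def D
    proof (intro exI[of _ "away n p"] conjI ballI)
      show "zopen (bvars n) block_of (away n p)" by (rule zopen_away[OF pm])
      show "?V \<subseteq> zclosure (bvars n) block_of (?V \<inter> away n p)" by (rule strict_transform_dense)
      fix q assume q: "q \<in> ?V \<inter> away n p"
      show "f * class_divisor n p d1 d2 m q \<in> max_ideal_power n p q ?R"
        by (rule divisor_multiplicity[OF pm _ _ G d fG van]) (use q strict_transform_blow_up in auto)
    qed
  qed
qed

end
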